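(* Let $d$ be an odd positive integer and let $\mathscr{C}$ be a $K$-linear, Hom-finite, $2d$-Calabi-Yau $(d+2)$-angulated category with split idempotents. Let $\mathscr{T}=\mathrm{add}(T)$ be an Oppermann-Thomas cluster tilting subcategory of $\mathscr{C}$. Assume that for all indecomposable objects $c,x\in\mathscr{C}$, the spaces $\mathrm{Hom}_{\mathscr{C}/[\Sigma^d\mathscr{T}]}(c,x)$ and $\mathrm{Hom}_{\mathscr{C}/[\Sigma^d\mathscr{T}]}(x,\Sigma^d(c))$ are not simultaneously non-zero. Then each indecomposable object of $\mathscr{C}$ is uniquely determined up to isomorphism by its index with respect to $\mathscr{T}$; that is, if $c,c'\in\mathscr{C}$ are indecomposable and $\mathrm{Ind}_{\mathscr{T}}(c)=\mathrm{Ind}_{\mathscr{T}}(c')$ in $K_0^{\mathrm{Split}}(\mathscr{T})$, then $c\cong c'$.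
   Context: $K$ is an algebraically closed field. $(d+2)$-angulated categories (Geiss-Keller-Oppermann). Let $d\ge 1$ be an integer and $\mathscr{C}$ an additive category with an automorphism denoted $\Sigma^d$ (inverse $\Sigma^{-d}$; $\Sigma^d$ need not be a $d$-th power of a functor). A $\Sigma^d$-sequence is a diagram $c^0\xrightarrow{\gamma^0}c^1\to\cdots\to c^{d+1}\xrightarrow{\gamma^{d+1}}\Sigma^d(c^0)$. The category $\mathscr{C}$ is $(d+2)$-angulated if it is equipped with a class of $\Sigma^d$-sequences, called $(d+2)$-angles, such that: (N1) the class is closed under sums and summands, contains $c\xrightarrow{\mathrm{id}}c\to0\to\cdots\to0\to\Sigma^d(c)$ for each $c$, and each morphism $\gamma^0$ is the first morphism of some $(d+2)$-angle; (N2) a $\Sigma^d$-sequence $c^0\xrightarrow{\gamma^0}c^1\xrightarrow{\gamma^1}c^2\to\cdots\to c^{d+1}\xrightarrow{\gamma^{d+1}}\Sigma^d(c^0)$ is a $(d+2)$-angle if and only if its left rotation $c^1\xrightarrow{\gamma^1}c^2\to\cdots\to c^{d+1}\xrightarrow{\gamma^{d+1}}\Sigma^d(c^0)\xrightarrow{(-1)^d\Sigma^d(\gamma^0)}\Sigma^d(c^1)$ is one; (N3) given two $(d+2)$-angles $b^0\to\cdots\to b^{d+1}\to\Sigma^d(b^0)$ and $c^0\to\cdots\to c^{d+1}\to\Sigma^d(c^0)$, and morphisms $b^0\to c^0$, $b^1\to c^1$ making the first square commute, these extend to a morphism of $\Sigma^d$-sequences (with last component $\Sigma^d$ of the first); (N4)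 in (N3) the extension can be chosen such that its mapping cone $b^1\oplus c^0\to b^2\oplus c^1\to\cdots\to\Sigma^d(b^0)\oplus c^{d+1}\to\Sigma^d(b^1)\oplus\Sigma^d(c^0)$ is a $(d+2)$-angle. Calabi-Yau. With $D=\mathrm{Hom}_K(-,K)$, a Serre functor for $\mathscr{C}$ is an auto-equivalence $S:\mathscr{C}\to\mathscr{C}$ with isomorphisms $\mathrm{Hom}_{\mathscr{C}}(Y,SX)\to D\mathrm{Hom}_{\mathscr{C}}(X,Y)$ natural in $X$ and $Y$. $\mathscr{C}$ is $2d$-Calabi-Yau if it admits a Serre functor isomorphic to $\Sigma^{2d}:=(\Sigma^d)^2$. Oppermann-Thomas cluster tilting. An object $T$ of $\mathscr{C}$, with $\mathscr{T}=\mathrm{add}(T)$ (full subcategory), is an Oppermann-Thomas cluster tilting object, and $\mathscr{T}$ is an Oppermann-Thomas cluster tilting subcategory, if (i) $\mathrm{Hom}_{\mathscr{C}}(\mathscr{T},\Sigma^d(\mathscr{T}))=0$, and (ii) for every $c\in\mathscr{C}$ there is a $(d+2)$-angle $t_d\to t_{d-1}\to\cdots\to t_0\to c\to\Sigma^d(t_d)$ with all $t_i\in\mathscr{T}$. Notation. For a full subcategory $\mathscr{S}\subseteq\mathscr{C}$, $\mathrm{Hom}_{\mathscr{C}}^{[\mathscr{S}]}(x,y)$ is the space of morphisms $x\to y$ in $\mathscr{C}$ that factor through some object of $\mathscr{S}$. The quotient category $\mathscr{C}/[\Sigma^d\mathscr{T}]$ has the same objects as $\mathscr{C}$ and $\mathrm{Hom}_{\mathscr{C}/[\Sigma^d\mathscr{T}]}(x,y)=\mathrm{Hom}_{\mathscr{C}}(x,y)/\mathrm{Hom}_{\mathscr{C}}^{[\Sigma^d\mathscr{T}]}(x,y)$.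 Index. $K_0^{\mathrm{Split}}(\mathscr{T})$ is the abelian group generated by objects of $\mathscr{T}$ modulo the relations $[t]=[t']+[t'']$ whenever $t\cong t'\oplus t''$. For $c\in\mathscr{C}$, $\mathrm{Ind}_{\mathscr{T}}(c)=\sum_{i=0}^d(-1)^i[t_i]$, where $t_d\to\cdots\to t_0\to c\to\Sigma^d(t_d)$ is any $(d+2)$-angle with all $t_i\in\mathscr{T}$; this is well defined (Jørgensen) when $\mathscr{C}$ is $K$-linear, Hom-finite with split idempotents. *)

theory Defs
  imports
    "Jordan_Normal_Form.Missing_VectorSpace"
    "HOL-Algebra.Algebraic_Closure"
    "HOL-Algebra.Free_Abelian_Groups"
begin

section \<open>Linear categories\<close>

text \<open>
  The morphisms from \<open>x\<close> to \<open>y\<close> are the elements of \<open>carrier (Hom C x y)\<close>. Hom spaces of different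
  pairs of objects may overlap, hence composition takes the three objects involved as arguments:
  \<open>Comp C x y z g f\<close> is the composite of \<open>f : x \<rightarrow> y\<close> followed by \<open>g : y \<rightarrow> z\<close>.
  As everywhere in the library, the fields \<open>mult\<close> and \<open>one\<close> of a \<open>module\<close> record are irrelevant.
\<close>

record ('o, 'k, 'm) lin_cat =
  Obj :: "'o set"
  Hom :: "'o \<Rightarrow> 'o \<Rightarrow> ('k, 'm) module"
  Comp :: "'o \<Rightarrow> 'o \<Rightarrow> 'o \<Rightarrow> 'm \<Rightarrow> 'm \<Rightarrow> 'm"
  Ident :: "'o \<Rightarrow> 'm"

abbreviation mor :: "('o, 'k, 'm) lin_cat \<Rightarrow> 'o \<Rightarrow> 'o \<Rightarrow> 'm set" where
  "mor C x y \<equiv> carrier (Hom C x y)"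

locale linear_category =
  fixes K :: "('k, 'r) ring_scheme" and C :: "('o, 'k, 'm) lin_cat"
  assumes Hom_vectorspace: "\<lbrakk>x \<in> Obj C; y \<in> Obj C\<rbrakk> \<Longrightarrow> vectorspace K (Hom C x y)"
    and Comp_closed:
      "\<lbrakk>x \<in> Obj C; y \<in> Obj C; z \<in> Obj C; g \<in> mor C y z; f \<in> mor C x y\<rbrakk>
        \<Longrightarrow> Comp C x y z g f \<in> mor C x z"
    and Ident_closed: "x \<in> Obj C \<Longrightarrow> Ident C x \<in> mor C x x"
    and Comp_assoc:
      "\<lbrakk>w \<in> Obj C; x \<in> Obj C; y \<in> Obj C; z \<in> Obj C;
        h \<in> mor C y z; g \<in> mor C x y; f \<in> mor C w x\<rbrakk>
        \<Longrightarrow> Comp C w x z (Comp C x y z h g) f = Comp C w y z h (Comp C w x y g f)"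
    and Ident_left:
      "\<lbrakk>x \<in> Obj C; y \<in> Obj C; f \<in> mor C x y\<rbrakk> \<Longrightarrow> Comp C x y y (Ident C y) f = f"
    and Ident_right:
      "\<lbrakk>x \<in> Obj C; y \<in> Obj C; f \<in> mor C x y\<rbrakk> \<Longrightarrow> Comp C x x y f (Ident C x) = f"
    and Comp_linear_left:
      "\<lbrakk>x \<in> Obj C; y \<in> Obj C; z \<in> Obj C; f \<in> mor C x y\<rbrakk>
        \<Longrightarrow> (\<lambda>g. Comp C x y z g f) \<in> LinearCombinations.module_hom K (Hom C y z) (Hom C x z)"
    and Comp_linear_right:
      "\<lbrakk>x \<in> Obj C; y \<in> Obj C; z \<in> Obj C; g \<in> mor C y z\<rbrakk>
        \<Longrightarrow> (\<lambda>f. Comp C x y z g f) \<in> LinearCombinations.module_hom K (Hom C x y) (Hom C x z)"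

definition hom_finite :: "('k, 'r) ring_scheme \<Rightarrow> ('o, 'k, 'm) lin_cat \<Rightarrow> bool" where
  "hom_finite K C \<longleftrightarrow> (\<forall>x\<in>Obj C. \<forall>y\<in>Obj C. vectorspace.fin_dim K (Hom C x y))"

definition inverse_mor :: "('o, 'k, 'm) lin_cat \<Rightarrow> 'o \<Rightarrow> 'o \<Rightarrow> 'm \<Rightarrow> 'm \<Rightarrow> bool" where
  "inverse_mor C x y f g \<longleftrightarrow> f \<in> mor C x y \<and> g \<in> mor C y x \<and>
     Comp C x y x g f = Ident C x \<and> Comp C y x y f g = Ident C y"

definition iso_mor :: "('o, 'k, 'm) lin_cat \<Rightarrow> 'o \<Rightarrow> 'o \<Rightarrow> 'm \<Rightarrow> bool" where
  "iso_mor C x y f \<longleftrightarrow> (\<exists>g. inverse_mor C x y f g)"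

definition isomorphic :: "('o, 'k, 'm) lin_cat \<Rightarrow> 'o \<Rightarrow> 'o \<Rightarrow> bool" where
  "isomorphic C x y \<longleftrightarrow> x \<in> Obj C \<and> y \<in> Obj C \<and> (\<exists>f. iso_mor C x y f)"

definition zero_object :: "('o, 'k, 'm) lin_cat \<Rightarrow> 'o \<Rightarrow> bool" where
  "zero_object C z \<longleftrightarrow> z \<in> Obj C \<and>
     (\<forall>x\<in>Obj C. mor C z x = {\<zero>\<^bsub>Hom C z x\<^esub>} \<and> mor C x z = {\<zero>\<^bsub>Hom C x z\<^esub>})"

text \<open>\<open>z\<close> is a direct sum of \<open>x\<close> and \<open>y\<close> with inclusions \<open>i1, i2\<close> and projections \<open>p1, p2\<close>.\<close>

definition biproduct ::
  "('o, 'k, 'm) lin_cat \<Rightarrow> 'o \<Rightarrow> 'o \<Rightarrow> 'o \<Rightarrow> 'm \<Rightarrow> 'm \<Rightarrow> 'm \<Rightarrow> 'm \<Rightarrow> bool" where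
  "biproduct C x y z i1 i2 p1 p2 \<longleftrightarrow>
     x \<in> Obj C \<and> y \<in> Obj C \<and> z \<in> Obj C \<and>
     i1 \<in> mor C x z \<and> i2 \<in> mor C y z \<and> p1 \<in> mor C z x \<and> p2 \<in> mor C z y \<and>
     Comp C x z x p1 i1 = Ident C x \<and> Comp C y z y p2 i2 = Ident C y \<and>
     Comp C y z x p1 i2 = \<zero>\<^bsub>Hom C y x\<^esub> \<and> Comp C x z y p2 i1 = \<zero>\<^bsub>Hom C x y\<^esub> \<and>
     Comp C z x z i1 p1 \<oplus>\<^bsub>Hom C z z\<^esub> Comp C z y z i2 p2 = Ident C z"

definition is_direct_sum :: "('o, 'k, 'm) lin_cat \<Rightarrow> 'o \<Rightarrow> 'o \<Rightarrow> 'o \<Rightarrow> bool" where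
  "is_direct_sum C x y z \<longleftrightarrow> (\<exists>i1 i2 p1 p2. biproduct C x y z i1 i2 p1 p2)"

locale additive_category = linear_category K C
  for K :: "('k, 'r) ring_scheme" and C :: "('o, 'k, 'm) lin_cat" +
  assumes zero_object_exists: "\<exists>z. zero_object C z"
    and direct_sum_exists: "\<lbrakk>x \<in> Obj C; y \<in> Obj C\<rbrakk> \<Longrightarrow> \<exists>z. is_direct_sum C x y z"

definition indecomposable :: "('o, 'k, 'm) lin_cat \<Rightarrow> 'o \<Rightarrow> bool" where
  "indecomposable C x \<longleftrightarrow> x \<in> Obj C \<and> \<not> zero_object C x \<and>
     (\<forall>y z. is_direct_sum C y z x \<longrightarrow> zero_object C y \<or> zero_object C z)"

definition split_idempotents :: "('o, 'k, 'm) lin_cat \<Rightarrow> bool" where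
  "split_idempotents C \<longleftrightarrow>
     (\<forall>x\<in>Obj C. \<forall>e\<in>mor C x x. Comp C x x x e e = e \<longrightarrow>
       (\<exists>y\<in>Obj C. \<exists>r\<in>mor C x y. \<exists>s\<in>mor C y x.
          Comp C x y x s r = e \<and> Comp C y x y r s = Ident C y))"

text \<open>\<open>add(T)\<close>: the direct summands of finite direct sums of copies of \<open>T\<close>.\<close>

inductive_set copies :: "('o, 'k, 'm) lin_cat \<Rightarrow> 'o \<Rightarrow> 'o set" for C T where
  zero: "zero_object C z \<Longrightarrow> z \<in> copies C T"
| step: "\<lbrakk>s \<in> copies C T; is_direct_sum C T s s'\<rbrakk> \<Longrightarrow> s' \<in> copies C T"

definition add_closure :: "('o, 'k, 'm) lin_cat \<Rightarrow> 'o \<Rightarrow> 'o set" where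
  "add_closure C T = {t. \<exists>u. \<exists>s\<in>copies C T. is_direct_sum C t u s}"

section \<open>Functors, Serre duality\<close>

text \<open>\<open>fmor F x y\<close> is the action of the functor on the morphisms from \<open>x\<close> to \<open>y\<close>.\<close>

record ('o, 'm) endofunctor =
  fobj :: "'o \<Rightarrow> 'o"
  fmor :: "'o \<Rightarrow> 'o \<Rightarrow> 'm \<Rightarrow> 'm"

definition is_functor :: "('o, 'k, 'm) lin_cat \<Rightarrow> ('o, 'm) endofunctor \<Rightarrow> bool" where
  "is_functor C F \<longleftrightarrow>
     (\<forall>x\<in>Obj C. fobj F x \<in> Obj C) \<and>
     (\<forall>x\<in>Obj C. \<forall>y\<in>Obj C. \<forall>f\<in>mor C x y. fmor F x y f \<in> mor C (fobj F x) (fobj F y)) \<and>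
     (\<forall>x\<in>Obj C. fmor F x x (Ident C x) = Ident C (fobj F x)) \<and>
     (\<forall>x\<in>Obj C. \<forall>y\<in>Obj C. \<forall>z\<in>Obj C. \<forall>f\<in>mor C x y. \<forall>g\<in>mor C y z.
        fmor F x z (Comp C x y z g f) =
        Comp C (fobj F x) (fobj F y) (fobj F z) (fmor F y z g) (fmor F x y f))"

definition is_additive_functor :: "('o, 'k, 'm) lin_cat \<Rightarrow> ('o, 'm) endofunctor \<Rightarrow> bool" where
  "is_additive_functor C F \<longleftrightarrow> is_functor C F \<and>
     (\<forall>x\<in>Obj C. \<forall>y\<in>Obj C. \<forall>f\<in>mor C x y. \<forall>g\<in>mor C x y.
        fmor F x y (f \<oplus>\<^bsub>Hom C x y\<^esub> g) =
        fmor F x y f \<oplus>\<^bsub>Hom C (fobj F x) (fobj F y)\<^esub> fmor F x y g)"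

definition id_functor :: "('o, 'm) endofunctor" where
  "id_functor = \<lparr>fobj = (\<lambda>x. x), fmor = (\<lambda>x y f. f)\<rparr>"

definition comp_functor ::
  "('o, 'm) endofunctor \<Rightarrow> ('o, 'm) endofunctor \<Rightarrow> ('o, 'm) endofunctor" where
  "comp_functor G F =
     \<lparr>fobj = (\<lambda>x. fobj G (fobj F x)),
      fmor = (\<lambda>x y f. fmor G (fobj F x) (fobj F y) (fmor F x y f))\<rparr>"

definition eq_functor ::
  "('o, 'k, 'm) lin_cat \<Rightarrow> ('o, 'm) endofunctor \<Rightarrow> ('o, 'm) endofunctor \<Rightarrow> bool" where
  "eq_functor C F G \<longleftrightarrow>
     (\<forall>x\<in>Obj C. fobj F x = fobj G x) \<and>
     (\<forall>x\<in>Obj C. \<forall>y\<in>Obj C. \<forall>f\<in>mor C x y. fmor F x y f = fmor G x y f)"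

text \<open>
  An automorphism of an additive category has a strict inverse. Additivity is part of the notion of
  a functor between additive categories; for automorphisms it is in fact automatic.
\<close>

definition automorphism :: "('o, 'k, 'm) lin_cat \<Rightarrow> ('o, 'm) endofunctor \<Rightarrow> bool" where
  "automorphism C F \<longleftrightarrow> is_additive_functor C F \<and>
     (\<exists>G. is_additive_functor C G \<and>
        eq_functor C (comp_functor G F) id_functor \<and> eq_functor C (comp_functor F G) id_functor)"

definition nat_iso ::
  "('o, 'k, 'm) lin_cat \<Rightarrow> ('o, 'm) endofunctor \<Rightarrow> ('o, 'm) endofunctor \<Rightarrow> bool" where
  "nat_iso C F G \<longleftrightarrow>
     (\<exists>\<eta>. (\<forall>x\<in>Obj C. iso_mor C (fobj F x) (fobj G x) (\<eta> x)) \<and>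
          (\<forall>x\<in>Obj C. \<forall>y\<in>Obj C. \<forall>f\<in>mor C x y.
             Comp C (fobj F x) (fobj F y) (fobj G y) (\<eta> y) (fmor F x y f) =
             Comp C (fobj F x) (fobj G x) (fobj G y) (fmor G x y f) (\<eta> x)))"

definition auto_equivalence :: "('o, 'k, 'm) lin_cat \<Rightarrow> ('o, 'm) endofunctor \<Rightarrow> bool" where
  "auto_equivalence C F \<longleftrightarrow> is_functor C F \<and>
     (\<exists>G. is_functor C G \<and>
        nat_iso C (comp_functor G F) id_functor \<and> nat_iso C (comp_functor F G) id_functor)"

definition ring_as_module :: "('k, 'r) ring_scheme \<Rightarrow> ('k, 'k) module" where
  "ring_as_module K =
     \<lparr>carrier = carrier K, monoid.mult = monoid.mult K, one = one K,
      ring.zero = ring.zero K, ring.add = ring.add K, smult = monoid.mult K\<rparr>"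

text \<open>The dual \<open>D V\<close>; linear forms are restricted to \<open>carrier V\<close> so that they are equal as soon as
  they agree on \<open>V\<close>.\<close>

definition dual_space :: "('k, 'r) ring_scheme \<Rightarrow> ('k, 'm) module \<Rightarrow> ('k, 'm \<Rightarrow> 'k) module" where
  "dual_space K V = (ring.func_space K (carrier V))
     \<lparr>carrier := LinearCombinations.module_hom K V (ring_as_module K) \<inter> extensional (carrier V)\<rparr>"

definition serre_functor ::
  "('k, 'r) ring_scheme \<Rightarrow> ('o, 'k, 'm) lin_cat \<Rightarrow> ('o, 'm) endofunctor \<Rightarrow> bool" where
  "serre_functor K C S \<longleftrightarrow> auto_equivalence C S \<and>
     (\<exists>\<theta> :: 'o \<Rightarrow> 'o \<Rightarrow> 'm \<Rightarrow> 'm \<Rightarrow> 'k.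
        (\<forall>x\<in>Obj C. \<forall>y\<in>Obj C.
           \<theta> x y \<in> LinearCombinations.module_hom K (Hom C y (fobj S x)) (dual_space K (Hom C x y)) \<and>
           bij_betw (\<theta> x y) (mor C y (fobj S x)) (carrier (dual_space K (Hom C x y)))) \<and>
        (\<forall>x\<in>Obj C. \<forall>x'\<in>Obj C. \<forall>y\<in>Obj C. \<forall>f\<in>mor C x x'. \<forall>h\<in>mor C y (fobj S x). \<forall>u\<in>mor C x' y.
           \<theta> x' y (Comp C y (fobj S x) (fobj S x') (fmor S x x' f) h) u =
           \<theta> x y h (Comp C x x' y u f)) \<and>
        (\<forall>x\<in>Obj C. \<forall>y\<in>Obj C. \<forall>y'\<in>Obj C. \<forall>g\<in>mor C y' y. \<forall>h\<in>mor C y (fobj S x). \<forall>u\<in>mor C x y'.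
           \<theta> x y' (Comp C y' y (fobj S x) h g) u =
           \<theta> x y h (Comp C x y' y g u)))"

text \<open>With \<open>F\<close> standing for \<open>\<Sigma>\<^sup>d\<close>, this says that the category is \<open>2d\<close>-Calabi-Yau.\<close>

definition calabi_yau ::
  "('k, 'r) ring_scheme \<Rightarrow> ('o, 'k, 'm) lin_cat \<Rightarrow> ('o, 'm) endofunctor \<Rightarrow> bool" where
  "calabi_yau K C F \<longleftrightarrow> (\<exists>S. serre_functor K C S \<and> nat_iso C S (comp_functor F F))"

section \<open>\<open>(d+2)\<close>-angulated categories\<close>

text \<open>
  A \<open>\<Sigma>\<^sup>d\<close>-sequence has objects \<open>sobj P 0, \<dots>, sobj P (d+1)\<close> and morphisms
  \<open>smor P 0, \<dots>, smor P (d+1)\<close>; values at larger indices are meaningless. A class of sequences that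
  is closed under summands does not depend on them, because \<open>seq_biproduct\<close> does not.

  \<open>ext_obj\<close> and \<open>ext_mor\<close> continue a family beyond \<open>d+1\<close> by applying \<open>\<Sigma>\<^sup>d\<close>; thus the object with
  index \<open>d+2+i\<close> is \<open>\<Sigma>\<^sup>d\<close> of the one with index \<open>i\<close>, and no signs are inserted. In \<open>ext_mor\<close> the
  \<open>i\<close>-th morphism goes from \<open>a i\<close> to \<open>b i\<close>.
\<close>

record ('o, 'm) sigma_seq =
  sobj :: "nat \<Rightarrow> 'o"
  smor :: "nat \<Rightarrow> 'm"

definition ext_obj :: "('o, 'm) endofunctor \<Rightarrow> nat \<Rightarrow> (nat \<Rightarrow> 'o) \<Rightarrow> nat \<Rightarrow> 'o" where
  "ext_obj F d a i = (if i \<le> d + 1 then a i else fobj F (a (i - (d + 2))))"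

definition ext_mor ::
  "('o, 'm) endofunctor \<Rightarrow> nat \<Rightarrow> (nat \<Rightarrow> 'o) \<Rightarrow> (nat \<Rightarrow> 'o) \<Rightarrow> (nat \<Rightarrow> 'm) \<Rightarrow> nat \<Rightarrow> 'm" where
  "ext_mor F d a b f i =
     (if i \<le> d + 1 then f i else fmor F (a (i - (d + 2))) (b (i - (d + 2))) (f (i - (d + 2))))"

abbreviation eobj :: "('o, 'm) endofunctor \<Rightarrow> nat \<Rightarrow> ('o, 'm) sigma_seq \<Rightarrow> nat \<Rightarrow> 'o" where
  "eobj F d P \<equiv> ext_obj F d (sobj P)"

abbreviation emor :: "('o, 'm) endofunctor \<Rightarrow> nat \<Rightarrow> ('o, 'm) sigma_seq \<Rightarrow> nat \<Rightarrow> 'm" where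
  "emor F d P \<equiv> ext_mor F d (sobj P) (\<lambda>i. eobj F d P (Suc i)) (smor P)"

definition is_sigma_seq ::
  "('o, 'k, 'm) lin_cat \<Rightarrow> ('o, 'm) endofunctor \<Rightarrow> nat \<Rightarrow> ('o, 'm) sigma_seq \<Rightarrow> bool" where
  "is_sigma_seq C F d P \<longleftrightarrow>
     (\<forall>i\<le>d + 1. sobj P i \<in> Obj C \<and> smor P i \<in> mor C (sobj P i) (eobj F d P (Suc i)))"

text \<open>Only \<open>f 0, \<dots>, f (d+1)\<close> matter; the last component is \<open>\<Sigma>\<^sup>d\<close> of the first one by \<open>ext_mor\<close>.\<close>

definition seq_morphism ::
  "('o, 'k, 'm) lin_cat \<Rightarrow> ('o, 'm) endofunctor \<Rightarrow> nat \<Rightarrow>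
    ('o, 'm) sigma_seq \<Rightarrow> ('o, 'm) sigma_seq \<Rightarrow> (nat \<Rightarrow> 'm) \<Rightarrow> bool" where
  "seq_morphism C F d P Q f \<longleftrightarrow>
     (\<forall>i\<le>d + 1. f i \<in> mor C (sobj P i) (sobj Q i) \<and>
        Comp C (sobj P i) (eobj F d P (Suc i)) (eobj F d Q (Suc i))
          (ext_mor F d (sobj P) (sobj Q) f (Suc i)) (smor P i) =
        Comp C (sobj P i) (sobj Q i) (eobj F d Q (Suc i)) (smor Q i) (f i))"

text \<open>\<open>R\<close> is a direct sum of \<open>P\<close> and \<open>Q\<close> in the category of \<open>\<Sigma>\<^sup>d\<close>-sequences.\<close>

definition seq_biproduct ::
  "('o, 'k, 'm) lin_cat \<Rightarrow> ('o, 'm) endofunctor \<Rightarrow> nat \<Rightarrow>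
    ('o, 'm) sigma_seq \<Rightarrow> ('o, 'm) sigma_seq \<Rightarrow> ('o, 'm) sigma_seq \<Rightarrow> bool" where
  "seq_biproduct C F d P Q R \<longleftrightarrow>
     is_sigma_seq C F d P \<and> is_sigma_seq C F d Q \<and> is_sigma_seq C F d R \<and>
     (\<exists>i1 i2 p1 p2.
        seq_morphism C F d P R i1 \<and> seq_morphism C F d Q R i2 \<and>
        seq_morphism C F d R P p1 \<and> seq_morphism C F d R Q p2 \<and>
        (\<forall>i\<le>d + 1. biproduct C (sobj P i) (sobj Q i) (sobj R i) (i1 i) (i2 i) (p1 i) (p2 i)))"

definition rotate_seq ::
  "('o, 'k, 'm) lin_cat \<Rightarrow> ('o, 'm) endofunctor \<Rightarrow> nat \<Rightarrow>
    ('o, 'm) sigma_seq \<Rightarrow> ('o, 'm) sigma_seq" where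
  "rotate_seq C F d P =
     \<lparr>sobj = (\<lambda>i. eobj F d P (Suc i)),
      smor = (\<lambda>i. if i \<le> d then smor P (Suc i)
        else if even d then emor F d P (d + 2)
        else \<ominus>\<^bsub>Hom C (eobj F d P (d + 2)) (eobj F d P (d + 3))\<^esub> emor F d P (d + 2))\<rparr>"

text \<open>
  \<open>R\<close> is a mapping cone of \<open>f : P \<rightarrow> Q\<close>. Its \<open>i\<close>-th object is a direct sum of the \<open>(i+1)\<close>-st object
  of \<open>P\<close> and the \<open>i\<close>-th object of \<open>Q\<close>, and with the sign convention of Geiss, Keller and Oppermann
  its \<open>i\<close>-th morphism is the matrix with first row \<open>(-\<xi>\<^sup>i\<^sup>+\<^sup>1, 0)\<close> and second row
  \<open>(f\<^sup>i\<^sup>+\<^sup>1, \<upsilon>\<^sup>i)\<close>, where \<open>\<xi>\<close> and \<open>\<upsilon>\<close> are the morphisms of \<open>P\<close> and \<open>Q\<close>. The last target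
  \<open>\<Sigma>\<^sup>d (sobj R 0)\<close> carries the direct sum structure obtained by applying \<open>\<Sigma>\<^sup>d\<close> to that of \<open>sobj R 0\<close>.
\<close>

definition is_mapping_cone ::
  "('o, 'k, 'm) lin_cat \<Rightarrow> ('o, 'm) endofunctor \<Rightarrow> nat \<Rightarrow>
    ('o, 'm) sigma_seq \<Rightarrow> ('o, 'm) sigma_seq \<Rightarrow> (nat \<Rightarrow> 'm) \<Rightarrow> ('o, 'm) sigma_seq \<Rightarrow> bool" where
  "is_mapping_cone C F d P Q f R \<longleftrightarrow> is_sigma_seq C F d R \<and>
     (\<exists>i1 i2 p1 p2.
        (\<forall>i\<le>d + 1. biproduct C (eobj F d P (Suc i)) (sobj Q i) (sobj R i)
           (i1 i) (i2 i) (p1 i) (p2 i)) \<and>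
        (\<forall>i\<le>d + 1.
           let x = eobj F d P; y = eobj F d Q; z = eobj F d R;
               j1 = ext_mor F d (\<lambda>k. x (Suc k)) (sobj R) i1 (Suc i);
               j2 = ext_mor F d (sobj Q) (sobj R) i2 (Suc i);
               H = Hom C (z i) (z (Suc i))
           in smor R i =
                (\<ominus>\<^bsub>H\<^esub> Comp C (z i) (x (Suc (Suc i))) (z (Suc i)) j1
                    (Comp C (z i) (x (Suc i)) (x (Suc (Suc i))) (emor F d P (Suc i)) (p1 i)))
                \<oplus>\<^bsub>H\<^esub> Comp C (z i) (y (Suc i)) (z (Suc i)) j2
                    (Comp C (z i) (x (Suc i)) (y (Suc i))
                       (ext_mor F d (sobj P) (sobj Q) f (Suc i)) (p1 i))
                \<oplus>\<^bsub>H\<^esub> Comp C (z i) (y (Suc i)) (z (Suc i)) j2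
                    (Comp C (z i) (y i) (y (Suc i)) (smor Q i) (p2 i))))"

locale angulated_category = additive_category K C
  for K :: "('k, 'r) ring_scheme" and C :: "('o, 'k, 'm) lin_cat" +
  fixes F :: "('o, 'm) endofunctor" and d :: nat and angles :: "('o, 'm) sigma_seq set"
  assumes d_pos: "1 \<le> d"
    and automorphism: "automorphism C F"
    and angles_are_seqs: "P \<in> angles \<Longrightarrow> is_sigma_seq C F d P"
    and N1_sums: "\<lbrakk>P \<in> angles; Q \<in> angles; seq_biproduct C F d P Q R\<rbrakk> \<Longrightarrow> R \<in> angles"
    and N1_summands: "\<lbrakk>R \<in> angles; seq_biproduct C F d P Q R\<rbrakk> \<Longrightarrow> P \<in> angles"
    and N1_trivial:
      "\<lbrakk>c \<in> Obj C; is_sigma_seq C F d P; sobj P 0 = c; sobj P 1 = c; smor P 0 = Ident C c;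
        \<And>i. \<lbrakk>2 \<le> i; i \<le> d + 1\<rbrakk> \<Longrightarrow> zero_object C (sobj P i)\<rbrakk> \<Longrightarrow> P \<in> angles"
    and N1_exists:
      "\<lbrakk>x \<in> Obj C; y \<in> Obj C; f \<in> mor C x y\<rbrakk>
        \<Longrightarrow> \<exists>P\<in>angles. sobj P 0 = x \<and> sobj P 1 = y \<and> smor P 0 = f"
    and N2: "is_sigma_seq C F d P \<Longrightarrow> P \<in> angles \<longleftrightarrow> rotate_seq C F d P \<in> angles"
    and N3:
      "\<lbrakk>P \<in> angles; Q \<in> angles; f0 \<in> mor C (sobj P 0) (sobj Q 0); f1 \<in> mor C (sobj P 1) (sobj Q 1);
        Comp C (sobj P 0) (sobj P 1) (sobj Q 1) f1 (smor P 0) =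
        Comp C (sobj P 0) (sobj Q 0) (sobj Q 1) (smor Q 0) f0\<rbrakk>
        \<Longrightarrow> \<exists>f. f 0 = f0 \<and> f 1 = f1 \<and> seq_morphism C F d P Q f"
    and N4:
      "\<lbrakk>P \<in> angles; Q \<in> angles; f0 \<in> mor C (sobj P 0) (sobj Q 0); f1 \<in> mor C (sobj P 1) (sobj Q 1);
        Comp C (sobj P 0) (sobj P 1) (sobj Q 1) f1 (smor P 0) =
        Comp C (sobj P 0) (sobj Q 0) (sobj Q 1) (smor Q 0) f0\<rbrakk>
        \<Longrightarrow> \<exists>f. f 0 = f0 \<and> f 1 = f1 \<and> seq_morphism C F d P Q f \<and>
              (\<exists>R. is_mapping_cone C F d P Q f R \<and> R \<in> angles)"

section \<open>Cluster tilting objects, quotient category, index\<close>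

text \<open>
  An angle \<open>t\<^sub>d \<rightarrow> \<dots> \<rightarrow> t\<^sub>0 \<rightarrow> c \<rightarrow> \<Sigma>\<^sup>d t\<^sub>d\<close> with all \<open>t\<^sub>i\<close> in \<open>A\<close>. As a
  \<open>\<Sigma>\<^sup>d\<close>-sequence \<open>P\<close> it has \<open>t\<^sub>i = sobj P (d - i)\<close> and \<open>c = sobj P (d + 1)\<close>.
\<close>

definition resolution ::
  "nat \<Rightarrow> ('o, 'm) sigma_seq set \<Rightarrow> 'o set \<Rightarrow> 'o \<Rightarrow> ('o, 'm) sigma_seq \<Rightarrow> bool" where
  "resolution d angles A c P \<longleftrightarrow>
     P \<in> angles \<and> (\<forall>i\<le>d. sobj P (d - i) \<in> A) \<and> sobj P (d + 1) = c"

definition cluster_tilting ::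
  "('o, 'k, 'm) lin_cat \<Rightarrow> ('o, 'm) endofunctor \<Rightarrow> nat \<Rightarrow> ('o, 'm) sigma_seq set \<Rightarrow> 'o \<Rightarrow> bool" where
  "cluster_tilting C F d angles T \<longleftrightarrow> T \<in> Obj C \<and>
     (\<forall>t\<in>add_closure C T. \<forall>t'\<in>add_closure C T.
        mor C t (fobj F t') = {\<zero>\<^bsub>Hom C t (fobj F t')\<^esub>}) \<and>
     (\<forall>c\<in>Obj C. \<exists>P. resolution d angles (add_closure C T) c P)"

definition factoring :: "('o, 'k, 'm) lin_cat \<Rightarrow> 'o set \<Rightarrow> 'o \<Rightarrow> 'o \<Rightarrow> 'm set" where
  "factoring C A x y =
     {h. \<exists>s\<in>A. \<exists>f\<in>mor C x s. \<exists>g\<in>mor C s y. h = Comp C x s y g f}"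

definition quotient_module :: "('k, 'm) module \<Rightarrow> 'm set \<Rightarrow> ('k, 'm set) module" where
  "quotient_module V N =
     \<lparr>carrier = a_rcosets\<^bsub>V\<^esub> N, monoid.mult = (\<lambda>_ _. N), one = N, ring.zero = N, ring.add = set_add V,
      smult = (\<lambda>a U. \<Union>u\<in>U. N +>\<^bsub>V\<^esub> (a \<odot>\<^bsub>V\<^esub> u))\<rparr>"

definition quotient_category :: "('o, 'k, 'm) lin_cat \<Rightarrow> 'o set \<Rightarrow> ('o, 'k, 'm set) lin_cat" where
  "quotient_category C A =
     \<lparr>Obj = Obj C,
      Hom = (\<lambda>x y. quotient_module (Hom C x y) (factoring C A x y)),
      Comp = (\<lambda>x y z G F. \<Union>g\<in>G. \<Union>f\<in>F. factoring C A x z +>\<^bsub>Hom C x z\<^esub> Comp C x y z g f),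
      Ident = (\<lambda>x. factoring C A x x +>\<^bsub>Hom C x x\<^esub> Ident C x)\<rparr>"

definition nonzero_space :: "('k, 'm) module \<Rightarrow> bool" where
  "nonzero_space V \<longleftrightarrow> carrier V \<noteq> {\<zero>\<^bsub>V\<^esub>}"

definition split_relations :: "('o, 'k, 'm) lin_cat \<Rightarrow> 'o set \<Rightarrow> ('o \<Rightarrow>\<^sub>0 int) set" where
  "split_relations C A =
     {frag_of t - frag_of t' - frag_of t'' | t t' t''.
        t \<in> A \<and> t' \<in> A \<and> t'' \<in> A \<and> is_direct_sum C t' t'' t}"

definition split_K0 :: "('o, 'k, 'm) lin_cat \<Rightarrow> 'o set \<Rightarrow> ('o \<Rightarrow>\<^sub>0 int) set monoid" where
  "split_K0 C A =
     free_Abelian_group A Mod generate (free_Abelian_group A) (split_relations C A)"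

definition K0_class :: "('o, 'k, 'm) lin_cat \<Rightarrow> 'o set \<Rightarrow> 'o \<Rightarrow> ('o \<Rightarrow>\<^sub>0 int) set" where
  "K0_class C A t =
     generate (free_Abelian_group A) (split_relations C A) #>\<^bsub>free_Abelian_group A\<^esub> frag_of t"

text \<open>
  The index \<open>\<Sum>\<^sub>i (-1)\<^sup>i [t\<^sub>i]\<close>, in the multiplicatively written group \<open>split_K0\<close>; the choice of the
  angle is immaterial in the situation of interest.
\<close>

definition index ::
  "('o, 'k, 'm) lin_cat \<Rightarrow> nat \<Rightarrow> ('o, 'm) sigma_seq set \<Rightarrow> 'o set \<Rightarrow> 'o \<Rightarrow> ('o \<Rightarrow>\<^sub>0 int) set" where
  "index C d angles A c =
     (let P = (SOME P. resolution d angles A c P)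
      in finprod (split_K0 C A)
           (\<lambda>i. K0_class C A (sobj P (d - i)) [^]\<^bsub>split_K0 C A\<^esub> ((-1) ^ i :: int)) {..d})"

end

theory Submission
  imports Defs
begin

text \<open>
  Let \<open>t\<^sub>d \<rightarrow> \<dots> \<rightarrow> t\<^sub>0 \<rightarrow> c \<rightarrow> \<Sigma>\<^sup>d t\<^sub>d\<close> be a resolution of \<open>c\<close>. For an object \<open>x\<close> let \<open>a(c,x)\<close> be the
  dimension of the space of morphisms \<open>t\<^sub>0 \<rightarrow> x\<close> that factor through \<open>t\<^sub>0 \<rightarrow> c\<close>, and \<open>b(c,x)\<close> the
  dimension of the cokernel of \<open>Hom(t\<^sub>d\<^sub>-\<^sub>1,x) \<rightarrow> Hom(t\<^sub>d,x)\<close>. Angles are exact, so the alternating sum of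
  the numbers \<open>dim Hom(t\<^sub>i,x)\<close> is \<open>a(c,x) - b(c,x)\<close>; the sign of \<open>b\<close> is where \<open>d\<close> odd enters
  (\<open>presentation_euler\<close>). The alternating sum is the value at the index of \<open>c\<close> of an additive function
  on \<open>K\<^sub>0\<close> (\<open>split_K0_functional\<close>), so \<open>a(c,x) - b(c,x)\<close> depends on the index only.

  A morphism \<open>c \<rightarrow> x\<close> factors through \<open>\<Sigma>\<^sup>d \<T>\<close> precisely when it vanishes on \<open>t\<^sub>0\<close>, hence \<open>a(c,x)\<close> is the
  dimension of \<open>Hom(c,x)\<close> in the quotient category. By Serre duality \<open>b(c,x) = 0\<close> as soon as
  \<open>Hom(x,\<Sigma>\<^sup>d c) = 0\<close> in the quotient category (\<open>serre_vanishing\<close>). For indecomposable \<open>c\<close> and \<open>x\<close> one of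
  the two nonnegative numbers \<open>a\<close> and \<open>b\<close> is therefore zero, and both can be read off from their
  difference. Decomposing \<open>x\<close> extends this to all objects: the functions \<open>a(c,-)\<close> and \<open>b(c,-)\<close> depend
  on the index only.

  It remains to recover \<open>c\<close> from \<open>a(c,-)\<close>, which is a version of the theorem of Auslander and Bongartz
  (\<open>presentations_determine_object\<close>). Suppose \<open>a(c,-) = a(c',-)\<close>. Let \<open>y \<rightarrow> c\<close> be an approximation by sums
  of copies of \<open>c' \<oplus> \<Sigma>\<^sup>d T\<close> and complete it to the left to an angle
  \<open>x\<^sub>0 \<rightarrow> \<dots> \<rightarrow> x\<^sub>d\<^sub>-\<^sub>1 \<rightarrow> y \<rightarrow> c \<rightarrow> \<Sigma>\<^sup>d x\<^sub>0\<close>. The copies of \<open>\<Sigma>\<^sup>d T\<close> in \<open>y\<close> ensure that \<open>x\<^sub>0 \<rightarrow> x\<^sub>1\<close> is injective on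
  morphisms from \<open>\<T>\<close>, and this makes the sequence
  \<open>0 \<rightarrow> Hom(c,x\<^sub>0) \<rightarrow> \<dots> \<rightarrow> Hom(c,y) \<rightarrow> Hom(c,c)\<close> in the quotient category exact, and likewise with \<open>c'\<close>
  in the first argument (\<open>correct_to_kernel\<close>). Hence the rank of its last map is an alternating sum of
  values of \<open>a(c,-)\<close>, and it is the same for \<open>c'\<close>. For \<open>c'\<close> the last map is onto by the choice of \<open>y\<close>, so
  it is onto for \<open>c\<close>: modulo \<open>\<Sigma>\<^sup>d \<T>\<close> the identity of \<open>c\<close> factors through \<open>y\<close>. As the endomorphism ring of
  \<open>c\<close> is local and \<open>t\<^sub>0 \<rightarrow> c\<close> is nonzero, \<open>c\<close> is a direct summand of \<open>c'\<close>, and so isomorphic to it.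

  If \<open>t\<^sub>0 \<rightarrow> c\<close> is zero, then \<open>a(c,-) = 0\<close>, and \<open>c = \<Sigma>\<^sup>d t\<close> for a direct summand \<open>t\<close> of \<open>t\<^sub>d\<close>. In this case
  \<open>b(c,-)\<close> is \<open>dim Hom(t,-)\<close> (\<open>shifted_summand\<close>), and the argument above applies to \<open>t\<close> with the resolution
  \<open>0 \<rightarrow> \<dots> \<rightarrow> 0 \<rightarrow> t \<rightarrow> t\<close>. As \<open>\<Sigma>\<^sup>d\<close> is an additive, perhaps not a linear functor, dimensions of Hom spaces
  cannot be compared along it; this is why \<open>t\<close> and not \<open>\<Sigma>\<^sup>d t\<close> is used.
\<close>

section \<open>Dimensions of subspaces\<close>

definition sdim :: "('k, 'r) ring_scheme \<Rightarrow> ('k, 'm, 'n) module_scheme \<Rightarrow> 'm set \<Rightarrow> nat" where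
  "sdim K V W = vectorspace.dim K (V\<lparr>carrier := W\<rparr>)"

context vectorspace
begin

lemma submodule_vectorspace:
  assumes "submodule K W V" shows "vectorspace K (V\<lparr>carrier := W\<rparr>)"
  by (rule subspace_is_vs) (simp add: VectorSpace.subspace_def vectorspace_axioms assms)

lemma submodule_lin_dep:
  assumes "submodule K W V" "S \<subseteq> W"
  shows "LinearCombinations.module.lin_dep K (V\<lparr>carrier := W\<rparr>) S = lin_dep S"
    and "LinearCombinations.module.span K (V\<lparr>carrier := W\<rparr>) S = span S"
  using span_li_not_depend[OF assms(2,1)] by simp_all

lemma submodule_fin_dim:
  assumes "fin_dim" "submodule K W V" shows "vectorspace.fin_dim K (V\<lparr>carrier := W\<rparr>)"
proof -
  interpret W: vectorspace K "V\<lparr>carrier := W\<rparr>" by (rule submodule_vectorspace[OF assms(2)])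
  have sub: "W \<subseteq> carrier V" using assms(2) by (simp add: submodule_def)
  have "\<exists>A. finite A \<and> maximal A (\<lambda>S. S \<subseteq> carrier (V\<lparr>carrier := W\<rparr>) \<and> W.lin_indpt S)"
  proof (rule maximal_exists)
    fix A assume "A \<subseteq> carrier (V\<lparr>carrier := W\<rparr>) \<and> W.lin_indpt A"
    then have "A \<subseteq> carrier V" "lin_indpt A" using submodule_lin_dep[OF assms(2)] sub by auto
    then show "finite A \<and> card A \<le> dim" using li_le_dim assms(1) by blast
  next
    show "{} \<subseteq> carrier (V\<lparr>carrier := W\<rparr>) \<and> W.lin_indpt {}"
      by (simp add: W.lin_dep_def)
  qed
  then obtain A where A: "finite A" "maximal A (\<lambda>S. S \<subseteq> carrier (V\<lparr>carrier := W\<rparr>) \<and> W.lin_indpt S)"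
    by (elim exE conjE)
  from W.max_li_is_basis[OF A(2)] have "W.lin_indpt A \<and> W.gen_set A \<and> A \<subseteq> carrier (V\<lparr>carrier := W\<rparr>)"
    unfolding W.basis_def .
  then show ?thesis unfolding W.fin_dim_def using A(1) by (intro exI[of _ A]) simp
qed

lemma basis_of_submodule:
  assumes "fin_dim" "submodule K W V"
  obtains A where "finite A" "A \<subseteq> W" "lin_indpt A" "span A = W" "card A = sdim K V W"
proof -
  interpret W: vectorspace K "V\<lparr>carrier := W\<rparr>" by (rule submodule_vectorspace[OF assms(2)])
  obtain A where A: "finite A" "W.basis A" using W.finite_basis_exists[OF submodule_fin_dim[OF assms]] by blast
  then have "card A = sdim K V W" unfolding sdim_def using W.dim_basis by auto
  moreover have "A \<subseteq> W" using A W.basis_def by auto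
  ultimately show ?thesis using that A submodule_lin_dep[OF assms(2)] unfolding W.basis_def by auto
qed

lemma sdim_mono:
  assumes "fin_dim" "submodule K W V" "submodule K W' V" "W \<subseteq> W'"
  shows "sdim K V W \<le> sdim K V W'"
proof -
  interpret W': vectorspace K "V\<lparr>carrier := W'\<rparr>" by (rule submodule_vectorspace[OF assms(3)])
  obtain A where A: "finite A" "A \<subseteq> W" "lin_indpt A" "span A = W" "card A = sdim K V W"
    using basis_of_submodule assms by blast
  have "W'.lin_indpt A" using A assms submodule_lin_dep[OF assms(3), of A] by blast
  then show ?thesis
    using W'.li_le_dim(2)[OF submodule_fin_dim[OF assms(1,3)], of A] A assms(4)
    unfolding sdim_def by auto
qed

lemma sdim_eq_imp_eq:
  assumes "fin_dim" "submodule K W V" "submodule K W' V" "W \<subseteq> W'" "sdim K V W' \<le> sdim K V W"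
  shows "W = W'"
proof -
  interpret W': vectorspace K "V\<lparr>carrier := W'\<rparr>" by (rule submodule_vectorspace[OF assms(3)])
  obtain A where A: "finite A" "A \<subseteq> W" "lin_indpt A" "span A = W" "card A = sdim K V W"
    using basis_of_submodule assms by blast
  have AW: "A \<subseteq> W'" using A assms by blast
  then have "W'.lin_indpt A" using A assms submodule_lin_dep[OF assms(3), of A] by blast
  then have "W'.basis A"
    using W'.dim_li_is_basis[OF submodule_fin_dim[OF assms(1,3)], of A] A AW assms(5)
    unfolding sdim_def by auto
  then have "W'.span A = W'" unfolding W'.basis_def by simp
  then show ?thesis using submodule_lin_dep(2)[OF assms(3) AW] A(4) by simp
qed

lemma submodule_zero: "submodule K {\<zero>\<^bsub>V\<^esub>} V"
  by (simp add: submodule_def module_axioms)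

lemma sdim_zero: "sdim K V {\<zero>\<^bsub>V\<^esub>} = 0"
proof -
  interpret W: vectorspace K "V\<lparr>carrier := {\<zero>\<^bsub>V\<^esub>}\<rparr>"
    by (rule submodule_vectorspace[OF submodule_zero])
  have "W.basis {}"
    by (simp add: W.basis_def W.lin_dep_def W.span_empty)
  then show ?thesis
    using W.dim_basis[of "{}"] by (simp add: sdim_def)
qed

lemma submodule_carrier: "submodule K (carrier V) V"
  by (simp add: submodule_def module_axioms)

lemma sdim_zero_imp:
  assumes "fin_dim" "submodule K W V" "sdim K V W = 0"
  shows "W = {\<zero>\<^bsub>V\<^esub>}"
  using sdim_eq_imp_eq[OF assms(1) submodule_zero assms(2)] assms submodule.zero_closed[OF assms(2)]
  by auto

lemma rank_nullity_sub:
  assumes fd: "fin_dim" and V': "vectorspace K V'" and t: "t \<in> LinearCombinations.module_hom K V V'"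
    and W: "submodule K W V"
  shows "submodule K (t ` W) V'" "submodule K {w \<in> W. t w = \<zero>\<^bsub>V'\<^esub>} V"
    "sdim K V W = sdim K V' (t ` W) + sdim K V {w \<in> W. t w = \<zero>\<^bsub>V'\<^esub>}"
proof -
  interpret V': vectorspace K V' by (rule V')
  interpret W: vectorspace K "V\<lparr>carrier := W\<rparr>" by (rule submodule_vectorspace[OF W])
  have sub: "W \<subseteq> carrier V" using W by (simp add: submodule_def)
  have tW: "t \<in> LinearCombinations.module_hom K (V\<lparr>carrier := W\<rparr>) V'"
    using t subsetD[OF sub] unfolding LinearCombinations.module_hom_def by (simp add: Pi_iff)
  interpret t: linear_map K "V\<lparr>carrier := W\<rparr>" V' t
    by (intro linear_map.intro mod_hom.intro mod_hom_axioms.intro W.vectorspace_axioms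
        V'.vectorspace_axioms W.module_axioms V'.module_axioms tW)
  have im: "t.im = t ` W" by (simp add: t.im_def)
  have ker: "t.ker = {w \<in> W. t w = \<zero>\<^bsub>V'\<^esub>}" by (simp add: t.ker_def)
  show "submodule K (t ` W) V'" using t.im_is_submodule im by simp
  have k: "submodule K t.ker (V\<lparr>carrier := W\<rparr>)" by (rule t.ker_is_submodule)
  show "submodule K {w \<in> W. t w = \<zero>\<^bsub>V'\<^esub>} V"
  proof (rule submodule.intro)
    show "Module.module K V" by (rule module_axioms)
    show "{w \<in> W. t w = \<zero>\<^bsub>V'\<^esub>} \<subseteq> carrier V" using sub by blast
  qed (use submodule.m_closed[OF k] submodule.zero_closed[OF k] submodule.smult_closed[OF k] in
      \<open>simp_all add: ker\<close>)
  have "W.fin_dim" by (rule submodule_fin_dim[OF fd W])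
  from t.rank_nullity[OF this]
  show "sdim K V W = sdim K V' (t ` W) + sdim K V {w \<in> W. t w = \<zero>\<^bsub>V'\<^esub>}"
    by (simp add: sdim_def im ker)
qed

end

text \<open>Extend \<open>f\<close> to a basis and take the coordinate at \<open>f\<close>.\<close>

lemma separating_form:
  fixes V :: "('k, 'm) module"
  assumes V: "vectorspace K V" and "vectorspace.fin_dim K V" "f \<in> carrier V" "f \<noteq> \<zero>\<^bsub>V\<^esub>"
  shows "\<exists>\<phi> \<in> carrier (dual_space K V). \<phi> f \<noteq> \<zero>\<^bsub>K\<^esub>"
proof -
  interpret vectorspace K V by (rule V)
  note assms = assms(2-)
  have li: "lin_indpt {f}"
  proof -
    have "lin_indpt {}" by (simp add: lin_dep_def)
    then show ?thesis using lin_dep_iff_in_span[of "{}" f] span_empty assms by simp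
  qed
  have "\<exists>A. finite A \<and> maximal A (\<lambda>S. (S \<subseteq> carrier V \<and> lin_indpt S) \<and> f \<in> S)"
  proof (rule maximal_exists[where B = "{f}" and N = dim])
    show "finite A \<and> card A \<le> dim" if "(A \<subseteq> carrier V \<and> lin_indpt A) \<and> f \<in> A" for A
      using that li_le_dim[OF assms(1), of A] by simp
  qed (simp add: li assms)
  then obtain A where "finite A" and mx: "maximal A (\<lambda>S. (S \<subseteq> carrier V \<and> lin_indpt S) \<and> f \<in> S)"
    by (elim exE conjE)
  moreover have "f \<in> A" using mx by (simp add: maximal_def)
  moreover have "maximal A (\<lambda>S. S \<subseteq> carrier V \<and> lin_indpt S)"
    using mx unfolding maximal_def by (metis subsetD)
  ultimately have A: "finite A" "f \<in> A" "maximal A (\<lambda>S. S \<subseteq> carrier V \<and> lin_indpt S)" by blast+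
  have bas: "basis A" by (rule max_li_is_basis[OF A(3)])
  have Asub: "A \<subseteq> carrier V" using bas by (simp add: basis_def)
  define co where "co v = (THE a. a \<in> A \<rightarrow>\<^sub>E carrier K \<and> lincomb a A = v)" for v
  have crit: "\<forall>v. v \<in> carrier V \<longrightarrow> (\<exists>!a. a \<in> A \<rightarrow>\<^sub>E carrier K \<and> lincomb a A = v)"
    by (rule iffD1[OF basis_criterion[OF A(1) Asub] bas])
  have co: "co v \<in> A \<rightarrow>\<^sub>E carrier K" "lincomb (co v) A = v" if "v \<in> carrier V" for v
    using theI'[OF crit[rule_format, OF that]] unfolding co_def by auto
  have co_eq: "co v = a" if "v \<in> carrier V" "a \<in> A \<rightarrow>\<^sub>E carrier K" "lincomb a A = v" for a v
    unfolding co_def by (rule the1_equality[OF crit[rule_format, OF that(1)]]) (simp add: that)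
  have cl: "co v f \<in> carrier K" if "v \<in> carrier V" for v using co(1)[OF that] A(2) by auto
  have add: "co (v \<oplus>\<^bsub>V\<^esub> w) f = co v f \<oplus>\<^bsub>K\<^esub> co w f" if vw: "v \<in> carrier V" "w \<in> carrier V" for v w
  proof -
    let ?a = "restrict (\<lambda>x. co v x \<oplus>\<^bsub>K\<^esub> co w x) A"
    have m: "co v \<in> A \<rightarrow> carrier K" "co w \<in> A \<rightarrow> carrier K" using co(1) vw by auto
    have "lincomb ?a A = lincomb (\<lambda>x. co v x \<oplus>\<^bsub>K\<^esub> co w x) A"
      by (rule lincomb_cong) (use Asub m in auto)
    also have "\<dots> = v \<oplus>\<^bsub>V\<^esub> w" using lincomb_sum[OF A(1) Asub m] co(2) vw by simp
    finally have "co (v \<oplus>\<^bsub>V\<^esub> w) = ?a" using vw m by (intro co_eq) auto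
    then show ?thesis using A(2) by simp
  qed
  have smult: "co (r \<odot>\<^bsub>V\<^esub> v) f = r \<otimes>\<^bsub>K\<^esub> co v f" if vw: "v \<in> carrier V" "r \<in> carrier K" for v r
  proof -
    let ?a = "restrict (\<lambda>x. r \<otimes>\<^bsub>K\<^esub> co v x) A"
    have m: "co v \<in> A \<rightarrow> carrier K" using co(1) vw by auto
    have "lincomb ?a A = lincomb (\<lambda>x. r \<otimes>\<^bsub>K\<^esub> co v x) A"
      by (rule lincomb_cong) (use Asub m vw in auto)
    also have "\<dots> = r \<odot>\<^bsub>V\<^esub> v" using lincomb_smult[OF Asub m vw(2)] co(2) vw by simp
    finally have "co (r \<odot>\<^bsub>V\<^esub> v) = ?a" using vw m by (intro co_eq) auto
    then show ?thesis using A(2) by simp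
  qed
  have cof: "co f f = \<one>\<^bsub>K\<^esub>"
  proof -
    define a where "a = restrict (\<lambda>x. if x = f then \<one>\<^bsub>K\<^esub> else \<zero>\<^bsub>K\<^esub>) A"
    have af: "a f = \<one>\<^bsub>K\<^esub>" and aP: "a \<in> A \<rightarrow>\<^sub>E carrier K" using A(2) by (auto simp: a_def)
    have "lincomb a A = a f \<odot>\<^bsub>V\<^esub> f \<oplus>\<^bsub>V\<^esub> lincomb a (A - {f})"
      by (rule lincomb_del2) (use A Asub aP in auto)
    also have "lincomb a (A - {f}) = \<zero>\<^bsub>V\<^esub>"
      unfolding lincomb_def by (rule M.finsum_all0) (use Asub in \<open>auto simp: a_def\<close>)
    finally have "lincomb a A = f" using af assms by simp
    then have "co f = a" using assms aP by (intro co_eq) auto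
    then show ?thesis using af by simp
  qed
  let ?\<phi> = "restrict (\<lambda>v. co v f) (carrier V)"
  have "?\<phi> \<in> carrier (dual_space K V)"
    unfolding dual_space_def LinearCombinations.module_hom_def ring_as_module_def
    using cl add smult by auto
  moreover have "?\<phi> f \<noteq> \<zero>\<^bsub>K\<^esub>" using cof assms by simp
  ultimately show ?thesis by blast
qed

section \<open>Arithmetic in linear categories\<close>

context linear_category
begin

lemma Hom_abelian_group: "\<lbrakk>x \<in> Obj C; y \<in> Obj C\<rbrakk> \<Longrightarrow> abelian_group (Hom C x y)"
  using Hom_vectorspace[of x y] unfolding vectorspace_def Module.module_def by blast

lemma Hom_module: "\<lbrakk>x \<in> Obj C; y \<in> Obj C\<rbrakk> \<Longrightarrow> Module.module K (Hom C x y)"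
  using Hom_vectorspace[of x y] unfolding vectorspace_def by blast

context
  fixes x y assumes xy: "x \<in> Obj C" "y \<in> Obj C"
begin

interpretation H: abelian_group "Hom C x y" by (rule Hom_abelian_group[OF xy])

lemma mor_zero: "\<zero>\<^bsub>Hom C x y\<^esub> \<in> mor C x y" by simp
lemma mor_add: "\<lbrakk>f \<in> mor C x y; g \<in> mor C x y\<rbrakk> \<Longrightarrow> f \<oplus>\<^bsub>Hom C x y\<^esub> g \<in> mor C x y" by simp
lemma mor_minus: "\<lbrakk>f \<in> mor C x y; g \<in> mor C x y\<rbrakk> \<Longrightarrow> f \<ominus>\<^bsub>Hom C x y\<^esub> g \<in> mor C x y" by simp
lemma mor_neg: "f \<in> mor C x y \<Longrightarrow> \<ominus>\<^bsub>Hom C x y\<^esub> f \<in> mor C x y" by simp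
lemma mor_r_zero: "f \<in> mor C x y \<Longrightarrow> f \<oplus>\<^bsub>Hom C x y\<^esub> \<zero>\<^bsub>Hom C x y\<^esub> = f" by simp
lemma mor_l_zero: "f \<in> mor C x y \<Longrightarrow> \<zero>\<^bsub>Hom C x y\<^esub> \<oplus>\<^bsub>Hom C x y\<^esub> f = f" by simp
lemma mor_add_comm:
  "\<lbrakk>f \<in> mor C x y; g \<in> mor C x y\<rbrakk> \<Longrightarrow> f \<oplus>\<^bsub>Hom C x y\<^esub> g = g \<oplus>\<^bsub>Hom C x y\<^esub> f"
  by (rule H.a_comm)
lemma mor_add_assoc:
  "\<lbrakk>f \<in> mor C x y; g \<in> mor C x y; h \<in> mor C x y\<rbrakk> \<Longrightarrow>
    (f \<oplus>\<^bsub>Hom C x y\<^esub> g) \<oplus>\<^bsub>Hom C x y\<^esub> h = f \<oplus>\<^bsub>Hom C x y\<^esub> (g \<oplus>\<^bsub>Hom C x y\<^esub> h)"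
  by (rule H.a_assoc)
lemma mor_minus_self: "f \<in> mor C x y \<Longrightarrow> f \<ominus>\<^bsub>Hom C x y\<^esub> f = \<zero>\<^bsub>Hom C x y\<^esub>"
  by (simp add: a_minus_def H.r_neg)
lemma mor_minus_zero: "f \<in> mor C x y \<Longrightarrow> f \<ominus>\<^bsub>Hom C x y\<^esub> \<zero>\<^bsub>Hom C x y\<^esub> = f"
  by (simp add: a_minus_def)
lemma mor_minus_eq_zero:
  "\<lbrakk>f \<in> mor C x y; g \<in> mor C x y\<rbrakk> \<Longrightarrow> f \<ominus>\<^bsub>Hom C x y\<^esub> g = \<zero>\<^bsub>Hom C x y\<^esub> \<longleftrightarrow> f = g"
  by (metis H.add.inv_closed H.minus_eq H.r_neg H.minus_equality H.minus_minus H.a_comm)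
lemma mor_minus_add:
  "\<lbrakk>f \<in> mor C x y; g \<in> mor C x y\<rbrakk> \<Longrightarrow> (f \<ominus>\<^bsub>Hom C x y\<^esub> g) \<oplus>\<^bsub>Hom C x y\<^esub> g = f"
  by (simp add: a_minus_def H.a_assoc H.l_neg)
lemma mor_neg_neg: "f \<in> mor C x y \<Longrightarrow> \<ominus>\<^bsub>Hom C x y\<^esub> (\<ominus>\<^bsub>Hom C x y\<^esub> f) = f" by simp
lemma mor_neg_zero: "\<ominus>\<^bsub>Hom C x y\<^esub> \<zero>\<^bsub>Hom C x y\<^esub> = \<zero>\<^bsub>Hom C x y\<^esub>" by simp
lemma mor_r_neg: "f \<in> mor C x y \<Longrightarrow> f \<oplus>\<^bsub>Hom C x y\<^esub> (\<ominus>\<^bsub>Hom C x y\<^esub> f) = \<zero>\<^bsub>Hom C x y\<^esub>"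
  by (rule H.r_neg)

end

context
  fixes x y z assumes xyz: "x \<in> Obj C" "y \<in> Obj C" "z \<in> Obj C"
begin

lemma Comp_mod_hom_left:
  "f \<in> mor C x y \<Longrightarrow> mod_hom K (Hom C y z) (Hom C x z) (\<lambda>g. Comp C x y z g f)"
  by (simp add: mod_hom_def mod_hom_axioms_def Hom_module xyz Comp_linear_left)

lemma Comp_mod_hom_right:
  "g \<in> mor C y z \<Longrightarrow> mod_hom K (Hom C x y) (Hom C x z) (\<lambda>f. Comp C x y z g f)"
  by (simp add: mod_hom_def mod_hom_axioms_def Hom_module xyz Comp_linear_right)

lemma Comp_add_left:
  "\<lbrakk>f \<in> mor C x y; g \<in> mor C y z; g' \<in> mor C y z\<rbrakk> \<Longrightarrow>
    Comp C x y z (g \<oplus>\<^bsub>Hom C y z\<^esub> g') f = Comp C x y z g f \<oplus>\<^bsub>Hom C x z\<^esub> Comp C x y z g' f"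
  by (rule LinearCombinations.module_hom_add[OF Comp_linear_left]) (use xyz in auto)

lemma Comp_add_right:
  "\<lbrakk>f \<in> mor C x y; f' \<in> mor C x y; g \<in> mor C y z\<rbrakk> \<Longrightarrow>
    Comp C x y z g (f \<oplus>\<^bsub>Hom C x y\<^esub> f') = Comp C x y z g f \<oplus>\<^bsub>Hom C x z\<^esub> Comp C x y z g f'"
  by (rule LinearCombinations.module_hom_add[OF Comp_linear_right]) (use xyz in auto)

lemma Comp_neg_left:
  "\<lbrakk>f \<in> mor C x y; g \<in> mor C y z\<rbrakk> \<Longrightarrow>
    Comp C x y z (\<ominus>\<^bsub>Hom C y z\<^esub> g) f = \<ominus>\<^bsub>Hom C x z\<^esub> Comp C x y z g f"
  using mod_hom.f_neg[OF Comp_mod_hom_left] by simp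

lemma Comp_neg_right:
  "\<lbrakk>f \<in> mor C x y; g \<in> mor C y z\<rbrakk> \<Longrightarrow>
    Comp C x y z g (\<ominus>\<^bsub>Hom C x y\<^esub> f) = \<ominus>\<^bsub>Hom C x z\<^esub> Comp C x y z g f"
  using mod_hom.f_neg[OF Comp_mod_hom_right] by simp

lemma Comp_minus_left:
  "\<lbrakk>f \<in> mor C x y; g \<in> mor C y z; g' \<in> mor C y z\<rbrakk> \<Longrightarrow>
    Comp C x y z (g \<ominus>\<^bsub>Hom C y z\<^esub> g') f = Comp C x y z g f \<ominus>\<^bsub>Hom C x z\<^esub> Comp C x y z g' f"
  using mod_hom.f_minus[OF Comp_mod_hom_left] by simp

lemma Comp_minus_right:
  "\<lbrakk>f \<in> mor C x y; f' \<in> mor C x y; g \<in> mor C y z\<rbrakk> \<Longrightarrow>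
    Comp C x y z g (f \<ominus>\<^bsub>Hom C x y\<^esub> f') = Comp C x y z g f \<ominus>\<^bsub>Hom C x z\<^esub> Comp C x y z g f'"
  using mod_hom.f_minus[OF Comp_mod_hom_right] by simp

lemma Comp_zero_left: "f \<in> mor C x y \<Longrightarrow> Comp C x y z \<zero>\<^bsub>Hom C y z\<^esub> f = \<zero>\<^bsub>Hom C x z\<^esub>"
  using mod_hom.f0_is_0[OF Comp_mod_hom_left] by simp

lemma Comp_zero_right: "g \<in> mor C y z \<Longrightarrow> Comp C x y z g \<zero>\<^bsub>Hom C x y\<^esub> = \<zero>\<^bsub>Hom C x z\<^esub>"
  using mod_hom.f0_is_0[OF Comp_mod_hom_right] by simp

end

lemmas cat_simps =
  mor_zero mor_add mor_minus mor_neg mor_r_zero mor_l_zero mor_minus_self mor_minus_zero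
  mor_neg_neg mor_neg_zero Comp_closed Ident_closed Ident_left Ident_right
  Comp_add_left Comp_add_right Comp_neg_left Comp_neg_right Comp_minus_left Comp_minus_right
  Comp_zero_left Comp_zero_right

declare cat_simps [simp]

section \<open>Zero objects and direct sums\<close>

lemma inverse_morI:
  "\<lbrakk>f \<in> mor C x y; g \<in> mor C y x; Comp C x y x g f = Ident C x; Comp C y x y f g = Ident C y\<rbrakk>
    \<Longrightarrow> inverse_mor C x y f g"
  by (simp add: inverse_mor_def)

lemma zero_objectI:
  assumes "z \<in> Obj C" "Ident C z = \<zero>\<^bsub>Hom C z z\<^esub>"
  shows "zero_object C z"
  unfolding zero_object_def
proof (intro conjI ballI)
  fix x assume x: "x \<in> Obj C"
  have "f = \<zero>\<^bsub>Hom C z x\<^esub>" if "f \<in> mor C z x" for f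
    using Ident_right[of z x f] that assms x by simp
  then show "mor C z x = {\<zero>\<^bsub>Hom C z x\<^esub>}" using x assms by auto
  have "f = \<zero>\<^bsub>Hom C x z\<^esub>" if "f \<in> mor C x z" for f
    using Ident_left[of x z f] that assms x by simp
  then show "mor C x z = {\<zero>\<^bsub>Hom C x z\<^esub>}" using x assms by auto
qed (fact assms)

lemma zero_object_iff: "zero_object C z \<longleftrightarrow> z \<in> Obj C \<and> Ident C z = \<zero>\<^bsub>Hom C z z\<^esub>"
  using zero_objectI Ident_closed unfolding zero_object_def by fast

lemma zero_object_from: "\<lbrakk>zero_object C z; x \<in> Obj C; f \<in> mor C z x\<rbrakk> \<Longrightarrow> f = \<zero>\<^bsub>Hom C z x\<^esub>"
  and zero_object_to: "\<lbrakk>zero_object C z; x \<in> Obj C; g \<in> mor C x z\<rbrakk> \<Longrightarrow> g = \<zero>\<^bsub>Hom C x z\<^esub>"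
  unfolding zero_object_def by blast+

lemma biproductD:
  assumes "biproduct C x y z i1 i2 p1 p2"
  shows "x \<in> Obj C" "y \<in> Obj C" "z \<in> Obj C"
    "i1 \<in> mor C x z" "i2 \<in> mor C y z" "p1 \<in> mor C z x" "p2 \<in> mor C z y"
    "Comp C x z x p1 i1 = Ident C x" "Comp C y z y p2 i2 = Ident C y"
    "Comp C y z x p1 i2 = \<zero>\<^bsub>Hom C y x\<^esub>" "Comp C x z y p2 i1 = \<zero>\<^bsub>Hom C x y\<^esub>"
    "Comp C z x z i1 p1 \<oplus>\<^bsub>Hom C z z\<^esub> Comp C z y z i2 p2 = Ident C z"
  using assms unfolding biproduct_def by auto

lemma biproduct_split_to:
  assumes b: "biproduct C x y z i1 i2 p1 p2" and w: "w \<in> Obj C" "f \<in> mor C w z"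
  shows "f = Comp C w x z i1 (Comp C w z x p1 f) \<oplus>\<^bsub>Hom C w z\<^esub> Comp C w y z i2 (Comp C w z y p2 f)"
proof -
  note [simp] = biproductD(1-7)[OF b] w
  have "f = Comp C w z z (Comp C z x z i1 p1 \<oplus>\<^bsub>Hom C z z\<^esub> Comp C z y z i2 p2) f"
    by (simp only: biproductD(12)[OF b]) simp
  then show ?thesis by (simp add: Comp_assoc)
qed

lemma biproduct_split_from:
  assumes b: "biproduct C x y z i1 i2 p1 p2" and w: "w \<in> Obj C" "f \<in> mor C z w"
  shows "f = Comp C z x w (Comp C x z w f i1) p1 \<oplus>\<^bsub>Hom C z w\<^esub> Comp C z y w (Comp C y z w f i2) p2"
proof -
  note [simp] = biproductD(1-7)[OF b] w
  have "f = Comp C z z w f (Comp C z x z i1 p1 \<oplus>\<^bsub>Hom C z z\<^esub> Comp C z y z i2 p2)"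
    by (simp only: biproductD(12)[OF b]) simp
  then show ?thesis by (simp add: Comp_assoc)
qed

end

section \<open>Objects built from a given object\<close>

text \<open>The smallest ideal containing the identity of \<open>T\<close>: finite sums of morphisms that factor through
  \<open>T\<close>. These sums stand for morphisms that factor through some \<open>T\<^sup>n\<close>, without the matrices.\<close>

inductive_set thru :: "('o, 'k, 'm) lin_cat \<Rightarrow> 'o \<Rightarrow> 'o \<Rightarrow> 'o \<Rightarrow> 'm set" for C T x y where
  zero: "\<zero>\<^bsub>Hom C x y\<^esub> \<in> thru C T x y"
| add: "\<lbrakk>h \<in> thru C T x y; f \<in> mor C x T; g \<in> mor C T y\<rbrakk>
    \<Longrightarrow> h \<oplus>\<^bsub>Hom C x y\<^esub> Comp C x T y g f \<in> thru C T x y"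

text \<open>The direct summands of finite sums of copies of \<open>T\<close>, recognised by their identity.\<close>

definition built_from :: "('o, 'k, 'm) lin_cat \<Rightarrow> 'o \<Rightarrow> 'o \<Rightarrow> bool" where
  "built_from C T e \<longleftrightarrow> e \<in> Obj C \<and> Ident C e \<in> thru C T e e"

context linear_category
begin

context
  fixes T assumes T: "T \<in> Obj C"
begin

lemma thru_closed:
  assumes "x \<in> Obj C" "y \<in> Obj C" "h \<in> thru C T x y" shows "h \<in> mor C x y"
  using assms(3) by induction (use assms T in auto)

lemma thru_single:
  assumes "x \<in> Obj C" "y \<in> Obj C" "f \<in> mor C x T" "g \<in> mor C T y"
  shows "Comp C x T y g f \<in> thru C T x y"
  using thru.add[OF thru.zero assms(3,4)] assms T by simp

lemma thru_add:
  assumes "x \<in> Obj C" "y \<in> Obj C" "h \<in> thru C T x y" "h' \<in> thru C T x y"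
  shows "h \<oplus>\<^bsub>Hom C x y\<^esub> h' \<in> thru C T x y"
  using assms(4)
proof induction
  case zero
  then show ?case using assms thru_closed by simp
next
  case (add h'' f g)
  have "(h \<oplus>\<^bsub>Hom C x y\<^esub> h'') \<oplus>\<^bsub>Hom C x y\<^esub> Comp C x T y g f \<in> thru C T x y"
    using add by (intro thru.add)
  then show ?case using add assms T thru_closed[OF assms(1,2)] by (simp add: mor_add_assoc)
qed

lemma thru_Comp_left:
  assumes "x \<in> Obj C" "y \<in> Obj C" "z \<in> Obj C" "h \<in> thru C T x y" "g \<in> mor C y z"
  shows "Comp C x y z g h \<in> thru C T x z"
  using assms(4)
proof induction
  case zero
  then show ?case using assms thru.zero by simp
next
  case (add h' f k)
  have "Comp C x y z g h' \<oplus>\<^bsub>Hom C x z\<^esub> Comp C x T z (Comp C T y z g k) f \<in> thru C T x z"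
    using add assms T by (intro thru.add) auto
  then show ?case using add assms T thru_closed[OF assms(1,2)] by (simp add: Comp_assoc)
qed

lemma thru_Comp_right:
  assumes "x \<in> Obj C" "y \<in> Obj C" "z \<in> Obj C" "h \<in> thru C T y z" "g \<in> mor C x y"
  shows "Comp C x y z h g \<in> thru C T x z"
  using assms(4)
proof induction
  case zero
  then show ?case using assms thru.zero by simp
next
  case (add h' f k)
  have "Comp C x y z h' g \<oplus>\<^bsub>Hom C x z\<^esub> Comp C x T z k (Comp C x y T f g) \<in> thru C T x z"
    using add assms T by (intro thru.add) auto
  then show ?case using add assms T thru_closed[OF assms(2,3)] by (simp add: Comp_assoc)
qed

lemma killed_on_thru:
  assumes "x \<in> Obj C" "y \<in> Obj C" "z \<in> Obj C" "f \<in> mor C y z"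
    and "\<And>k. k \<in> mor C T y \<Longrightarrow> Comp C T y z f k = \<zero>\<^bsub>Hom C T z\<^esub>"
    and "h \<in> thru C T x y"
  shows "Comp C x y z f h = \<zero>\<^bsub>Hom C x z\<^esub>"
  using assms(6)
proof induction
  case zero
  then show ?case using assms by simp
next
  case (add h' k g)
  have "Comp C x y z f (Comp C x T y g k) = \<zero>\<^bsub>Hom C x z\<^esub>"
    using Comp_assoc[of x T y z f g k, symmetric] assms(1-5) add T by simp
  then show ?case using add assms T thru_closed[OF assms(1,2)] by simp
qed

lemma thru_no_maps_to:
  assumes "x \<in> Obj C" "y \<in> Obj C" "mor C T y = {\<zero>\<^bsub>Hom C T y\<^esub>}" "h \<in> thru C T x y"
  shows "h = \<zero>\<^bsub>Hom C x y\<^esub>"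
  using assms(4)
  by induction (use assms T in auto)

lemma built_from_Obj: "built_from C T e \<Longrightarrow> e \<in> Obj C"
  by (simp add: built_from_def)

lemma built_from_thru_left:
  assumes "built_from C T e" "y \<in> Obj C" "f \<in> mor C e y" shows "f \<in> thru C T e y"
  using thru_Comp_left[of e e y "Ident C e" f] assms by (simp add: built_from_def)

lemma built_from_thru_right:
  assumes "built_from C T e" "y \<in> Obj C" "f \<in> mor C y e" shows "f \<in> thru C T y e"
  using thru_Comp_right[of y e e "Ident C e" f] assms by (simp add: built_from_def)

lemma built_from_self: "built_from C T T"
  using thru_single[of T T "Ident C T" "Ident C T"] T by (simp add: built_from_def)

lemma built_from_zero_object: "zero_object C z \<Longrightarrow> built_from C T z"
  using thru.zero[of C z z T] by (simp add: built_from_def zero_object_iff)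

lemma built_from_retract:
  assumes "built_from C T e" "x \<in> Obj C" "s \<in> mor C x e" "r \<in> mor C e x"
    "Comp C x e x r s = Ident C x"
  shows "built_from C T x"
proof -
  have "Comp C x e x r s \<in> thru C T x x"
    using assms built_from_Obj by (intro thru_Comp_left[of x e x] built_from_thru_right) auto
  then show ?thesis using assms by (simp add: built_from_def)
qed

lemma built_from_biproduct:
  assumes "built_from C T x" "built_from C T y" "biproduct C x y z i1 i2 p1 p2"
  shows "built_from C T z"
proof -
  note b = biproductD[OF assms(3)]
  have "Comp C z x z i1 p1 \<oplus>\<^bsub>Hom C z z\<^esub> Comp C z y z i2 p2 \<in> thru C T z z"
    using assms b
    by (intro thru_add thru_Comp_left[of z x z] thru_Comp_left[of z y z] built_from_thru_right) auto
  then show ?thesis using b by (simp add: built_from_def)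
qed

lemma copies_built_from:
  assumes "y \<in> copies C T" shows "built_from C T y"
  using assms
proof induction
  case (zero z)
  then show ?case by (rule built_from_zero_object)
next
  case (step s s')
  then show ?case using built_from_self built_from_biproduct unfolding is_direct_sum_def by blast
qed

lemma add_closure_built_from:
  assumes "t \<in> add_closure C T" shows "built_from C T t"
proof -
  obtain u s i1 i2 p1 p2 where s: "s \<in> copies C T" "biproduct C t u s i1 i2 p1 p2"
    using assms unfolding add_closure_def is_direct_sum_def by blast
  show ?thesis
    using built_from_retract[OF copies_built_from[OF s(1)], of t i1 p1] biproductD[OF s(2)] by simp
qed

end

lemma biproduct_zero_right:
  assumes "x \<in> Obj C" "zero_object C z"
  shows "biproduct C x z x (Ident C x) \<zero>\<^bsub>Hom C z x\<^esub> (Ident C x) \<zero>\<^bsub>Hom C x z\<^esub>"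
  using assms by (simp add: biproduct_def zero_object_iff)

section \<open>Endomorphism rings\<close>

definition End :: "'o \<Rightarrow> 'm ring" where
  "End x = \<lparr>carrier = mor C x x, monoid.mult = Comp C x x x, one = Ident C x,
     ring.zero = \<zero>\<^bsub>Hom C x x\<^esub>, ring.add = ring.add (Hom C x x)\<rparr>"

lemma End_simps [simp]:
  "carrier (End x) = mor C x x" "monoid.mult (End x) = Comp C x x x" "one (End x) = Ident C x"
  "ring.zero (End x) = \<zero>\<^bsub>Hom C x x\<^esub>" "ring.add (End x) = ring.add (Hom C x x)"
  by (simp_all add: End_def)

lemma End_ring: assumes x: "x \<in> Obj C" shows "ring (End x)"
proof (rule ringI)
  show "abelian_group (End x)"
  proof (rule abelian_groupI)
    fix f assume "f \<in> carrier (End x)"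
    then show "\<exists>g\<in>carrier (End x). g \<oplus>\<^bsub>End x\<^esub> f = \<zero>\<^bsub>End x\<^esub>"
      using x mor_add_comm[of x x f "\<ominus>\<^bsub>Hom C x x\<^esub> f"]
      by (intro bexI[of _ "\<ominus>\<^bsub>Hom C x x\<^esub> f"]) (simp_all add: mor_r_neg)
  qed (use x in \<open>auto intro: mor_add_assoc mor_add_comm\<close>)
  show "monoid (End x)"
    by (rule monoidI) (use x in \<open>auto simp: Comp_assoc\<close>)
qed (use x in auto)

end

text \<open>The element \<open>e = p b = b' p\<close> with \<open>p = f\<^sup>n\<^sup>+\<^sup>1\<close> is the idempotent that projects onto the stable
  image of \<open>f\<close>.\<close>

lemma (in ring) fitting:
  assumes idem: "\<And>e. \<lbrakk>e \<in> carrier R; e \<otimes> e = e\<rbrakk> \<Longrightarrow> e = \<zero> \<or> e = \<one>"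
    and f: "f \<in> carrier R" and b: "b \<in> carrier R" "b' \<in> carrier R"
    and n: "f [^] (Suc n) = f [^] (Suc n) \<otimes> f [^] (Suc n) \<otimes> b"
      "f [^] (Suc n) = b' \<otimes> (f [^] (Suc n) \<otimes> f [^] (Suc n))"
  shows "f \<in> Units R \<or> f [^] (Suc n) = \<zero>"
proof -
  define p where "p = f [^] (Suc n)"
  have p: "p \<in> carrier R" using f by (simp add: p_def)
  have n1: "p = p \<otimes> p \<otimes> b" "p = b' \<otimes> (p \<otimes> p)" using n by (simp_all add: p_def)
  have eq: "b' \<otimes> p = p \<otimes> b"
  proof -
    have "b' \<otimes> p = b' \<otimes> (p \<otimes> p \<otimes> b)" using n1(1) by simp
    also have "\<dots> = b' \<otimes> (p \<otimes> p) \<otimes> b" using p b by (simp add: m_assoc)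
    finally show ?thesis using n1(2) by simp
  qed
  have "(p \<otimes> b) \<otimes> (p \<otimes> b) = (b' \<otimes> p) \<otimes> (p \<otimes> b)" using eq by simp
  also have "\<dots> = b' \<otimes> (p \<otimes> p) \<otimes> b" using p b by (simp add: m_assoc)
  also have "\<dots> = p \<otimes> b" using n1(2) by simp
  finally consider "p \<otimes> b = \<zero>" | "p \<otimes> b = \<one>" using idem p b by blast
  then show ?thesis
  proof cases
    case 1
    have "p = p \<otimes> (p \<otimes> b)" using n1(1) p b by (simp add: m_assoc)
    then show ?thesis using 1 p by (simp add: p_def)
  next
    case 2
    have pr: "p = f [^] n \<otimes> f" "p = f \<otimes> f [^] n"
      using f nat_pow_mult[OF f, of 1 n] by (simp_all add: p_def nat_pow_Suc)
    have "f \<otimes> (f [^] n \<otimes> b) = \<one>" using 2 pr(2) f b by (simp add: m_assoc)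
    moreover have "(b' \<otimes> f [^] n) \<otimes> f = \<one>" using 2 eq pr(1) f b by (simp add: m_assoc)
    moreover have "b' \<otimes> f [^] n = f [^] n \<otimes> b"
      using inv_unique[of "b' \<otimes> f [^] n" f "f [^] n \<otimes> b"] calculation f b by simp
    ultimately show ?thesis using f b unfolding Units_def by auto
  qed
qed

text \<open>A power of \<open>g\<close> that is killed by \<open>g\<close> is fixed by \<open>f\<close>, and so it is zero; descend from
  \<open>g\<^sup>m\<close> to \<open>g\<^sup>0 = 1\<close>.\<close>

lemma (in ring) nilpotent_sum_one:
  assumes fg: "f \<in> carrier R" "g \<in> carrier R" "f \<oplus> g = \<one>"
    and nil: "f [^] (n::nat) = \<zero>" "g [^] (m::nat) = \<zero>"
  shows "\<one> = \<zero>"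
proof -
  have "g [^] k = \<zero>" if "k \<le> m" for k
    using that
  proof (induction k rule: inc_induct)
    case base
    show ?case by (rule nil(2))
  next
    case (step k)
    let ?h = "g [^] k"
    have h: "?h \<in> carrier R" using fg by simp
    have "g \<otimes> ?h = \<zero>" using step(3) nat_pow_mult[OF fg(2), of 1 k] fg by simp
    then have fh: "f \<otimes> ?h = ?h"
      using l_distr[OF fg(1,2) h] fg h by simp
    have "f [^] j \<otimes> ?h = ?h" for j :: nat
      by (induction j) (use fg h fh in \<open>simp_all add: m_assoc\<close>)
    then show ?case using nil(1)[symmetric] h by (metis l_null)
  qed
  from this[of 0] show ?thesis by simp
qed

section \<open>Hom-finite categories\<close>

locale hom_finite_category = additive_category K C
  for K :: "('k, 'r) ring_scheme" and C :: "('o, 'k, 'm) lin_cat" +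
  assumes hom_finite: "hom_finite K C"
begin

text \<open>Subspaces of \<open>Hom(x,y)\<close> are given by their carriers, so that images and kernels of composition
  maps can be written as sets.\<close>

definition hdim :: "'o \<Rightarrow> 'o \<Rightarrow> 'm set \<Rightarrow> nat" where
  "hdim x y W = sdim K (Hom C x y) W"

abbreviation hom_submodule :: "'o \<Rightarrow> 'o \<Rightarrow> 'm set \<Rightarrow> bool" where
  "hom_submodule x y W \<equiv> submodule K W (Hom C x y)"

lemma Hom_fin_dim: "\<lbrakk>x \<in> Obj C; y \<in> Obj C\<rbrakk> \<Longrightarrow> vectorspace.fin_dim K (Hom C x y)"
  using hom_finite by (simp add: hom_finite_def)

lemma hom_submodule_mor: "\<lbrakk>x \<in> Obj C; y \<in> Obj C\<rbrakk> \<Longrightarrow> hom_submodule x y (mor C x y)"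
  using vectorspace.submodule_carrier[OF Hom_vectorspace] .

lemma hdim_mono:
  "\<lbrakk>x \<in> Obj C; y \<in> Obj C; hom_submodule x y W; hom_submodule x y W'; W \<subseteq> W'\<rbrakk>
    \<Longrightarrow> hdim x y W \<le> hdim x y W'"
  unfolding hdim_def by (rule vectorspace.sdim_mono[OF Hom_vectorspace Hom_fin_dim])

lemma hdim_eq_imp_eq:
  "\<lbrakk>x \<in> Obj C; y \<in> Obj C; hom_submodule x y W; hom_submodule x y W'; W \<subseteq> W'; hdim x y W' \<le> hdim x y W\<rbrakk>
    \<Longrightarrow> W = W'"
  unfolding hdim_def by (rule vectorspace.sdim_eq_imp_eq[OF Hom_vectorspace Hom_fin_dim])

lemma hdim_zero: "\<lbrakk>x \<in> Obj C; y \<in> Obj C\<rbrakk> \<Longrightarrow> hdim x y {\<zero>\<^bsub>Hom C x y\<^esub>} = 0"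
  unfolding hdim_def by (rule vectorspace.sdim_zero[OF Hom_vectorspace])

lemma hdim_zero_imp:
  "\<lbrakk>x \<in> Obj C; y \<in> Obj C; hom_submodule x y W; hdim x y W = 0\<rbrakk> \<Longrightarrow> W = {\<zero>\<^bsub>Hom C x y\<^esub>}"
  unfolding hdim_def by (rule vectorspace.sdim_zero_imp[OF Hom_vectorspace Hom_fin_dim])

lemma post_rank:
  assumes "x \<in> Obj C" "y \<in> Obj C" "z \<in> Obj C" "g \<in> mor C y z" "hom_submodule x y W"
  shows "hom_submodule x z (Comp C x y z g ` W)"
    "hdim x y W = hdim x z (Comp C x y z g ` W) + hdim x y {w \<in> W. Comp C x y z g w = \<zero>\<^bsub>Hom C x z\<^esub>}"
  using vectorspace.rank_nullity_sub[OF Hom_vectorspace[OF assms(1,2)] Hom_fin_dim[OF assms(1,2)]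
      Hom_vectorspace[OF assms(1,3)] Comp_linear_right[OF assms(1-4)] assms(5)]
  by (simp_all add: hdim_def)

lemma pre_rank:
  assumes "x \<in> Obj C" "y \<in> Obj C" "z \<in> Obj C" "f \<in> mor C x y" "hom_submodule y z W"
  shows "hom_submodule x z ((\<lambda>u. Comp C x y z u f) ` W)"
    "hdim y z W = hdim x z ((\<lambda>u. Comp C x y z u f) ` W)
      + hdim y z {w \<in> W. Comp C x y z w f = \<zero>\<^bsub>Hom C x z\<^esub>}"
  using vectorspace.rank_nullity_sub[OF Hom_vectorspace[OF assms(2,3)] Hom_fin_dim[OF assms(2,3)]
      Hom_vectorspace[OF assms(1,3)] Comp_linear_left[OF assms(1-4)] assms(5)]
  by (simp_all add: hdim_def)

lemma post_inj:
  assumes "x \<in> Obj C" "y \<in> Obj C" "z \<in> Obj C" "g \<in> mor C y z" "r \<in> mor C z y"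
    "Comp C y z y r g = Ident C y" "hom_submodule x y W"
  shows "hdim x z (Comp C x y z g ` W) = hdim x y W"
proof -
  have sub: "W \<subseteq> mor C x y" and z: "\<zero>\<^bsub>Hom C x y\<^esub> \<in> W"
    using assms(7) by (simp_all add: submodule_def)
  have k: "w = \<zero>\<^bsub>Hom C x y\<^esub>" if "w \<in> W" "Comp C x y z g w = \<zero>\<^bsub>Hom C x z\<^esub>" for w
  proof -
    have w: "w \<in> mor C x y" using that sub by blast
    then have "w = Comp C x z y r (Comp C x y z g w)"
      using Comp_assoc[of x y z y r g w] assms(1-6) by simp
    then show ?thesis unfolding that(2) using assms by simp
  qed
  have "{w \<in> W. Comp C x y z g w = \<zero>\<^bsub>Hom C x z\<^esub>} = {\<zero>\<^bsub>Hom C x y\<^esub>}" by (auto simp: z assms intro: k)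
  then show ?thesis using post_rank(2)[OF assms(1-4,7)] hdim_zero assms by simp
qed

lemma pre_inj:
  assumes "x \<in> Obj C" "y \<in> Obj C" "z \<in> Obj C" "f \<in> mor C x y" "s \<in> mor C y x"
    "Comp C y x y f s = Ident C y" "hom_submodule y z W"
  shows "hdim x z ((\<lambda>u. Comp C x y z u f) ` W) = hdim y z W"
proof -
  have sub: "W \<subseteq> mor C y z" and z: "\<zero>\<^bsub>Hom C y z\<^esub> \<in> W"
    using assms(7) by (simp_all add: submodule_def)
  have k: "w = \<zero>\<^bsub>Hom C y z\<^esub>" if "w \<in> W" "Comp C x y z w f = \<zero>\<^bsub>Hom C x z\<^esub>" for w
  proof -
    have w: "w \<in> mor C y z" using that sub by blast
    then have "w = Comp C y x z (Comp C x y z w f) s"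
      using Comp_assoc[of y x y z w f s] assms(1-6) by simp
    then show ?thesis unfolding that(2) using assms by simp
  qed
  have "{w \<in> W. Comp C x y z w f = \<zero>\<^bsub>Hom C x z\<^esub>} = {\<zero>\<^bsub>Hom C y z\<^esub>}" by (auto simp: z assms intro: k)
  then show ?thesis using pre_rank(2)[OF assms(1-4,7)] hdim_zero assms by simp
qed

definition through :: "'o \<Rightarrow> 'o \<Rightarrow> 'm \<Rightarrow> 'o \<Rightarrow> 'm set" where
  "through x y p z = (\<lambda>u. Comp C x y z u p) ` mor C y z"

lemma through_submodule:
  "\<lbrakk>x \<in> Obj C; y \<in> Obj C; z \<in> Obj C; p \<in> mor C x y\<rbrakk> \<Longrightarrow> hom_submodule x z (through x y p z)"
  unfolding through_def by (rule pre_rank(1)) (simp_all add: hom_submodule_mor)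

text \<open>The projection to \<open>z1\<close> maps the left hand space onto the first space on the right, and its kernel
  is the image of the second one under the inclusion of \<open>z2\<close>.\<close>

lemma through_biproduct:
  assumes xy: "x \<in> Obj C" "y \<in> Obj C" "p \<in> mor C x y" and b: "biproduct C z1 z2 z i1 i2 p1 p2"
  shows "hdim x z (through x y p z) = hdim x z1 (through x y p z1) + hdim x z2 (through x y p z2)"
proof -
  note [simp] = xy biproductD(1-11)[OF b]
  have "Comp C x z z1 p1 ` through x y p z = through x y p z1"
  proof (intro equalityI subsetI)
    fix w assume "w \<in> Comp C x z z1 p1 ` through x y p z"
    then obtain u where u: "u \<in> mor C y z" "w = Comp C x z z1 p1 (Comp C x y z u p)"
      by (auto simp: through_def)
    then show "w \<in> through x y p z1"
      unfolding through_def by (intro image_eqI[of _ _ "Comp C y z z1 p1 u"]) (auto simp: Comp_assoc)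
  next
    fix w assume "w \<in> through x y p z1"
    then obtain u where u: "u \<in> mor C y z1" "w = Comp C x y z1 u p" by (auto simp: through_def)
    then have "Comp C x z z1 p1 (Comp C x y z (Comp C y z1 z i1 u) p) = w"
      using Comp_assoc[of x z1 z z1 p1 i1 w, symmetric] by (simp add: Comp_assoc)
    then show "w \<in> Comp C x z z1 p1 ` through x y p z"
      unfolding through_def
      by (intro image_eqI[of w _ "Comp C x y z (Comp C y z1 z i1 u) p"] imageI) (simp_all add: u)
  qed
  moreover have "{w \<in> through x y p z. Comp C x z z1 p1 w = \<zero>\<^bsub>Hom C x z1\<^esub>}
      = Comp C x z2 z i2 ` through x y p z2"
  proof (intro equalityI subsetI)
    fix w assume "w \<in> {w \<in> through x y p z. Comp C x z z1 p1 w = \<zero>\<^bsub>Hom C x z1\<^esub>}"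
    then obtain u where u: "u \<in> mor C y z" "w = Comp C x y z u p" "Comp C x z z1 p1 w = \<zero>\<^bsub>Hom C x z1\<^esub>"
      by (auto simp: through_def)
    then have "w = Comp C x z2 z i2 (Comp C x z z2 p2 w)"
      using biproduct_split_to[OF b, of x w] by simp
    also have "Comp C x z z2 p2 w = Comp C x y z2 (Comp C y z z2 p2 u) p"
      using u by (simp add: Comp_assoc)
    finally show "w \<in> Comp C x z2 z i2 ` through x y p z2"
      unfolding through_def by (rule image_eqI) (use u in simp)
  next
    fix w assume "w \<in> Comp C x z2 z i2 ` through x y p z2"
    then obtain u where u: "u \<in> mor C y z2" "w = Comp C x z2 z i2 (Comp C x y z2 u p)"
      by (auto simp: through_def)
    then have "w = Comp C x y z (Comp C y z2 z i2 u) p" by (simp add: Comp_assoc)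
    moreover have "Comp C x z z1 p1 w = \<zero>\<^bsub>Hom C x z1\<^esub>"
      using u Comp_assoc[of x z2 z z1 p1 i2 "Comp C x y z2 u p", symmetric] by simp
    ultimately show "w \<in> {w \<in> through x y p z. Comp C x z z1 p1 w = \<zero>\<^bsub>Hom C x z1\<^esub>}"
      using u unfolding through_def by simp
  qed
  ultimately show ?thesis
    using post_rank(2)[of x z z1 p1 "through x y p z"] through_submodule
      post_inj[of x z2 z i2 p2 "through x y p z2"] by simp
qed

lemma through_Ident: "\<lbrakk>x \<in> Obj C; y \<in> Obj C\<rbrakk> \<Longrightarrow> through x x (Ident C x) y = mor C x y"
  unfolding through_def by (simp cong: image_cong)

lemma mor_biproduct_from:
  assumes w: "w \<in> Obj C" and b: "biproduct C x y z i1 i2 p1 p2"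
  shows "hdim z w (mor C z w) = hdim x w (mor C x w) + hdim y w (mor C y w)"
proof -
  note [simp] = w biproductD(1-11)[OF b]
  have "(\<lambda>u. Comp C x z w u i1) ` mor C z w = mor C x w"
  proof (intro equalityI subsetI)
    fix v assume v: "v \<in> mor C x w"
    then have "Comp C x z w (Comp C z x w v p1) i1 = v" by (simp add: Comp_assoc)
    then show "v \<in> (\<lambda>u. Comp C x z w u i1) ` mor C z w"
      by (intro image_eqI[of v _ "Comp C z x w v p1"]) (simp_all add: v)
  qed auto
  moreover have "{u \<in> mor C z w. Comp C x z w u i1 = \<zero>\<^bsub>Hom C x w\<^esub>} = (\<lambda>u. Comp C z y w u p2) ` mor C y w"
  proof (intro equalityI subsetI)
    fix u assume "u \<in> {u \<in> mor C z w. Comp C x z w u i1 = \<zero>\<^bsub>Hom C x w\<^esub>}"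
    then have "u = Comp C z y w (Comp C y z w u i2) p2" "u \<in> mor C z w"
      using biproduct_split_from[OF b, of w u] by auto
    then show "u \<in> (\<lambda>u. Comp C z y w u p2) ` mor C y w"
      by (intro image_eqI[of u _ "Comp C y z w u i2"]) simp_all
  qed (auto simp: Comp_assoc)
  ultimately show ?thesis
    using pre_rank(2)[of x z w i1 "mor C z w"] hom_submodule_mor
      pre_inj[of z y w p2 i2 "mor C y w"] by simp
qed

text \<open>Nonzero direct summands have smaller endomorphism algebras, so decomposing an object stops.\<close>

lemma decomposition_induct [consumes 1, case_names zero indecomposable sum]:
  assumes "x \<in> Obj C"
    and zero: "\<And>z. zero_object C z \<Longrightarrow> Q z"
    and ind: "\<And>z. indecomposable C z \<Longrightarrow> Q z"
    and sum: "\<And>y z s i1 i2 p1 p2. \<lbrakk>biproduct C y z s i1 i2 p1 p2; Q y; Q z\<rbrakk> \<Longrightarrow> Q s"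
  shows "Q x"
  using assms(1)
proof (induction "hdim x x (mor C x x)" arbitrary: x rule: less_induct)
  case less
  have nz: "0 < hdim v w (mor C v w)"
    if "f \<in> mor C v w" "f \<noteq> \<zero>\<^bsub>Hom C v w\<^esub>" "v \<in> Obj C" "w \<in> Obj C" for f v w
    using hdim_zero_imp[OF that(3,4) hom_submodule_mor] that by (metis gr0I singletonD)
  show ?case
  proof (cases "zero_object C x \<or> indecomposable C x")
    case True
    then show ?thesis using zero ind by blast
  next
    case False
    then obtain y z i1 i2 p1 p2 where b: "biproduct C y z x i1 i2 p1 p2"
      and nzo: "\<not> zero_object C y" "\<not> zero_object C z"
      using less.prems unfolding indecomposable_def is_direct_sum_def by blast
    note [simp] = biproductD(1-11)[OF b]
    have i1: "i1 \<noteq> \<zero>\<^bsub>Hom C y x\<^esub>"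
    proof
      assume "i1 = \<zero>\<^bsub>Hom C y x\<^esub>"
      then have "Ident C y = \<zero>\<^bsub>Hom C y y\<^esub>" using biproductD(8)[OF b] by simp
      then show False using nzo by (simp add: zero_object_iff)
    qed
    have i2: "i2 \<noteq> \<zero>\<^bsub>Hom C z x\<^esub>"
    proof
      assume "i2 = \<zero>\<^bsub>Hom C z x\<^esub>"
      then have "Ident C z = \<zero>\<^bsub>Hom C z z\<^esub>" using biproductD(9)[OF b] by simp
      then show False using nzo by (simp add: zero_object_iff)
    qed
    have e: "hdim x x (mor C x x) = hdim y x (mor C y x) + hdim z x (mor C z x)"
      by (rule mor_biproduct_from[OF _ b]) simp
    have "hdim y y (mor C y y) \<le> hdim y x (mor C y x)"
    proof -
      have "hdim y y (mor C y y) = hdim y x (Comp C y y x i1 ` mor C y y)"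
        by (rule post_inj[of y y x i1 p1, symmetric]) (simp_all add: hom_submodule_mor)
      also have "\<dots> \<le> hdim y x (mor C y x)"
        by (rule hdim_mono) (auto intro!: post_rank(1) hom_submodule_mor)
      finally show ?thesis .
    qed
    then have "Q y" using less.hyps[of y] e nz[OF _ i2] by simp
    have "hdim z z (mor C z z) \<le> hdim z x (mor C z x)"
    proof -
      have "hdim z z (mor C z z) = hdim z x (Comp C z z x i2 ` mor C z z)"
        by (rule post_inj[of z z x i2 p2, symmetric]) (simp_all add: hom_submodule_mor)
      also have "\<dots> \<le> hdim z x (mor C z x)"
        by (rule hdim_mono) (auto intro!: post_rank(1) hom_submodule_mor)
      finally show ?thesis .
    qed
    then have "Q z" using less.hyps[of z] e nz[OF _ i1] by simp
    show ?thesis using sum[OF b \<open>Q y\<close> \<open>Q z\<close>] .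
  qed
qed

end

section \<open>Indecomposable objects have local endomorphism rings\<close>

context linear_category
begin

text \<open>The images of \<open>e\<close> and of \<open>1 - e\<close> are complementary direct summands.\<close>

lemma idempotent_of_indecomposable:
  assumes si: "split_idempotents C" and x: "indecomposable C x"
    and e: "e \<in> mor C x x" "Comp C x x x e e = e"
  shows "e = \<zero>\<^bsub>Hom C x x\<^esub> \<or> e = Ident C x"
proof -
  have [simp]: "x \<in> Obj C" using x by (simp add: indecomposable_def)
  define e' where "e' = Ident C x \<ominus>\<^bsub>Hom C x x\<^esub> e"
  have e': "e' \<in> mor C x x" "Comp C x x x e' e' = e'"
    using e by (simp_all add: e'_def)
  obtain y r s where y: "y \<in> Obj C" "r \<in> mor C x y" "s \<in> mor C y x"
    "Comp C x y x s r = e" "Comp C y x y r s = Ident C y"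
    using si e unfolding split_idempotents_def by (meson \<open>x \<in> Obj C\<close>)
  obtain z r' s' where z: "z \<in> Obj C" "r' \<in> mor C x z" "s' \<in> mor C z x"
    "Comp C x z x s' r' = e'" "Comp C z x z r' s' = Ident C z"
    using si e' unfolding split_idempotents_def by (meson \<open>x \<in> Obj C\<close>)
  note [simp] = e(1) e'(1) y(1-3) z(1-3)
  have r: "r = Comp C x x y r e" using Comp_assoc[of x y x y r s r] y by simp
  have r': "r' = Comp C x x z r' e'" using Comp_assoc[of x z x z r' s' r'] z by simp
  have s: "s = Comp C y x x e s" using Comp_assoc[of y x y x s r s] y by simp
  have s': "s' = Comp C z x x e' s'" using Comp_assoc[of z x z x s' r' s'] z by simp
  have ee': "Comp C x x x e e' = \<zero>\<^bsub>Hom C x x\<^esub>" "Comp C x x x e' e = \<zero>\<^bsub>Hom C x x\<^esub>"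
    using e by (simp_all add: e'_def)
  have "Comp C z x y r s' = Comp C z x y (Comp C x x y r e) (Comp C z x x e' s')"
    using r s' by simp
  also have "\<dots> = Comp C z x y r (Comp C z x x (Comp C x x x e e') s')" by (simp add: Comp_assoc)
  finally have rs': "Comp C z x y r s' = \<zero>\<^bsub>Hom C z y\<^esub>" by (simp add: ee')
  have "Comp C y x z r' s = Comp C y x z (Comp C x x z r' e') (Comp C y x x e s)"
    using r' s by simp
  also have "\<dots> = Comp C y x z r' (Comp C y x x (Comp C x x x e' e) s)" by (simp add: Comp_assoc)
  finally have r's: "Comp C y x z r' s = \<zero>\<^bsub>Hom C y z\<^esub>" by (simp add: ee')
  have "e \<oplus>\<^bsub>Hom C x x\<^esub> e' = Ident C x"
    using mor_minus_add[of x x "Ident C x" e] mor_add_comm[of x x e e'] by (simp add: e'_def)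
  then have "biproduct C y z x s s' r r'"
    unfolding biproduct_def using y z rs' r's by simp
  then have "zero_object C y \<or> zero_object C z"
    using x unfolding indecomposable_def is_direct_sum_def by blast
  then show ?thesis
  proof
    assume "zero_object C y"
    then have "r = \<zero>\<^bsub>Hom C x y\<^esub>" by (rule zero_object_to) auto
    then show ?thesis using y(4) by simp
  next
    assume "zero_object C z"
    then have "r' = \<zero>\<^bsub>Hom C x z\<^esub>" by (rule zero_object_to) auto
    then have "e' = \<zero>\<^bsub>Hom C x x\<^esub>" using z(4) by simp
    then show ?thesis using mor_minus_eq_zero[of x x "Ident C x" e] by (simp add: e'_def)
  qed
qed

lemma indecomposable_Obj: "indecomposable C x \<Longrightarrow> x \<in> Obj C"
  by (simp add: indecomposable_def)

lemma indecomposable_nonzero: "indecomposable C x \<Longrightarrow> Ident C x \<noteq> \<zero>\<^bsub>Hom C x x\<^esub>"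
  by (simp add: indecomposable_def zero_object_iff)

text \<open>After normalisation \<open>g f = 1\<close>, and then \<open>f g\<close> is an idempotent of \<open>c'\<close>, so it is \<open>0\<close> or \<open>1\<close>.\<close>

lemma indecomposable_retract_iso:
  assumes si: "split_idempotents C" and c: "indecomposable C c" and c': "indecomposable C c'"
    and f: "f \<in> mor C c c'" and g: "g \<in> mor C c' c" and u: "Comp C c c' c g f \<in> Units (End c)"
  shows "isomorphic C c c'"
proof -
  note [simp] = indecomposable_Obj[OF c] indecomposable_Obj[OF c'] f g
  obtain w where w [simp]: "w \<in> mor C c c" and w1: "Comp C c c c w (Comp C c c' c g f) = Ident C c"
    using u by (auto simp: Units_def)
  define r where "r = Comp C c' c c w g"
  have r [simp]: "r \<in> mor C c' c" by (simp add: r_def)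
  have rf: "Comp C c c' c r f = Ident C c" using w1 by (simp add: r_def Comp_assoc)
  let ?e = "Comp C c' c c' f r"
  have "Comp C c' c' c' ?e ?e = Comp C c' c c' f (Comp C c' c c (Comp C c c' c r f) r)"
    by (simp add: Comp_assoc)
  then have "Comp C c' c' c' ?e ?e = ?e" by (simp add: rf)
  then consider "?e = \<zero>\<^bsub>Hom C c' c'\<^esub>" | "?e = Ident C c'"
    using idempotent_of_indecomposable[OF si c', of ?e] by auto
  then show ?thesis
  proof cases
    case 1
    have "Comp C c c' c (Comp C c' c' c r ?e) f = Comp C c c c (Comp C c c' c r f) (Comp C c c' c r f)"
      by (simp add: Comp_assoc)
    then have "Ident C c = \<zero>\<^bsub>Hom C c c\<^esub>" unfolding rf 1 by simp
    then show ?thesis using indecomposable_nonzero[OF c] by simp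
  next
    case 2
    then have "inverse_mor C c c' f r" using rf by (intro inverse_morI) auto
    then show ?thesis unfolding isomorphic_def iso_mor_def by auto
  qed
qed

end

context hom_finite_category
begin

text \<open>The images of left and of right multiplication with powers of \<open>f\<close> decrease, and their dimensions
  become constant. The exponent is a successor so that \<open>f\<close> can be split off in \<open>fitting\<close>.\<close>

lemma End_power_stable:
  assumes x: "x \<in> Obj C" and f: "f \<in> mor C x x"
  shows "\<exists>n. \<exists>b\<in>mor C x x. \<exists>b'\<in>mor C x x.
    f [^]\<^bsub>End x\<^esub> Suc n = Comp C x x x (Comp C x x x (f [^]\<^bsub>End x\<^esub> Suc n) (f [^]\<^bsub>End x\<^esub> Suc n)) b \<and>
    f [^]\<^bsub>End x\<^esub> Suc n = Comp C x x x b' (Comp C x x x (f [^]\<^bsub>End x\<^esub> Suc n) (f [^]\<^bsub>End x\<^esub> Suc n))"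
proof -
  interpret E: ring "End x" by (rule End_ring[OF x])
  define p where "p n = f [^]\<^bsub>End x\<^esub> n" for n :: nat
  have p [simp]: "p n \<in> mor C x x" for n
    using E.nat_pow_closed[of f n] f by (simp add: p_def)
  have pm: "Comp C x x x (p m) (p n) = p (m + n)" for m n
    using E.nat_pow_mult[of f m n] f by (simp add: p_def)
  define L where "L n = Comp C x x x (p n) ` mor C x x" for n
  define R where "R n = (\<lambda>u. Comp C x x x u (p n)) ` mor C x x" for n
  have sub: "hom_submodule x x (L n)" "hom_submodule x x (R n)" for n
    unfolding L_def R_def using x by (auto intro!: post_rank(1) pre_rank(1) hom_submodule_mor)
  have L_dec: "L (m + n) \<subseteq> L m" for m n
  proof
    fix w assume "w \<in> L (m + n)"
    then obtain u where u: "u \<in> mor C x x" "w = Comp C x x x (p (m + n)) u" by (auto simp: L_def)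
    then have "w = Comp C x x x (p m) (Comp C x x x (p n) u)"
      using x by (simp add: Comp_assoc flip: pm)
    then show "w \<in> L m" unfolding L_def by (rule image_eqI) (use u x in simp)
  qed
  have R_dec: "R (m + n) \<subseteq> R m" for m n
  proof
    fix w assume "w \<in> R (m + n)"
    then obtain u where u: "u \<in> mor C x x" "w = Comp C x x x u (p (n + m))"
      by (auto simp: R_def add.commute)
    then have "w = Comp C x x x (Comp C x x x u (p n)) (p m)"
      using x by (simp add: Comp_assoc flip: pm)
    then show "w \<in> R m" unfolding R_def by (rule image_eqI) (use u x in simp)
  qed
  \<comment> \<open>minimising the sum of both dimensions makes the two chains stable from the same index on\<close>
  define s where "s n = hdim x x (L n) + hdim x x (R n)" for n
  obtain N where N: "\<And>n. s N \<le> s n"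
    using ex_has_least_nat[of "\<lambda>_. True" 0 s] by auto
  have st: "L N = L n \<and> R N = R n" if "n \<ge> N" for n
  proof -
    have l: "L n \<subseteq> L N" "R n \<subseteq> R N" using L_dec[of N "n - N"] R_dec[of N "n - N"] that by auto
    have "hdim x x (L n) \<le> hdim x x (L N)" "hdim x x (R n) \<le> hdim x x (R N)"
      using hdim_mono[OF x x sub(1) sub(1) l(1)] hdim_mono[OF x x sub(2) sub(2) l(2)] .
    then have "hdim x x (L N) \<le> hdim x x (L n)" "hdim x x (R N) \<le> hdim x x (R n)"
      using N[of n] unfolding s_def by linarith+
    then show ?thesis
      using hdim_eq_imp_eq[OF x x sub(1) sub(1) l(1)] hdim_eq_imp_eq[OF x x sub(2) sub(2) l(2)] by simp
  qed
  have "p (Suc N) \<in> L (Suc N)" unfolding L_def using x by (intro image_eqI[of _ _ "Ident C x"]) auto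
  moreover have "L (Suc N) = L (Suc N + Suc N)" using st[of "Suc N"] st[of "Suc N + Suc N"] by simp
  ultimately obtain b where b: "b \<in> mor C x x" "p (Suc N) = Comp C x x x (p (Suc N + Suc N)) b"
    unfolding L_def by auto
  have "p (Suc N) \<in> R (Suc N)" unfolding R_def using x by (intro image_eqI[of _ _ "Ident C x"]) auto
  moreover have "R (Suc N) = R (Suc N + Suc N)" using st[of "Suc N"] st[of "Suc N + Suc N"] by simp
  ultimately obtain b' where b': "b' \<in> mor C x x" "p (Suc N) = Comp C x x x b' (p (Suc N + Suc N))"
    unfolding R_def by auto
  show ?thesis
    using b b' pm[of "Suc N" "Suc N"] unfolding p_def by (intro exI[of _ N] bexI[of _ b] bexI[of _ b']) simp_all
qed

lemma indecomposable_fitting: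
  assumes si: "split_idempotents C" and x: "indecomposable C x" and f: "f \<in> mor C x x"
  shows "f \<in> Units (End x) \<or> (\<exists>n::nat. f [^]\<^bsub>End x\<^esub> n = \<zero>\<^bsub>Hom C x x\<^esub>)"
proof -
  interpret E: ring "End x" by (rule End_ring[OF indecomposable_Obj[OF x]])
  obtain n b b' where nb: "b \<in> mor C x x" "b' \<in> mor C x x"
    "f [^]\<^bsub>End x\<^esub> Suc n = Comp C x x x (Comp C x x x (f [^]\<^bsub>End x\<^esub> Suc n) (f [^]\<^bsub>End x\<^esub> Suc n)) b"
    "f [^]\<^bsub>End x\<^esub> Suc n = Comp C x x x b' (Comp C x x x (f [^]\<^bsub>End x\<^esub> Suc n) (f [^]\<^bsub>End x\<^esub> Suc n))"
    using End_power_stable[OF indecomposable_Obj[OF x] f] by (elim exE bexE conjE)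
  have "f \<in> Units (End x) \<or> f [^]\<^bsub>End x\<^esub> Suc n = \<zero>\<^bsub>End x\<^esub>"
    by (rule E.fitting[where b = b and b' = b'])
      (use idempotent_of_indecomposable[OF si x] f nb in simp_all)
  then show ?thesis unfolding End_simps by blast
qed

text \<open>Dividing by \<open>f + g\<close> reduces to the case \<open>f + g = 1\<close>, where \<open>f\<close> and \<open>g\<close> cannot both be nilpotent.\<close>

lemma indecomposable_local:
  assumes si: "split_idempotents C" and x: "indecomposable C x"
    and f: "f \<in> mor C x x" and g: "g \<in> mor C x x" and u: "f \<oplus>\<^bsub>Hom C x x\<^esub> g \<in> Units (End x)"
  shows "f \<in> Units (End x) \<or> g \<in> Units (End x)"
proof -
  note [simp] = indecomposable_Obj[OF x] f g
  interpret E: ring "End x" by (rule End_ring) simp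
  let ?u = "f \<oplus>\<^bsub>Hom C x x\<^esub> g"
  obtain v where v: "v \<in> mor C x x" "Comp C x x x v ?u = Ident C x" "Comp C x x x ?u v = Ident C x"
    using u unfolding Units_def by auto
  have *: "k \<in> Units (End x)" if "k \<in> mor C x x" "Comp C x x x k v \<in> Units (End x)" for k
  proof -
    have "Comp C x x x (Comp C x x x k v) ?u = k"
      using that v Comp_assoc[of x x x x k v ?u] by simp
    then show ?thesis using E.Units_m_closed[OF that(2) u] by simp
  qed
  let ?f = "Comp C x x x f v" and ?g = "Comp C x x x g v"
  have fg: "?f \<oplus>\<^bsub>Hom C x x\<^esub> ?g = Ident C x" using v(1,3) by simp
  show ?thesis
  proof (rule ccontr)
    assume "\<not> ?thesis"
    then have "?f \<notin> Units (End x)" "?g \<notin> Units (End x)" using *[of f] *[of g] by auto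
    then obtain n m :: nat where "?f [^]\<^bsub>End x\<^esub> n = \<zero>\<^bsub>Hom C x x\<^esub>" "?g [^]\<^bsub>End x\<^esub> m = \<zero>\<^bsub>Hom C x x\<^esub>"
      using indecomposable_fitting[OF si x, of ?f] indecomposable_fitting[OF si x, of ?g] v by auto
    then have "\<one>\<^bsub>End x\<^esub> = \<zero>\<^bsub>End x\<^esub>"
      by (intro E.nilpotent_sum_one[of ?f ?g n m]) (use fg v in simp_all)
    then show False using indecomposable_nonzero[OF x] by simp
  qed
qed

lemma zero_not_unit:
  assumes x: "indecomposable C x" shows "\<zero>\<^bsub>Hom C x x\<^esub> \<notin> Units (End x)"
  using indecomposable_nonzero[OF x] indecomposable_Obj[OF x] unfolding Units_def by auto

text \<open>In a local ring a sum of nonunits is a nonunit, so one of the summands is a unit.\<close>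

lemma thru_unit:
  assumes si: "split_idempotents C" and x: "indecomposable C x" and T: "T \<in> Obj C"
    and h: "h \<in> thru C T x x" and u: "h \<in> Units (End x)"
  shows "\<exists>f\<in>mor C x T. \<exists>g\<in>mor C T x. Comp C x T x g f \<in> Units (End x)"
  using h u
proof induction
  case zero
  then show ?case using zero_not_unit[OF x] by blast
next
  case (add h f g)
  have "h \<in> Units (End x) \<or> Comp C x T x g f \<in> Units (End x)"
    using add thru_closed[OF T _ _ add(1)] indecomposable_Obj[OF x] T
    by (intro indecomposable_local[OF si x]) auto
  then show ?case using add by blast
qed

section \<open>Approximations\<close>

text \<open>Add one copy of \<open>u\<close> for each morphism in \<open>S\<close>.\<close>

lemma finite_approximation:
  assumes u: "u \<in> Obj C" and c: "c \<in> Obj C" and S: "finite S" "S \<subseteq> mor C u c"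
  shows "\<exists>y\<in>copies C u. \<exists>g\<in>mor C y c. S \<subseteq> Comp C u y c g ` mor C u y"
  using S
proof induction
  case empty
  obtain z where z: "zero_object C z" using zero_object_exists by blast
  then have "\<zero>\<^bsub>Hom C z c\<^esub> \<in> mor C z c" using c by (simp add: zero_object_def)
  then show ?case using copies.zero[OF z] by blast
next
  case (insert k S)
  then obtain y g where y: "y \<in> copies C u" "g \<in> mor C y c" "S \<subseteq> Comp C u y c g ` mor C u y" by blast
  have yO: "y \<in> Obj C" using copies_built_from[OF u y(1)] by (simp add: built_from_def)
  obtain y' i1 i2 p1 p2 where b: "biproduct C u y y' i2 i1 p2 p1"
    using direct_sum_exists[OF u yO] unfolding is_direct_sum_def by blast
  have y': "y' \<in> copies C u" using copies.step[OF y(1)] b unfolding is_direct_sum_def by blast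
  note [simp] = u c yO biproductD(1-11)[OF b]
  have k: "k \<in> mor C u c" using insert by simp
  define g' where "g' = Comp C y' y c g p1 \<oplus>\<^bsub>Hom C y' c\<^esub> Comp C y' u c k p2"
  have g': "g' \<in> mor C y' c" using y k by (simp add: g'_def)
  have "Comp C u y' c g' i2 = k" using y k by (simp add: g'_def Comp_assoc)
  then have "k \<in> Comp C u y' c g' ` mor C u y'" by (intro image_eqI[of _ _ i2]) auto
  moreover have "S \<subseteq> Comp C u y' c g' ` mor C u y'"
  proof
    fix l assume "l \<in> S"
    then obtain m where m: "m \<in> mor C u y" "l = Comp C u y c g m" using y(3) by auto
    have "Comp C y y' c g' i1 = g" using y k by (simp add: g'_def Comp_assoc)
    then have "l = Comp C u y' c g' (Comp C u y y' i1 m)"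
      using m g' Comp_assoc[of u y y' c g' i1 m] by simp
    then show "l \<in> Comp C u y' c g' ` mor C u y'" using m by auto
  qed
  ultimately show ?case using y' g' by blast
qed

text \<open>The morphisms that factor through \<open>g\<close> form a subspace, so a finite spanning set can be used in
  \<open>finite_approximation\<close>.\<close>

lemma approximation:
  assumes u: "u \<in> Obj C" and c: "c \<in> Obj C"
  obtains y g where "y \<in> Obj C" "built_from C u y" "g \<in> mor C y c" "Comp C u y c g ` mor C u y = mor C u c"
proof -
  interpret V: vectorspace K "Hom C u c" by (rule Hom_vectorspace[OF u c])
  obtain S where S: "finite S" "S \<subseteq> mor C u c" "V.span S = mor C u c"
    using Hom_fin_dim[OF u c] unfolding V.fin_dim_def by (elim exE conjE)
  obtain y g where y: "y \<in> copies C u" "g \<in> mor C y c" "S \<subseteq> Comp C u y c g ` mor C u y"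
    using finite_approximation[OF u c S(1,2)] by (elim bexE)
  have bf: "built_from C u y" by (rule copies_built_from[OF u y(1)])
  then have yO: "y \<in> Obj C" by (simp add: built_from_def)
  have "hom_submodule u c (Comp C u y c g ` mor C u y)"
    using u c yO y by (intro post_rank(1) hom_submodule_mor) auto
  then have "V.span S \<subseteq> Comp C u y c g ` mor C u y"
    by (rule V.span_is_subset[OF y(3)])
  moreover have "Comp C u y c g ` mor C u y \<subseteq> mor C u c" using u c yO y by auto
  ultimately show ?thesis using that[OF yO bf y(2)] S(3) by simp
qed

end

section \<open>Presentations and test sequences\<close>

context linear_category
begin

text \<open>What is used of a resolution \<open>e (d+1) \<rightarrow> \<dots> \<rightarrow> e 1 \<rightarrow> e 0\<close> of \<open>e 0\<close>: exactness of \<open>Hom(-,z)\<close>. The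
  notion also covers \<open>0 \<rightarrow> \<dots> \<rightarrow> 0 \<rightarrow> t \<rightarrow> t\<close> with \<open>t\<close> in \<open>\<T>\<close>. Numbering starts at the resolved object, against
  the direction of the morphisms.\<close>

definition presentation :: "'o \<Rightarrow> nat \<Rightarrow> (nat \<Rightarrow> 'o) \<Rightarrow> (nat \<Rightarrow> 'm) \<Rightarrow> bool" where
  "presentation T d e \<sigma> \<longleftrightarrow>
     (\<forall>j\<le>Suc d. e j \<in> Obj C) \<and>
     (\<forall>j\<le>d. \<sigma> j \<in> mor C (e (Suc j)) (e j) \<and> built_from C T (e (Suc j))) \<and>
     (\<forall>j<d. Comp C (e (Suc (Suc j))) (e (Suc j)) (e j) (\<sigma> j) (\<sigma> (Suc j)) =
        \<zero>\<^bsub>Hom C (e (Suc (Suc j))) (e j)\<^esub>) \<and>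
     (\<forall>j<d. \<forall>z\<in>Obj C. \<forall>f\<in>mor C (e (Suc j)) z.
        Comp C (e (Suc (Suc j))) (e (Suc j)) z f (\<sigma> (Suc j)) = \<zero>\<^bsub>Hom C (e (Suc (Suc j))) z\<^esub> \<longrightarrow>
        (\<exists>f'\<in>mor C (e j) z. f = Comp C (e (Suc j)) (e j) z f' (\<sigma> j)))"

text \<open>A sequence \<open>x 0 \<rightarrow> \<dots> \<rightarrow> x (d+1)\<close> on which \<open>Hom(w,-)\<close> is exact, and for \<open>w\<close> in \<open>\<T>\<close> moreover injective at the
  start. In the quotient category the objects \<open>x 0, \<dots>, x (d-1)\<close> then form a \<open>d\<close>-kernel of the last morphism.\<close>

definition test_sequence :: "'o \<Rightarrow> nat \<Rightarrow> (nat \<Rightarrow> 'o) \<Rightarrow> (nat \<Rightarrow> 'm) \<Rightarrow> bool" where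
  "test_sequence T d x \<xi> \<longleftrightarrow>
     (\<forall>i\<le>Suc d. x i \<in> Obj C) \<and>
     (\<forall>i\<le>d. \<xi> i \<in> mor C (x i) (x (Suc i))) \<and>
     (\<forall>i<d. Comp C (x i) (x (Suc i)) (x (Suc (Suc i))) (\<xi> (Suc i)) (\<xi> i) =
        \<zero>\<^bsub>Hom C (x i) (x (Suc (Suc i)))\<^esub>) \<and>
     (\<forall>i<d. \<forall>w\<in>Obj C. \<forall>f\<in>mor C w (x (Suc i)).
        Comp C w (x (Suc i)) (x (Suc (Suc i))) (\<xi> (Suc i)) f = \<zero>\<^bsub>Hom C w (x (Suc (Suc i)))\<^esub> \<longrightarrow>
        (\<exists>f'\<in>mor C w (x i). f = Comp C w (x i) (x (Suc i)) (\<xi> i) f')) \<and>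
     (\<forall>w. built_from C T w \<longrightarrow> (\<forall>f\<in>mor C w (x 0).
        Comp C w (x 0) (x (Suc 0)) (\<xi> 0) f = \<zero>\<^bsub>Hom C w (x (Suc 0))\<^esub> \<longrightarrow> f = \<zero>\<^bsub>Hom C w (x 0)\<^esub>))"

lemma presentationD:
  assumes "presentation T d e \<sigma>"
  shows "j \<le> Suc d \<Longrightarrow> e j \<in> Obj C"
    and "j \<le> d \<Longrightarrow> \<sigma> j \<in> mor C (e (Suc j)) (e j)"
    and "j \<le> d \<Longrightarrow> built_from C T (e (Suc j))"
    and "j < d \<Longrightarrow> Comp C (e (Suc (Suc j))) (e (Suc j)) (e j) (\<sigma> j) (\<sigma> (Suc j)) =
        \<zero>\<^bsub>Hom C (e (Suc (Suc j))) (e j)\<^esub>"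
    and "\<lbrakk>j < d; z \<in> Obj C; f \<in> mor C (e (Suc j)) z;
        Comp C (e (Suc (Suc j))) (e (Suc j)) z f (\<sigma> (Suc j)) = \<zero>\<^bsub>Hom C (e (Suc (Suc j))) z\<^esub>\<rbrakk>
      \<Longrightarrow> \<exists>f'\<in>mor C (e j) z. f = Comp C (e (Suc j)) (e j) z f' (\<sigma> j)"
  using assms unfolding presentation_def by simp_all

lemma test_sequenceD:
  assumes "test_sequence T d x \<xi>"
  shows "i \<le> Suc d \<Longrightarrow> x i \<in> Obj C"
    and "i \<le> d \<Longrightarrow> \<xi> i \<in> mor C (x i) (x (Suc i))"
    and "i < d \<Longrightarrow> Comp C (x i) (x (Suc i)) (x (Suc (Suc i))) (\<xi> (Suc i)) (\<xi> i) =
        \<zero>\<^bsub>Hom C (x i) (x (Suc (Suc i)))\<^esub>"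
    and "\<lbrakk>i < d; w \<in> Obj C; f \<in> mor C w (x (Suc i));
        Comp C w (x (Suc i)) (x (Suc (Suc i))) (\<xi> (Suc i)) f = \<zero>\<^bsub>Hom C w (x (Suc (Suc i)))\<^esub>\<rbrakk>
      \<Longrightarrow> \<exists>f'\<in>mor C w (x i). f = Comp C w (x i) (x (Suc i)) (\<xi> i) f'"
    and "\<lbrakk>built_from C T w; f \<in> mor C w (x 0);
        Comp C w (x 0) (x (Suc 0)) (\<xi> 0) f = \<zero>\<^bsub>Hom C w (x (Suc 0))\<^esub>\<rbrakk> \<Longrightarrow> f = \<zero>\<^bsub>Hom C w (x 0)\<^esub>"
  using assms unfolding test_sequence_def by simp_all

text \<open>This is exactness, modulo the morphisms killed by \<open>\<sigma>\<close>, of the sequence obtained from \<open>Hom(e j,-)\<close>: a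
  morphism \<open>u\<close> that is a cycle only after restriction along \<open>\<sigma> j\<close> may be replaced by a true cycle \<open>v\<close>
  with the same restriction. It is a diagram chase in the double complex of all \<open>Hom(e j, x i)\<close>. One step
  lifts \<open>u \<sigma>\<close> along \<open>\<xi>\<close> to a morphism \<open>v\<close> from \<open>e (j+1)\<close> to \<open>x (i-1)\<close>; the induction hypothesis corrects
  \<open>v\<close> by a cycle so that it extends to \<open>e j\<close>, and at \<open>x 0\<close> injectivity on \<open>\<T>\<close> ends the chase. The condition
  \<open>i + j \<le> d\<close> says that the presentation is long enough.\<close>

lemma correct_to_kernel:
  assumes P: "presentation T d e \<sigma>" and X: "test_sequence T d x \<xi>"
    and ij: "i + j \<le> d" and u: "u \<in> mor C (e j) (x i)"
    and k: "Comp C (e (Suc j)) (x i) (x (Suc i)) (\<xi> i) (Comp C (e (Suc j)) (e j) (x i) u (\<sigma> j)) =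
      \<zero>\<^bsub>Hom C (e (Suc j)) (x (Suc i))\<^esub>"
  shows "\<exists>v\<in>mor C (e j) (x i).
    Comp C (e j) (x i) (x (Suc i)) (\<xi> i) v = \<zero>\<^bsub>Hom C (e j) (x (Suc i))\<^esub> \<and>
    Comp C (e (Suc j)) (e j) (x i) v (\<sigma> j) = Comp C (e (Suc j)) (e j) (x i) u (\<sigma> j)"
  using ij u k
proof (induction i arbitrary: j u)
  case 0
  have [simp]: "e j \<in> Obj C" "e (Suc j) \<in> Obj C" "x 0 \<in> Obj C" "x (Suc 0) \<in> Obj C"
    "\<sigma> j \<in> mor C (e (Suc j)) (e j)" "\<xi> 0 \<in> mor C (x 0) (x (Suc 0))"
    using presentationD[OF P] test_sequenceD[OF X] 0(1) by simp_all
  have "Comp C (e (Suc j)) (e j) (x 0) u (\<sigma> j) = \<zero>\<^bsub>Hom C (e (Suc j)) (x 0)\<^esub>"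
    using test_sequenceD(5)[OF X presentationD(3)[OF P], of j] 0 by simp
  then show ?case by (intro bexI[of _ "\<zero>\<^bsub>Hom C (e j) (x 0)\<^esub>"]) simp_all
next
  case (Suc i)
  let ?a = "e j" and ?b = "e (Suc j)" and ?c = "e (Suc (Suc j))"
  let ?x = "x i" and ?y = "x (Suc i)" and ?z = "x (Suc (Suc i))"
  have [simp]: "?a \<in> Obj C" "?b \<in> Obj C" "?c \<in> Obj C" "?x \<in> Obj C" "?y \<in> Obj C" "?z \<in> Obj C"
    "\<sigma> j \<in> mor C ?b ?a" "\<sigma> (Suc j) \<in> mor C ?c ?b" "\<xi> i \<in> mor C ?x ?y" "\<xi> (Suc i) \<in> mor C ?y ?z"
    using presentationD[OF P] test_sequenceD[OF X] Suc(2) by simp_all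
  have ss: "Comp C ?c ?b ?a (\<sigma> j) (\<sigma> (Suc j)) = \<zero>\<^bsub>Hom C ?c ?a\<^esub>"
    using presentationD(4)[OF P] Suc(2) by simp
  have xx: "Comp C ?x ?y ?z (\<xi> (Suc i)) (\<xi> i) = \<zero>\<^bsub>Hom C ?x ?z\<^esub>"
    using test_sequenceD(3)[OF X] Suc(2) by simp
  note [simp] = Suc(3)
  obtain v where v [simp]: "v \<in> mor C ?b ?x" and uv: "Comp C ?b ?a ?y u (\<sigma> j) = Comp C ?b ?x ?y (\<xi> i) v"
    using test_sequenceD(4)[OF X, of i ?b "Comp C ?b ?a ?y u (\<sigma> j)"] Suc by auto
  have "Comp C ?c ?x ?y (\<xi> i) (Comp C ?c ?b ?x v (\<sigma> (Suc j))) =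
      Comp C ?c ?b ?y (Comp C ?b ?a ?y u (\<sigma> j)) (\<sigma> (Suc j))"
    unfolding uv by (simp add: Comp_assoc)
  also have "\<dots> = \<zero>\<^bsub>Hom C ?c ?y\<^esub>" by (simp add: Comp_assoc ss)
  finally obtain v' where v' [simp]: "v' \<in> mor C ?b ?x" "Comp C ?b ?x ?y (\<xi> i) v' = \<zero>\<^bsub>Hom C ?b ?y\<^esub>"
    and vv': "Comp C ?c ?b ?x v' (\<sigma> (Suc j)) = Comp C ?c ?b ?x v (\<sigma> (Suc j))"
    using Suc.IH[of "Suc j" v] Suc(2) by auto
  have "Comp C ?c ?b ?x (v \<ominus>\<^bsub>Hom C ?b ?x\<^esub> v') (\<sigma> (Suc j)) = \<zero>\<^bsub>Hom C ?c ?x\<^esub>"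
    by (simp add: vv')
  then obtain w where w [simp]: "w \<in> mor C ?a ?x" and vw: "v \<ominus>\<^bsub>Hom C ?b ?x\<^esub> v' = Comp C ?b ?a ?x w (\<sigma> j)"
    using presentationD(5)[OF P, of j ?x "v \<ominus>\<^bsub>Hom C ?b ?x\<^esub> v'"] Suc(2) by auto
  show ?case
  proof (intro bexI conjI)
    show "Comp C ?a ?x ?y (\<xi> i) w \<in> mor C ?a ?y" by simp
    show "Comp C ?a ?y ?z (\<xi> (Suc i)) (Comp C ?a ?x ?y (\<xi> i) w) = \<zero>\<^bsub>Hom C ?a ?z\<^esub>"
      using Comp_assoc[of ?a ?x ?y ?z "\<xi> (Suc i)" "\<xi> i" w] by (simp add: xx)
    have "Comp C ?b ?a ?y (Comp C ?a ?x ?y (\<xi> i) w) (\<sigma> j) =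
        Comp C ?b ?x ?y (\<xi> i) (v \<ominus>\<^bsub>Hom C ?b ?x\<^esub> v')"
      by (simp add: Comp_assoc vw del: Comp_minus_right)
    also have "\<dots> = Comp C ?b ?a ?y u (\<sigma> j)" by (simp add: uv)
    finally show "Comp C ?b ?a ?y (Comp C ?a ?x ?y (\<xi> i) w) (\<sigma> j) = Comp C ?b ?a ?y u (\<sigma> j)" .
  qed
qed

lemma unit_cancel:
  assumes "x \<in> Obj C" "y \<in> Obj C" "f \<in> mor C y x" "u \<in> Units (End x)"
    "Comp C y x x u f = \<zero>\<^bsub>Hom C y x\<^esub>"
  shows "f = \<zero>\<^bsub>Hom C y x\<^esub>"
proof -
  obtain v where "v \<in> mor C x x" "Comp C x x x v u = Ident C x" "u \<in> mor C x x"
    using assms(4) unfolding Units_def by auto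
  then show ?thesis using Comp_assoc[of y x x x v u f] assms by simp
qed

end

context hom_finite_category
begin

text \<open>For a resolution of \<open>c\<close> this is the dimension of \<open>Hom(c,x)\<close> in the quotient category by \<open>\<Sigma>\<^sup>d \<T>\<close>,
  realised inside \<open>Hom(t\<^sub>0,x)\<close>.\<close>

definition test_dim :: "(nat \<Rightarrow> 'o) \<Rightarrow> (nat \<Rightarrow> 'm) \<Rightarrow> 'o \<Rightarrow> nat" where
  "test_dim e \<sigma> x = hdim (e 1) x (through (e 1) (e 0) (\<sigma> 0) x)"

lemma test_dim_biproduct:
  assumes "presentation T d e \<sigma>" "biproduct C y z x i1 i2 p1 p2"
  shows "test_dim e \<sigma> x = test_dim e \<sigma> y + test_dim e \<sigma> z"
  unfolding test_dim_def
  by (rule through_biproduct[OF _ _ _ assms(2)]) (use presentationD[OF assms(1)] in auto)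

lemma test_dim_zero:
  assumes "presentation T d e \<sigma>" "zero_object C x"
  shows "test_dim e \<sigma> x = 0"
proof -
  have x: "x \<in> Obj C" using assms(2) by (simp add: zero_object_def)
  have e: "e 0 \<in> Obj C" "e 1 \<in> Obj C" "\<sigma> 0 \<in> mor C (e 1) (e 0)"
    using presentationD[OF assms(1)] by auto
  have "through (e 1) (e 0) (\<sigma> 0) x = {\<zero>\<^bsub>Hom C (e 1) x\<^esub>}"
    using assms(2) e x unfolding through_def zero_object_def by simp
  then show ?thesis using hdim_zero e x by (simp add: test_dim_def)
qed

definition test_rank :: "(nat \<Rightarrow> 'o) \<Rightarrow> (nat \<Rightarrow> 'm) \<Rightarrow> (nat \<Rightarrow> 'o) \<Rightarrow> (nat \<Rightarrow> 'm) \<Rightarrow> nat \<Rightarrow> nat" where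
  "test_rank e \<sigma> x \<xi> i = hdim (e 1) (x (Suc i))
     (Comp C (e 1) (x i) (x (Suc i)) (\<xi> i) ` through (e 1) (e 0) (\<sigma> 0) (x i))"

text \<open>Rank and nullity for the exact sequence given by \<open>correct_to_kernel\<close>; consequently all
  ranks are determined by the dimensions.\<close>

lemma test_rank_recursion:
  assumes P: "presentation T d e \<sigma>" and X: "test_sequence T d x \<xi>"
  shows "test_dim e \<sigma> (x 0) = test_rank e \<sigma> x \<xi> 0"
    and "i < d \<Longrightarrow> test_dim e \<sigma> (x (Suc i)) = test_rank e \<sigma> x \<xi> (Suc i) + test_rank e \<sigma> x \<xi> i"
proof -
  note [simp] = presentationD(1,2)[OF P] test_sequenceD(1,2)[OF X]
  have [simp]: "\<sigma> 0 \<in> mor C (e (Suc 0)) (e 0)" using presentationD(2)[OF P, of 0] by simp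
  let ?V = "\<lambda>i. through (e 1) (e 0) (\<sigma> 0) (x i)"
  let ?N = "\<lambda>i. {w \<in> ?V i. Comp C (e 1) (x i) (x (Suc i)) (\<xi> i) w = \<zero>\<^bsub>Hom C (e 1) (x (Suc i))\<^esub>}"
  have rk: "test_dim e \<sigma> (x i) = test_rank e \<sigma> x \<xi> i + hdim (e 1) (x i) (?N i)" if "i \<le> d" for i
    unfolding test_dim_def test_rank_def
    using that by (intro post_rank(2) through_submodule) auto
  have kernel: "\<exists>v\<in>mor C (e 0) (x i). w = Comp C (e 1) (e 0) (x i) v (\<sigma> 0) \<and>
      Comp C (e 0) (x i) (x (Suc i)) (\<xi> i) v = \<zero>\<^bsub>Hom C (e 0) (x (Suc i))\<^esub>"
    if "i \<le> d" "w \<in> ?N i" for i w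
  proof -
    have w: "w \<in> ?V i" "Comp C (e 1) (x i) (x (Suc i)) (\<xi> i) w = \<zero>\<^bsub>Hom C (e 1) (x (Suc i))\<^esub>"
      using that(2) by simp_all
    obtain u where u: "u \<in> mor C (e 0) (x i)" "w = Comp C (e 1) (e 0) (x i) u (\<sigma> 0)"
      using w(1) unfolding through_def by auto
    show ?thesis
      using correct_to_kernel[OF P X, of i 0 u] that(1) u w(2) by (metis One_nat_def add_0_right)
  qed
  have "?N 0 \<subseteq> {\<zero>\<^bsub>Hom C (e 1) (x 0)\<^esub>}"
  proof
    fix w assume "w \<in> ?N 0"
    then have "w \<in> mor C (e 1) (x 0)" "Comp C (e 1) (x 0) (x (Suc 0)) (\<xi> 0) w = \<zero>\<^bsub>Hom C (e 1) (x (Suc 0))\<^esub>"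
      by (auto simp: through_def)
    then show "w \<in> {\<zero>\<^bsub>Hom C (e 1) (x 0)\<^esub>}"
      using test_sequenceD(5)[OF X presentationD(3)[OF P], of 0 w] by simp
  qed
  moreover have "\<zero>\<^bsub>Hom C (e 1) (x 0)\<^esub> \<in> ?N 0"
    using submodule.zero_closed[OF through_submodule[of "e 1" "e 0" "x 0" "\<sigma> 0"]] by simp
  ultimately have "?N 0 = {\<zero>\<^bsub>Hom C (e 1) (x 0)\<^esub>}" by blast
  then show "test_dim e \<sigma> (x 0) = test_rank e \<sigma> x \<xi> 0"
    using rk[of 0] hdim_zero[of "e 1" "x 0"] by simp
  assume i: "i < d"
  have "?N (Suc i) = Comp C (e 1) (x i) (x (Suc i)) (\<xi> i) ` ?V i"
  proof (intro equalityI subsetI)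
    fix w assume "w \<in> ?N (Suc i)"
    then obtain v where v: "v \<in> mor C (e 0) (x (Suc i))" "w = Comp C (e 1) (e 0) (x (Suc i)) v (\<sigma> 0)"
      "Comp C (e 0) (x (Suc i)) (x (Suc (Suc i))) (\<xi> (Suc i)) v = \<zero>\<^bsub>Hom C (e 0) (x (Suc (Suc i)))\<^esub>"
      using kernel[of "Suc i" w] i by auto
    then obtain v' where v': "v' \<in> mor C (e 0) (x i)" "v = Comp C (e 0) (x i) (x (Suc i)) (\<xi> i) v'"
      using test_sequenceD(4)[OF X i, of "e 0" v] by auto
    then have "w = Comp C (e 1) (x i) (x (Suc i)) (\<xi> i) (Comp C (e 1) (e 0) (x i) v' (\<sigma> 0))"
      using v i by (simp add: Comp_assoc)
    then show "w \<in> Comp C (e 1) (x i) (x (Suc i)) (\<xi> i) ` ?V i" using v' unfolding through_def by blast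
  next
    fix w assume "w \<in> Comp C (e 1) (x i) (x (Suc i)) (\<xi> i) ` ?V i"
    then obtain u where u: "u \<in> mor C (e 0) (x i)"
      "w = Comp C (e 1) (x i) (x (Suc i)) (\<xi> i) (Comp C (e 1) (e 0) (x i) u (\<sigma> 0))"
      unfolding through_def by auto
    then have "w = Comp C (e 1) (e 0) (x (Suc i)) (Comp C (e 0) (x i) (x (Suc i)) (\<xi> i) u) (\<sigma> 0)"
      using i by (simp add: Comp_assoc)
    moreover have "Comp C (e 1) (x (Suc i)) (x (Suc (Suc i))) (\<xi> (Suc i)) w = \<zero>\<^bsub>Hom C (e 1) (x (Suc (Suc i)))\<^esub>"
      using Comp_assoc[of "e 1" "x i" "x (Suc i)" "x (Suc (Suc i))" "\<xi> (Suc i)" "\<xi> i"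
          "Comp C (e 1) (e 0) (x i) u (\<sigma> 0)"] u i test_sequenceD(3)[OF X i] by simp
    ultimately show "w \<in> ?N (Suc i)" using u i unfolding through_def by simp
  qed
  then show "test_dim e \<sigma> (x (Suc i)) = test_rank e \<sigma> x \<xi> (Suc i) + test_rank e \<sigma> x \<xi> i"
    using rk[of "Suc i"] i by (simp add: test_rank_def)
qed

lemma test_rank_eq:
  assumes P: "presentation T d e \<sigma>" and P': "presentation T d e' \<sigma>'" and X: "test_sequence T d x \<xi>"
    and eq: "\<And>y. y \<in> Obj C \<Longrightarrow> test_dim e \<sigma> y = test_dim e' \<sigma>' y"
  shows "i \<le> d \<Longrightarrow> test_rank e \<sigma> x \<xi> i = test_rank e' \<sigma>' x \<xi> i"
proof (induction i)
  case 0
  then show ?case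
    using test_rank_recursion(1)[OF P X] test_rank_recursion(1)[OF P' X] eq test_sequenceD(1)[OF X, of 0]
    by simp
next
  case (Suc i)
  then show ?case
    using test_rank_recursion(2)[OF P X, of i] test_rank_recursion(2)[OF P' X, of i]
      eq[of "x (Suc i)"] test_sequenceD(1)[OF X, of "Suc i"] by simp
qed

text \<open>Here \<open>N\<close> is \<open>\<Sigma>\<^sup>d T\<close>, and \<open>\<xi> d\<close> is an approximation of \<open>e 0\<close> by copies of \<open>u = e' 0 \<oplus> N\<close>. Composition with
  \<open>\<xi> d\<close> is onto for \<open>e'\<close>. The ranks agree, so it is onto for \<open>e\<close> and \<open>\<sigma> 0\<close> equals \<open>g h \<sigma> 0\<close> with \<open>g = \<xi> d\<close>.
  No unit of \<open>End (e 0)\<close> annihilates \<open>\<sigma> 0\<close>; this makes \<open>g h\<close> a unit, and it excludes \<open>N\<close> as the factor of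
  \<open>u\<close> through which a unit passes.\<close>

lemma presentations_determine_object:
  assumes si: "split_idempotents C" and T: "T \<in> Obj C"
    and P: "presentation T d e \<sigma>" and P': "presentation T d e' \<sigma>'"
    and ind: "indecomposable C (e 0)" "indecomposable C (e' 0)"
    and nz: "\<sigma> 0 \<noteq> \<zero>\<^bsub>Hom C (e 1) (e 0)\<^esub>"
    and eq: "\<And>y. y \<in> Obj C \<Longrightarrow> test_dim e \<sigma> y = test_dim e' \<sigma>' y"
    and N: "N \<in> Obj C" "mor C T N = {\<zero>\<^bsub>Hom C T N\<^esub>}"
    and b: "biproduct C (e' 0) N u i1 i2 p1 p2"
    and X: "test_sequence T d x \<xi>" "x (Suc d) = e 0" "built_from C u (x d)"
    and appr: "Comp C u (x d) (e 0) (\<xi> d) ` mor C u (x d) = mor C u (e 0)"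
  shows "isomorphic C (e 0) (e' 0)"
proof -
  let ?c = "e 0" and ?c' = "e' 0" and ?y = "x d" and ?g = "\<xi> d"
  note [simp] = biproductD(1-11)[OF b] T
  have [simp]: "?c \<in> Obj C" "e 1 \<in> Obj C" "e (Suc 0) \<in> Obj C" "e' 1 \<in> Obj C" "e' (Suc 0) \<in> Obj C"
     "?y \<in> Obj C" "?g \<in> mor C ?y ?c"
    "\<sigma> 0 \<in> mor C (e 1) ?c" "\<sigma>' 0 \<in> mor C (e' 1) ?c'" "\<sigma> 0 \<in> mor C (e (Suc 0)) ?c" "\<sigma>' 0 \<in> mor C (e' (Suc 0)) ?c'"
    using presentationD(1)[OF P, of 0] presentationD(1)[OF P, of 1] presentationD(1)[OF P', of 1]
      presentationD(2)[OF P, of 0] presentationD(2)[OF P', of 0]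
      test_sequenceD(1)[OF X(1), of d] test_sequenceD(2)[OF X(1), of d] X(2) by simp_all
  let ?V = "through (e 1) ?c (\<sigma> 0)" and ?V' = "through (e' 1) ?c' (\<sigma>' 0)"
  have "Comp C (e' 1) ?y ?c ?g ` ?V' ?y = ?V' ?c"
  proof (intro equalityI subsetI)
    fix w assume "w \<in> Comp C (e' 1) ?y ?c ?g ` ?V' ?y"
    then obtain v where v: "v \<in> mor C ?c' ?y" "w = Comp C (e' 1) ?y ?c ?g (Comp C (e' 1) ?c' ?y v (\<sigma>' 0))"
      unfolding through_def by auto
    then have "w = Comp C (e' 1) ?c' ?c (Comp C ?c' ?y ?c ?g v) (\<sigma>' 0)" by (simp add: Comp_assoc)
    then show "w \<in> ?V' ?c" unfolding through_def by (rule image_eqI) (use v in simp)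
  next
    fix w assume "w \<in> ?V' ?c"
    then obtain k where k: "k \<in> mor C ?c' ?c" "w = Comp C (e' 1) ?c' ?c k (\<sigma>' 0)"
      unfolding through_def by auto
    have "Comp C u ?c' ?c k p1 \<in> mor C u ?c" using k by simp
    then obtain m where m: "m \<in> mor C u ?y" "Comp C u ?c' ?c k p1 = Comp C u ?y ?c ?g m"
      unfolding appr[symmetric] by auto
    have "k = Comp C ?c' u ?c (Comp C u ?c' ?c k p1) i1" using k by (simp add: Comp_assoc)
    also have "\<dots> = Comp C ?c' ?y ?c ?g (Comp C ?c' u ?y m i1)" unfolding m(2) using m by (simp add: Comp_assoc)
    finally have k': "k = Comp C ?c' ?y ?c ?g (Comp C ?c' u ?y m i1)" .
    have "w = Comp C (e' 1) ?y ?c ?g (Comp C (e' 1) ?c' ?y (Comp C ?c' u ?y m i1) (\<sigma>' 0))"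
      unfolding k(2) by (subst k') (use m in \<open>simp add: Comp_assoc\<close>)
    then show "w \<in> Comp C (e' 1) ?y ?c ?g ` ?V' ?y"
      unfolding through_def by (rule image_eqI) (use m in auto)
  qed
  then have "test_rank e' \<sigma>' x \<xi> d = test_dim e' \<sigma>' ?c"
    unfolding test_rank_def test_dim_def X(2) by simp
  then have rk: "test_rank e \<sigma> x \<xi> d = test_dim e \<sigma> ?c"
    using test_rank_eq[OF P P' X(1) eq, of d] eq[of ?c] by simp
  have sub: "Comp C (e 1) ?y ?c ?g ` ?V ?y \<subseteq> ?V ?c"
  proof
    fix w assume "w \<in> Comp C (e 1) ?y ?c ?g ` ?V ?y"
    then obtain v where v: "v \<in> mor C ?c ?y" "w = Comp C (e 1) ?y ?c ?g (Comp C (e 1) ?c ?y v (\<sigma> 0))"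
      unfolding through_def by auto
    then have "w = Comp C (e 1) ?c ?c (Comp C ?c ?y ?c ?g v) (\<sigma> 0)" by (simp add: Comp_assoc)
    then show "w \<in> ?V ?c" unfolding through_def by (rule image_eqI) (use v in simp)
  qed
  have "Comp C (e 1) ?y ?c ?g ` ?V ?y = ?V ?c"
  proof (rule hdim_eq_imp_eq[OF _ _ _ _ sub])
    show "hdim (e 1) ?c (?V ?c) \<le> hdim (e 1) ?c (Comp C (e 1) ?y ?c ?g ` ?V ?y)"
      using rk unfolding test_rank_def test_dim_def X(2) by simp
  qed (auto intro!: post_rank(1) through_submodule)
  moreover have "\<sigma> 0 \<in> ?V ?c"
    unfolding through_def by (rule image_eqI[of _ _ "Ident C ?c"]) simp_all
  ultimately obtain h where h: "h \<in> mor C ?c ?y" "\<sigma> 0 = Comp C (e 1) ?y ?c ?g (Comp C (e 1) ?c ?y h (\<sigma> 0))"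
    unfolding through_def by force
  note [simp] = h(1)
  let ?gh = "Comp C ?c ?y ?c ?g h"
  have kill: "Comp C (e 1) ?c ?c (Ident C ?c \<ominus>\<^bsub>Hom C ?c ?c\<^esub> ?gh) (\<sigma> 0) = \<zero>\<^bsub>Hom C (e 1) ?c\<^esub>"
    using h(2)[symmetric] by (simp add: Comp_assoc)
  have not_unit: False if "w \<in> Units (End ?c)" "Comp C (e 1) ?c ?c w (\<sigma> 0) = \<zero>\<^bsub>Hom C (e 1) ?c\<^esub>" for w
    using unit_cancel[OF _ _ _ that(1), of "e 1" "\<sigma> 0"] that(2) nz by simp
  interpret E: ring "End ?c" by (rule End_ring) simp
  have "(Ident C ?c \<ominus>\<^bsub>Hom C ?c ?c\<^esub> ?gh) \<oplus>\<^bsub>Hom C ?c ?c\<^esub> ?gh = \<one>\<^bsub>End ?c\<^esub>"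
    by (simp add: mor_minus_add)
  then have "(Ident C ?c \<ominus>\<^bsub>Hom C ?c ?c\<^esub> ?gh) \<oplus>\<^bsub>Hom C ?c ?c\<^esub> ?gh \<in> Units (End ?c)"
    using E.Units_one_closed by metis
  then have "?gh \<in> Units (End ?c)"
    using indecomposable_local[OF si ind(1), of "Ident C ?c \<ominus>\<^bsub>Hom C ?c ?c\<^esub> ?gh" ?gh] not_unit[OF _ kill]
    by auto
  moreover have "?gh \<in> thru C u ?c ?c"
    by (rule thru_Comp_left[of u ?c ?y]) (use built_from_thru_right[of u ?y ?c h] X(3) in simp_all)
  ultimately obtain f k where fk: "f \<in> mor C ?c u" "k \<in> mor C u ?c" "Comp C ?c u ?c k f \<in> Units (End ?c)"
    using thru_unit[OF si ind(1), of u ?gh] by auto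
  note [simp] = fk(1,2)
  let ?f1 = "Comp C ?c u ?c' p1 f" and ?k1 = "Comp C ?c' u ?c k i1"
  let ?f2 = "Comp C ?c u N p2 f" and ?k2 = "Comp C N u ?c k i2"
  have "Comp C ?c u ?c k f = Comp C ?c u ?c k (Comp C ?c ?c' u i1 ?f1 \<oplus>\<^bsub>Hom C ?c u\<^esub> Comp C ?c N u i2 ?f2)"
    using biproduct_split_to[OF b, of ?c f] by simp
  also have "\<dots> = Comp C ?c ?c' ?c ?k1 ?f1 \<oplus>\<^bsub>Hom C ?c ?c\<^esub> Comp C ?c N ?c ?k2 ?f2"
    by (simp add: Comp_assoc)
  finally have "Comp C ?c ?c' ?c ?k1 ?f1 \<oplus>\<^bsub>Hom C ?c ?c\<^esub> Comp C ?c N ?c ?k2 ?f2 \<in> Units (End ?c)"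
    using fk(3) by metis
  then consider "Comp C ?c ?c' ?c ?k1 ?f1 \<in> Units (End ?c)" | "Comp C ?c N ?c ?k2 ?f2 \<in> Units (End ?c)"
    using indecomposable_local[OF si ind(1), of "Comp C ?c ?c' ?c ?k1 ?f1" "Comp C ?c N ?c ?k2 ?f2"] by auto
  then show ?thesis
  proof cases
    case 1
    then show ?thesis
      by (intro indecomposable_retract_iso[OF si ind, of ?f1 ?k1]) simp_all
  next
    case 2
    have "Comp C (e 1) ?c N ?f2 (\<sigma> 0) \<in> thru C T (e 1) N"
      by (rule built_from_thru_left) (use presentationD(3)[OF P, of 0] N in simp_all)
    then have "Comp C (e 1) ?c N ?f2 (\<sigma> 0) = \<zero>\<^bsub>Hom C (e 1) N\<^esub>"
      by (intro thru_no_maps_to[of T]) (use N in simp_all)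
    then have "Comp C (e 1) ?c ?c (Comp C ?c N ?c ?k2 ?f2) (\<sigma> 0) = \<zero>\<^bsub>Hom C (e 1) ?c\<^esub>"
      using Comp_assoc[of "e 1" ?c N ?c ?k2 ?f2 "\<sigma> 0"] by simp
    then show ?thesis using not_unit 2 by blast
  qed
qed

end

section \<open>Additive functors and exactness\<close>

context linear_category
begin

context
  fixes H assumes H: "is_additive_functor C H"
begin

lemma functor_obj: "x \<in> Obj C \<Longrightarrow> fobj H x \<in> Obj C"
  and functor_mor: "\<lbrakk>x \<in> Obj C; y \<in> Obj C; f \<in> mor C x y\<rbrakk> \<Longrightarrow> fmor H x y f \<in> mor C (fobj H x) (fobj H y)"
  and functor_Ident: "x \<in> Obj C \<Longrightarrow> fmor H x x (Ident C x) = Ident C (fobj H x)"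
  and functor_Comp: "\<lbrakk>x \<in> Obj C; y \<in> Obj C; z \<in> Obj C; f \<in> mor C x y; g \<in> mor C y z\<rbrakk> \<Longrightarrow>
    fmor H x z (Comp C x y z g f) = Comp C (fobj H x) (fobj H y) (fobj H z) (fmor H y z g) (fmor H x y f)"
  and functor_add: "\<lbrakk>x \<in> Obj C; y \<in> Obj C; f \<in> mor C x y; g \<in> mor C x y\<rbrakk> \<Longrightarrow>
    fmor H x y (f \<oplus>\<^bsub>Hom C x y\<^esub> g) = fmor H x y f \<oplus>\<^bsub>Hom C (fobj H x) (fobj H y)\<^esub> fmor H x y g"
  using H unfolding is_additive_functor_def is_functor_def by blast+

lemma functor_zero:
  assumes "x \<in> Obj C" "y \<in> Obj C"
  shows "fmor H x y \<zero>\<^bsub>Hom C x y\<^esub> = \<zero>\<^bsub>Hom C (fobj H x) (fobj H y)\<^esub>"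
proof -
  interpret A: abelian_group "Hom C (fobj H x) (fobj H y)"
    by (rule Hom_abelian_group) (simp_all add: functor_obj assms)
  let ?z = "fmor H x y \<zero>\<^bsub>Hom C x y\<^esub>"
  have z: "?z \<in> mor C (fobj H x) (fobj H y)" using assms functor_mor by simp
  have "?z \<oplus>\<^bsub>Hom C (fobj H x) (fobj H y)\<^esub> ?z = ?z"
    using functor_add[of x y "\<zero>\<^bsub>Hom C x y\<^esub>" "\<zero>\<^bsub>Hom C x y\<^esub>"] assms by simp
  then show ?thesis using z A.add.r_cancel_one by simp
qed

lemma functor_zero_object: assumes "zero_object C z" shows "zero_object C (fobj H z)"
  using assms functor_Ident[of z] functor_zero[of z z] functor_obj
  by (auto simp: zero_object_iff)

lemma functor_biproduct:
  assumes b: "biproduct C x y z i1 i2 p1 p2"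
  shows "biproduct C (fobj H x) (fobj H y) (fobj H z)
    (fmor H x z i1) (fmor H y z i2) (fmor H z x p1) (fmor H z y p2)"
proof -
  note [simp] = biproductD(1-11)[OF b]
  have "Comp C (fobj H z) (fobj H x) (fobj H z) (fmor H x z i1) (fmor H z x p1)
      \<oplus>\<^bsub>Hom C (fobj H z) (fobj H z)\<^esub>
      Comp C (fobj H z) (fobj H y) (fobj H z) (fmor H y z i2) (fmor H z y p2)
    = Ident C (fobj H z)"
    by (simp add: functor_add[symmetric] functor_Ident[symmetric] functor_Comp[symmetric]
        biproductD(12)[OF b])
  then show ?thesis
    unfolding biproduct_def
    by (simp add: functor_obj functor_mor functor_Ident[symmetric] functor_zero[symmetric]
        functor_Comp[symmetric])
qed

lemma functor_thru:
  assumes T: "T \<in> Obj C" "x \<in> Obj C" "y \<in> Obj C" and h: "h \<in> thru C T x y"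
  shows "fmor H x y h \<in> thru C (fobj H T) (fobj H x) (fobj H y)"
  using h
proof induction
  case zero
  then show ?case using T thru.zero by (simp add: functor_zero)
next
  case (add h f g)
  have "fmor H x y h \<oplus>\<^bsub>Hom C (fobj H x) (fobj H y)\<^esub>
      Comp C (fobj H x) (fobj H T) (fobj H y) (fmor H T y g) (fmor H x T f)
      \<in> thru C (fobj H T) (fobj H x) (fobj H y)"
    using add T by (intro thru.add) (auto simp: functor_mor)
  then show ?case using add T thru_closed[OF T add(1)] by (simp add: functor_add functor_Comp)
qed

lemma functor_built_from:
  assumes "T \<in> Obj C" "built_from C T e" shows "built_from C (fobj H T) (fobj H e)"
  using assms functor_thru[of T e e "Ident C e"] by (simp add: built_from_def functor_obj functor_Ident)

lemma functor_iso:
  assumes "isomorphic C x y" shows "isomorphic C (fobj H x) (fobj H y)"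
proof -
  obtain f g where [simp]: "x \<in> Obj C" "y \<in> Obj C" "f \<in> mor C x y" "g \<in> mor C y x"
    and fg: "Comp C x y x g f = Ident C x" "Comp C y x y f g = Ident C y"
    using assms unfolding isomorphic_def iso_mor_def inverse_mor_def by blast
  have "inverse_mor C (fobj H x) (fobj H y) (fmor H x y f) (fmor H y x g)"
    by (rule inverse_morI) (simp_all add: functor_mor functor_Comp[symmetric] fg functor_Ident)
  then show ?thesis unfolding isomorphic_def iso_mor_def by (auto simp: functor_obj)
qed

end

text \<open>Exactness at the middle term after applying any covariant or contravariant Hom functor.\<close>

definition exact_at :: "'o \<Rightarrow> 'o \<Rightarrow> 'o \<Rightarrow> 'm \<Rightarrow> 'm \<Rightarrow> bool" where
  "exact_at x y z f g \<longleftrightarrow> x \<in> Obj C \<and> y \<in> Obj C \<and> z \<in> Obj C \<and> f \<in> mor C x y \<and> g \<in> mor C y z \<and>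
     Comp C x y z g f = \<zero>\<^bsub>Hom C x z\<^esub> \<and>
     (\<forall>w\<in>Obj C. \<forall>h\<in>mor C w y. Comp C w y z g h = \<zero>\<^bsub>Hom C w z\<^esub> \<longrightarrow> (\<exists>k\<in>mor C w x. h = Comp C w x y f k)) \<and>
     (\<forall>w\<in>Obj C. \<forall>h\<in>mor C y w. Comp C x y w h f = \<zero>\<^bsub>Hom C x w\<^esub> \<longrightarrow> (\<exists>k\<in>mor C z w. h = Comp C y z w k g))"

lemma exact_atD:
  assumes "exact_at x y z f g"
  shows "x \<in> Obj C" "y \<in> Obj C" "z \<in> Obj C" "f \<in> mor C x y" "g \<in> mor C y z"
    "Comp C x y z g f = \<zero>\<^bsub>Hom C x z\<^esub>"
    "\<lbrakk>w \<in> Obj C; h \<in> mor C w y; Comp C w y z g h = \<zero>\<^bsub>Hom C w z\<^esub>\<rbrakk> \<Longrightarrow> \<exists>k\<in>mor C w x. h = Comp C w x y f k"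
    "\<lbrakk>w \<in> Obj C; h' \<in> mor C y w; Comp C x y w h' f = \<zero>\<^bsub>Hom C x w\<^esub>\<rbrakk> \<Longrightarrow> \<exists>k\<in>mor C z w. h' = Comp C y z w k g"
  using assms unfolding exact_at_def by simp_all

lemma mor_neg_eq_zero:
  "\<lbrakk>x \<in> Obj C; y \<in> Obj C; f \<in> mor C x y\<rbrakk> \<Longrightarrow> \<ominus>\<^bsub>Hom C x y\<^esub> f = \<zero>\<^bsub>Hom C x y\<^esub> \<longleftrightarrow> f = \<zero>\<^bsub>Hom C x y\<^esub>"
  by (metis mor_neg_neg mor_neg_zero)

lemma exact_at_neg_right:
  assumes "exact_at x y z f g" shows "exact_at x y z f (\<ominus>\<^bsub>Hom C y z\<^esub> g)"
proof -
  note [simp] = exact_atD(1-6)[OF assms]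
  have "\<exists>k\<in>mor C w x. h = Comp C w x y f k"
    if "w \<in> Obj C" "h \<in> mor C w y" "Comp C w y z (\<ominus>\<^bsub>Hom C y z\<^esub> g) h = \<zero>\<^bsub>Hom C w z\<^esub>" for w h
    using that by (intro exact_atD(7)[OF assms]) (simp_all add: mor_neg_eq_zero)
  moreover have "\<exists>k\<in>mor C z w. h = Comp C y z w k (\<ominus>\<^bsub>Hom C y z\<^esub> g)"
    if h: "w \<in> Obj C" "h \<in> mor C y w" "Comp C x y w h f = \<zero>\<^bsub>Hom C x w\<^esub>" for w h
  proof -
    obtain k where "k \<in> mor C z w" "h = Comp C y z w k g" using exact_atD(8)[OF assms h] by blast
    then show ?thesis using h by (intro bexI[of _ "\<ominus>\<^bsub>Hom C z w\<^esub> k"]) simp_all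
  qed
  ultimately show ?thesis unfolding exact_at_def by simp
qed

end

section \<open>Exactness of angles\<close>

context angulated_category
begin

text \<open>A strict inverse of \<open>F\<close>, standing for \<open>\<Sigma>\<^sup>-\<^sup>d\<close>.\<close>

definition Fi :: "('o, 'm) endofunctor" where
  "Fi = (SOME G. is_additive_functor C G \<and>
     eq_functor C (comp_functor G F) id_functor \<and> eq_functor C (comp_functor F G) id_functor)"

lemma F_additive: "is_additive_functor C F"
  using automorphism by (simp add: automorphism_def)

lemma Fi_props: "is_additive_functor C Fi \<and>
     eq_functor C (comp_functor Fi F) id_functor \<and> eq_functor C (comp_functor F Fi) id_functor"
  unfolding Fi_def by (rule someI_ex) (use automorphism in \<open>simp add: automorphism_def\<close>)

lemma Fi_additive: "is_additive_functor C Fi"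
  using Fi_props by blast

lemma Fi_F [simp]:
  "x \<in> Obj C \<Longrightarrow> fobj Fi (fobj F x) = x"
  "\<lbrakk>x \<in> Obj C; y \<in> Obj C; f \<in> mor C x y\<rbrakk> \<Longrightarrow> fmor Fi (fobj F x) (fobj F y) (fmor F x y f) = f"
  and F_Fi [simp]:
  "x \<in> Obj C \<Longrightarrow> fobj F (fobj Fi x) = x"
  "\<lbrakk>x \<in> Obj C; y \<in> Obj C; f \<in> mor C x y\<rbrakk> \<Longrightarrow> fmor F (fobj Fi x) (fobj Fi y) (fmor Fi x y f) = f"
  using Fi_props by (simp_all add: eq_functor_def comp_functor_def id_functor_def)

lemmas F_simps [simp] = functor_obj[OF F_additive] functor_mor[OF F_additive]
  functor_obj[OF Fi_additive] functor_mor[OF Fi_additive]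

lemma F_full:
  assumes "x \<in> Obj C" "y \<in> Obj C" "g \<in> mor C (fobj F x) (fobj F y)"
  obtains f where "f \<in> mor C x y" "g = fmor F x y f"
  using that[of "fmor Fi (fobj F x) (fobj F y) g"] functor_mor[OF Fi_additive, of "fobj F x" "fobj F y" g]
    F_Fi(2)[of "fobj F x" "fobj F y" g] assms by simp

lemma F_faithful:
  "\<lbrakk>x \<in> Obj C; y \<in> Obj C; f \<in> mor C x y; g \<in> mor C x y; fmor F x y f = fmor F x y g\<rbrakk> \<Longrightarrow> f = g"
  by (metis Fi_F(2))

lemma Fi_faithful:
  "\<lbrakk>x \<in> Obj C; y \<in> Obj C; f \<in> mor C x y; g \<in> mor C x y; fmor Fi x y f = fmor Fi x y g\<rbrakk> \<Longrightarrow> f = g"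
  by (metis F_Fi(2))

lemma Fi_full:
  assumes "x \<in> Obj C" "y \<in> Obj C" "g \<in> mor C (fobj Fi x) (fobj Fi y)"
  obtains f where "f \<in> mor C x y" "g = fmor Fi x y f"
  using that[of "fmor F (fobj Fi x) (fobj Fi y) g"] functor_mor[OF F_additive, of "fobj Fi x" "fobj Fi y" g]
    Fi_F(2)[of "fobj Fi x" "fobj Fi y" g] assms by simp

lemma Fi_exact_at:
  assumes e: "exact_at x y z f g"
  shows "exact_at (fobj Fi x) (fobj Fi y) (fobj Fi z) (fmor Fi x y f) (fmor Fi y z g)"
proof -
  note [simp] = exact_atD(1-6)[OF e]
  have "\<exists>k\<in>mor C w (fobj Fi x). h = Comp C w (fobj Fi x) (fobj Fi y) (fmor Fi x y f) k"
    if h: "w \<in> Obj C" "h \<in> mor C w (fobj Fi y)"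
      "Comp C w (fobj Fi y) (fobj Fi z) (fmor Fi y z g) h = \<zero>\<^bsub>Hom C w (fobj Fi z)\<^esub>" for w h
  proof -
    note [simp] = h(1)
    obtain h' where h': "h' \<in> mor C (fobj F w) y" "h = fmor Fi (fobj F w) y h'"
      using Fi_full[of "fobj F w" y h] h by auto
    have "fmor Fi (fobj F w) z (Comp C (fobj F w) y z g h') = fmor Fi (fobj F w) z \<zero>\<^bsub>Hom C (fobj F w) z\<^esub>"
      using h(3) h' by (simp add: functor_Comp[OF Fi_additive] functor_zero[OF Fi_additive])
    then have "Comp C (fobj F w) y z g h' = \<zero>\<^bsub>Hom C (fobj F w) z\<^esub>"
      using F_Fi(2)[of "fobj F w" z] h' by (metis F_simps(1) Comp_closed exact_atD(2,3,5)[OF e] h(1) mor_zero)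
    then obtain k where k: "k \<in> mor C (fobj F w) x" "h' = Comp C (fobj F w) x y f k"
      using exact_atD(7)[OF e, of "fobj F w" h'] h' by auto
    then show ?thesis
      using h' functor_mor[OF Fi_additive, of "fobj F w" x k]
      by (intro bexI[of _ "fmor Fi (fobj F w) x k"]) (simp_all add: functor_Comp[OF Fi_additive])
  qed
  moreover have "\<exists>k\<in>mor C (fobj Fi z) w. h = Comp C (fobj Fi y) (fobj Fi z) w k (fmor Fi y z g)"
    if h: "w \<in> Obj C" "h \<in> mor C (fobj Fi y) w"
      "Comp C (fobj Fi x) (fobj Fi y) w h (fmor Fi x y f) = \<zero>\<^bsub>Hom C (fobj Fi x) w\<^esub>" for w h
  proof -
    note [simp] = h(1)
    obtain h' where h': "h' \<in> mor C y (fobj F w)" "h = fmor Fi y (fobj F w) h'"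
      using Fi_full[of y "fobj F w" h] h by auto
    have "fmor Fi x (fobj F w) (Comp C x y (fobj F w) h' f) = fmor Fi x (fobj F w) \<zero>\<^bsub>Hom C x (fobj F w)\<^esub>"
      using h(3) h' by (simp add: functor_Comp[OF Fi_additive] functor_zero[OF Fi_additive])
    then have "Comp C x y (fobj F w) h' f = \<zero>\<^bsub>Hom C x (fobj F w)\<^esub>"
      using F_Fi(2)[of x "fobj F w"] h' by (metis F_simps(1) Comp_closed exact_atD(1,2,4)[OF e] h(1) mor_zero)
    then obtain k where k: "k \<in> mor C z (fobj F w)" "h' = Comp C y z (fobj F w) k g"
      using exact_atD(8)[OF e, of "fobj F w" h'] h' by auto
    then show ?thesis
      using h' functor_mor[OF Fi_additive, of z "fobj F w" k]
      by (intro bexI[of _ "fmor Fi z (fobj F w) k"]) (simp_all add: functor_Comp[OF Fi_additive])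
  qed
  ultimately show ?thesis
    unfolding exact_at_def
    by (simp add: functor_Comp[OF Fi_additive, symmetric] functor_zero[OF Fi_additive])
qed

lemma Fi_indecomposable:
  assumes "indecomposable C x" shows "indecomposable C (fobj Fi x)"
  unfolding indecomposable_def
proof (intro conjI allI impI)
  have [simp]: "x \<in> Obj C" using assms by (rule indecomposable_Obj)
  show "fobj Fi x \<in> Obj C" by simp
  show "\<not> zero_object C (fobj Fi x)"
    using functor_zero_object[OF F_additive, of "fobj Fi x"] assms by (auto simp: indecomposable_def)
  fix y z assume "is_direct_sum C y z (fobj Fi x)"
  then obtain i1 i2 p1 p2 where b: "biproduct C y z (fobj Fi x) i1 i2 p1 p2"
    unfolding is_direct_sum_def by blast
  have "is_direct_sum C (fobj F y) (fobj F z) x"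
    using functor_biproduct[OF F_additive b] unfolding is_direct_sum_def by auto
  then have "zero_object C (fobj F y) \<or> zero_object C (fobj F z)"
    using assms unfolding indecomposable_def by blast
  then show "zero_object C y \<or> zero_object C z"
    using functor_zero_object[OF Fi_additive, of "fobj F y"] functor_zero_object[OF Fi_additive, of "fobj F z"]
      biproductD(1,2)[OF b] by auto
qed


lemma ext_obj_simps:
  "i \<le> Suc d \<Longrightarrow> ext_obj F d a i = a i" "ext_obj F d a (Suc (Suc d)) = fobj F (a 0)"
  "ext_obj F d a (Suc (Suc (Suc d))) = fobj F (a 1)"
  by (simp_all add: ext_obj_def)

lemma ext_mor_simps:
  "i \<le> Suc d \<Longrightarrow> ext_mor F d a b f i = f i"
  "ext_mor F d a b f (Suc (Suc d)) = fmor F (a 0) (b 0) (f 0)"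
  by (simp_all add: ext_mor_def)

lemma rotate_obj: "sobj (rotate_seq C F d P) i = eobj F d P (Suc i)"
  by (simp add: rotate_seq_def)

lemma rotate_eobj: "i \<le> Suc (Suc d) \<Longrightarrow> eobj F d (rotate_seq C F d P) i = eobj F d P (Suc i)"
  by (cases "i = Suc (Suc d)") (simp_all add: ext_obj_simps rotate_obj)

lemma rotate_mor: "i \<le> d \<Longrightarrow> smor (rotate_seq C F d P) i = smor P (Suc i)"
  by (simp add: rotate_seq_def)

lemma rotate_mor_last: "smor (rotate_seq C F d P) (Suc d) =
    (if even d then emor F d P (Suc (Suc d))
     else \<ominus>\<^bsub>Hom C (eobj F d P (Suc (Suc d))) (eobj F d P (Suc (Suc (Suc d))))\<^esub> emor F d P (Suc (Suc d)))"
  by (simp add: rotate_seq_def eval_nat_numeral)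

lemma is_sigma_seqD:
  assumes "is_sigma_seq C F d P"
  shows "i \<le> Suc (Suc (Suc d)) \<Longrightarrow> eobj F d P i \<in> Obj C"
    and "i \<le> Suc (Suc d) \<Longrightarrow> emor F d P i \<in> mor C (eobj F d P i) (eobj F d P (Suc i))"
proof -
  have P: "sobj P i \<in> Obj C" "smor P i \<in> mor C (sobj P i) (eobj F d P (Suc i))" if "i \<le> Suc d" for i
    using assms that unfolding is_sigma_seq_def by simp_all
  have 1: "eobj F d P i \<in> Obj C" if "i \<le> Suc (Suc (Suc d))" for i
  proof -
    have "i \<le> Suc d \<or> i = Suc (Suc d) \<or> i = Suc (Suc (Suc d))" using that by linarith
    then show ?thesis by (elim disjE) (use P(1)[of 0] P(1)[of 1] P(1) in \<open>auto simp: ext_obj_simps\<close>)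
  qed
  then show "i \<le> Suc (Suc (Suc d)) \<Longrightarrow> eobj F d P i \<in> Obj C" .
  show "emor F d P i \<in> mor C (eobj F d P i) (eobj F d P (Suc i))" if "i \<le> Suc (Suc d)"
  proof -
    have "i \<le> Suc d \<or> i = Suc (Suc d)" using that by linarith
    then show ?thesis
      by (elim disjE) (use P(2)[of i] P(2)[of 0] P(1)[of 0] P(1)[of 1] in
          \<open>auto simp: ext_obj_simps ext_mor_simps\<close>)
  qed
qed

lemma rotate_is_sigma_seq:
  assumes P: "is_sigma_seq C F d P" shows "is_sigma_seq C F d (rotate_seq C F d P)"
  unfolding is_sigma_seq_def
proof (intro allI impI conjI)
  fix i assume i: "i \<le> d + 1"
  then show "sobj (rotate_seq C F d P) i \<in> Obj C"
    using is_sigma_seqD(1)[OF P, of "Suc i"] by (simp add: rotate_obj)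
  have e: "eobj F d (rotate_seq C F d P) (Suc i) = eobj F d P (Suc (Suc i))"
    using i by (intro rotate_eobj) simp
  show "smor (rotate_seq C F d P) i \<in> mor C (sobj (rotate_seq C F d P) i) (eobj F d (rotate_seq C F d P) (Suc i))"
  proof (cases "i \<le> d")
    case True
    then show ?thesis
      unfolding e rotate_obj using is_sigma_seqD(2)[OF P, of "Suc i"] by (simp add: rotate_mor ext_mor_simps)
  next
    case False
    then have i: "i = Suc d" using i by simp
    show ?thesis
      unfolding e rotate_obj unfolding i rotate_mor_last
      using is_sigma_seqD(2)[OF P, of "Suc (Suc d)"] is_sigma_seqD(1)[OF P, of "Suc (Suc d)"]
        is_sigma_seqD(1)[OF P, of "Suc (Suc (Suc d))"] by simp
  qed
qed

lemma rotate_angle: "P \<in> angles \<Longrightarrow> rotate_seq C F d P \<in> angles"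
  using N2 angles_are_seqs by blast

text \<open>For \<open>k = 0\<close> this is the trivial angle \<open>z \<rightarrow> z \<rightarrow> 0 \<rightarrow> \<dots>\<close>, for \<open>k = 1\<close> the angle \<open>0 \<rightarrow> z \<rightarrow> z \<rightarrow> 0 \<rightarrow> \<dots>\<close>
  whose rotation is trivial. Morphisms from or to these angles turn (N3) into exactness statements.\<close>

definition stalk :: "'o \<Rightarrow> nat \<Rightarrow> ('o, 'm) sigma_seq" where
  "stalk z k =
     (let o' = (SOME x. zero_object C x); s = (\<lambda>i. if i = k \<or> i = Suc k then z else o')
      in \<lparr>sobj = s, smor = (\<lambda>i. if i = k then Ident C z else \<zero>\<^bsub>Hom C (s i) (ext_obj F d s (Suc i))\<^esub>)\<rparr>)"

lemma stalk_simps: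
  assumes z: "z \<in> Obj C" and k: "k \<le> 1"
  shows "is_sigma_seq C F d (stalk z k)"
    "i = k \<or> i = Suc k \<Longrightarrow> sobj (stalk z k) i = z"
    "\<lbrakk>i \<noteq> k; i \<noteq> Suc k\<rbrakk> \<Longrightarrow> zero_object C (sobj (stalk z k) i)"
    "smor (stalk z k) k = Ident C z"
    "i \<noteq> k \<Longrightarrow> smor (stalk z k) i = \<zero>\<^bsub>Hom C (sobj (stalk z k) i) (eobj F d (stalk z k) (Suc i))\<^esub>"
proof -
  define o' where "o' = (SOME x. zero_object C x)"
  have o': "zero_object C o'" unfolding o'_def using zero_object_exists by (rule someI_ex)
  define s where "s = (\<lambda>i. if i = k \<or> i = Suc k then z else o')"
  have st: "sobj (stalk z k) = s"
    "smor (stalk z k) = (\<lambda>i. if i = k then Ident C z else \<zero>\<^bsub>Hom C (s i) (ext_obj F d s (Suc i))\<^esub>)"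
    unfolding stalk_def s_def o'_def by (simp_all add: Let_def)
  show "i = k \<or> i = Suc k \<Longrightarrow> sobj (stalk z k) i = z"
    "\<lbrakk>i \<noteq> k; i \<noteq> Suc k\<rbrakk> \<Longrightarrow> zero_object C (sobj (stalk z k) i)"
    "smor (stalk z k) k = Ident C z"
    "i \<noteq> k \<Longrightarrow> smor (stalk z k) i = \<zero>\<^bsub>Hom C (sobj (stalk z k) i) (eobj F d (stalk z k) (Suc i))\<^esub>"
    using o' by (auto simp: st s_def)
  have s: "s i \<in> Obj C" for i using o' z by (simp add: s_def zero_object_def)
  have es: "ext_obj F d s i \<in> Obj C" for i using s by (simp add: ext_obj_def)
  have "ext_obj F d s (Suc k) = z" using k d_pos by (simp add: ext_obj_simps s_def)
  then show "is_sigma_seq C F d (stalk z k)"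
    unfolding is_sigma_seq_def st using s es z
    by (intro allI impI conjI) (auto simp: if_distrib[of "\<lambda>u. u \<in> _"] s_def[THEN fun_cong, of k])
qed

lemma stalk_0_angle: "z \<in> Obj C \<Longrightarrow> stalk z 0 \<in> angles"
  by (rule N1_trivial[of z]) (simp_all add: stalk_simps)

lemma stalk_1_angle: assumes z: "z \<in> Obj C" shows "stalk z 1 \<in> angles"
proof -
  note st = stalk_simps[OF z, of 1, simplified]
  have "rotate_seq C F d (stalk z 1) \<in> angles"
  proof (rule N1_trivial[OF z])
    show "is_sigma_seq C F d (rotate_seq C F d (stalk z 1))"
      using st(1) by (intro rotate_is_sigma_seq) simp
    show "sobj (rotate_seq C F d (stalk z 1)) 0 = z" "sobj (rotate_seq C F d (stalk z 1)) 1 = z"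
      "smor (rotate_seq C F d (stalk z 1)) 0 = Ident C z"
      using st d_pos by (simp_all add: rotate_obj rotate_mor ext_obj_simps)
    fix i assume i: "2 \<le> i" "i \<le> d + 1"
    show "zero_object C (sobj (rotate_seq C F d (stalk z 1)) i)"
    proof (cases "i \<le> d")
      case True
      then show ?thesis using st(3)[of "Suc i"] i by (simp add: rotate_obj ext_obj_simps)
    next
      case False
      then have "i = Suc d" using i by simp
      then show ?thesis
        using st(3)[of 0] functor_zero_object[OF F_additive] by (simp add: rotate_obj ext_obj_simps)
    qed
  qed
  then show ?thesis using N2 st(1) by simp
qed

lemma seq_morphismD:
  assumes "seq_morphism C F d P Q f" "i \<le> Suc d"
  shows "f i \<in> mor C (sobj P i) (sobj Q i)"
    "Comp C (sobj P i) (eobj F d P (Suc i)) (eobj F d Q (Suc i))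
          (ext_mor F d (sobj P) (sobj Q) f (Suc i)) (smor P i) =
        Comp C (sobj P i) (sobj Q i) (eobj F d Q (Suc i)) (smor Q i) (f i)"
  using assms unfolding seq_morphism_def by simp_all

lemma angle_objs:
  assumes P: "P \<in> angles"
  shows "sobj P 0 \<in> Obj C" "sobj P (Suc 0) \<in> Obj C" "sobj P (Suc (Suc 0)) \<in> Obj C"
    "smor P 0 \<in> mor C (sobj P 0) (sobj P (Suc 0))"
    "smor P (Suc 0) \<in> mor C (sobj P (Suc 0)) (sobj P (Suc (Suc 0)))"
  using is_sigma_seqD(1)[OF angles_are_seqs[OF P], of 0] is_sigma_seqD(1)[OF angles_are_seqs[OF P], of 1]
    is_sigma_seqD(1)[OF angles_are_seqs[OF P], of 2]
    is_sigma_seqD(2)[OF angles_are_seqs[OF P], of 0] is_sigma_seqD(2)[OF angles_are_seqs[OF P], of 1] d_pos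
  by (simp_all add: ext_obj_simps ext_mor_simps eval_nat_numeral)

text \<open>The morphism from the trivial angle of \<open>sobj P 0\<close> given by (N3) factors the composite through zero.\<close>

lemma angle_composite_zero:
  assumes P: "P \<in> angles"
  shows "Comp C (sobj P 0) (sobj P (Suc 0)) (sobj P (Suc (Suc 0))) (smor P (Suc 0)) (smor P 0) =
    \<zero>\<^bsub>Hom C (sobj P 0) (sobj P (Suc (Suc 0)))\<^esub>"
proof -
  note [simp] = angle_objs[OF P]
  let ?p = "sobj P 0"
  note st = stalk_simps[of ?p 0, simplified]
  obtain f where f: "f 0 = Ident C ?p" "f 1 = smor P 0" "seq_morphism C F d (stalk ?p 0) P f"
  proof -
    have "sobj (stalk ?p 0) 0 = ?p" "sobj (stalk ?p 0) 1 = ?p" "smor (stalk ?p 0) 0 = Ident C ?p"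
      using st(2,4) by simp_all
    then show ?thesis
      using N3[OF stalk_0_angle P, of ?p "Ident C ?p" "smor P 0"] that by auto
  qed
  have "Comp C ?p (sobj (stalk ?p 0) (Suc (Suc 0))) (sobj P (Suc (Suc 0))) (f (Suc (Suc 0))) (smor (stalk ?p 0) (Suc 0)) =
      Comp C ?p (sobj P (Suc 0)) (sobj P (Suc (Suc 0))) (smor P (Suc 0)) (smor P 0)"
    using seq_morphismD(2)[OF f(3), of "Suc 0"] f(2) d_pos st by (simp add: ext_obj_simps ext_mor_simps)
  moreover have "smor (stalk ?p 0) (Suc 0) = \<zero>\<^bsub>Hom C ?p (sobj (stalk ?p 0) (Suc (Suc 0)))\<^esub>"
    using st(5)[of "Suc 0"] d_pos st by (simp add: ext_obj_simps)
  moreover have "sobj (stalk ?p 0) (Suc (Suc 0)) \<in> Obj C"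
    using st(3)[of "Suc (Suc 0)"] by (simp add: zero_object_def)
  moreover have "f (Suc (Suc 0)) \<in> mor C (sobj (stalk ?p 0) (Suc (Suc 0))) (sobj P (Suc (Suc 0)))"
    using seq_morphismD(1)[OF f(3), of "Suc (Suc 0)"] d_pos by simp
  ultimately show ?thesis by simp
qed

text \<open>Apply (N3) to \<open>0\<close> and \<open>h\<close> as the first two components of a morphism to \<open>0 \<rightarrow> z \<rightarrow> z \<rightarrow> 0 \<rightarrow> \<dots>\<close>.\<close>

lemma angle_exact_contravariant:
  assumes P: "P \<in> angles" and z: "z \<in> Obj C" and h: "h \<in> mor C (sobj P (Suc 0)) z"
    and hz: "Comp C (sobj P 0) (sobj P (Suc 0)) z h (smor P 0) = \<zero>\<^bsub>Hom C (sobj P 0) z\<^esub>"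
  shows "\<exists>k\<in>mor C (sobj P (Suc (Suc 0))) z.
    h = Comp C (sobj P (Suc 0)) (sobj P (Suc (Suc 0))) z k (smor P (Suc 0))"
proof -
  note [simp] = angle_objs[OF P] z
  let ?Q = "stalk z (Suc 0)"
  note st = stalk_simps[OF z, of 1, simplified]
  have o': "zero_object C (sobj ?Q 0)" using st(3)[of 0] by simp
  then have [simp]: "sobj ?Q 0 \<in> Obj C" by (simp add: zero_object_def)
  have [simp]: "smor ?Q 0 = \<zero>\<^bsub>Hom C (sobj ?Q 0) z\<^esub>" using st(5)[of 0] st d_pos by (simp add: ext_obj_simps)
  obtain f where f: "f 0 = \<zero>\<^bsub>Hom C (sobj P 0) (sobj ?Q 0)\<^esub>" "f 1 = h" "seq_morphism C F d P ?Q f"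
  proof -
    have "sobj ?Q (Suc 0) = z" using st(2) by simp
    then show ?thesis
      using N3[OF P stalk_1_angle[OF z, simplified], of "\<zero>\<^bsub>Hom C (sobj P 0) (sobj ?Q 0)\<^esub>" h] that h hz by auto
  qed
  have "Comp C (sobj P (Suc 0)) (sobj P (Suc (Suc 0))) z (f (Suc (Suc 0))) (smor P (Suc 0)) = h"
    using seq_morphismD(2)[OF f(3), of "Suc 0"] f(2) d_pos st h by (simp add: ext_obj_simps ext_mor_simps)
  moreover have "f (Suc (Suc 0)) \<in> mor C (sobj P (Suc (Suc 0))) z"
    using seq_morphismD(1)[OF f(3), of "Suc (Suc 0)"] d_pos st by simp
  ultimately show ?thesis by metis
qed

text \<open>A morphism to be lifted along \<open>smor P 0\<close> becomes the first component after rotating both angles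
  once; the last component given by (N3) is then \<open>\<Sigma>\<^sup>d\<close> of the lift. The signs of the two rotations
  cancel.\<close>

lemma angle_exact_covariant:
  assumes P: "P \<in> angles" and z: "z \<in> Obj C" and h: "h \<in> mor C z (sobj P (Suc 0))"
    and hz: "Comp C z (sobj P (Suc 0)) (sobj P (Suc (Suc 0))) (smor P (Suc 0)) h =
      \<zero>\<^bsub>Hom C z (sobj P (Suc (Suc 0)))\<^esub>"
  shows "\<exists>k\<in>mor C z (sobj P 0). h = Comp C z (sobj P 0) (sobj P (Suc 0)) (smor P 0) k"
proof -
  note [simp] = angle_objs[OF P] z h
  note st = stalk_simps[OF z, of 0, simplified]
  let ?S = "stalk z 0"
  let ?Q = "rotate_seq C F d ?S" and ?R = "rotate_seq C F d P"
  have Q: "?Q \<in> angles" "?R \<in> angles" using rotate_angle stalk_0_angle P z by auto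
  have o': "zero_object C (sobj ?S (Suc (Suc 0)))" using st(3) by simp
  then have [simp]: "sobj ?S (Suc (Suc 0)) \<in> Obj C" by (simp add: zero_object_def)
  have ob: "sobj ?Q 0 = z" "sobj ?Q (Suc 0) = sobj ?S (Suc (Suc 0))" "sobj ?R 0 = sobj P (Suc 0)"
    "sobj ?R (Suc 0) = sobj P (Suc (Suc 0))" "sobj ?Q (Suc d) = fobj F z" "sobj ?R (Suc d) = fobj F (sobj P 0)"
    using st(2)[of 0] st(2)[of "Suc 0"] d_pos by (simp_all add: rotate_obj ext_obj_simps)
  have mo: "smor ?Q 0 = \<zero>\<^bsub>Hom C z (sobj ?S (Suc (Suc 0)))\<^esub>" "smor ?R 0 = smor P (Suc 0)"
    using st(5)[of "Suc 0"] st(2)[of "Suc 0"] d_pos by (simp_all add: rotate_mor ext_obj_simps)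
  let ?f1 = "\<zero>\<^bsub>Hom C (sobj ?S (Suc (Suc 0))) (sobj P (Suc (Suc 0)))\<^esub>"
  obtain f where f: "f 0 = h" "f 1 = ?f1" "seq_morphism C F d ?Q ?R f"
  proof -
    have "h \<in> mor C (sobj ?Q 0) (sobj ?R 0)" "?f1 \<in> mor C (sobj ?Q 1) (sobj ?R 1)"
      "Comp C (sobj ?Q 0) (sobj ?Q 1) (sobj ?R 1) ?f1 (smor ?Q 0) =
       Comp C (sobj ?Q 0) (sobj ?R 0) (sobj ?R 1) (smor ?R 0) h"
      unfolding mo One_nat_def ob(1-4) by (simp_all add: hz)
    from N3[OF Q this] show ?thesis using that by (elim exE conjE)
  qed
  have fd: "f (Suc d) \<in> mor C (fobj F z) (fobj F (sobj P 0))"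
    using seq_morphismD(1)[OF f(3), of "Suc d"] ob by simp
  obtain k where k: "k \<in> mor C z (sobj P 0)" "f (Suc d) = fmor F z (sobj P 0) k"
    by (rule F_full[OF z _ fd]) simp
  note [simp] = k(1)
  let ?h = "fmor F z (sobj P (Suc 0)) h" and ?k = "fmor F z (sobj P 0) k"
  have eq: "Comp C (fobj F z) (fobj F z) (fobj F (sobj P (Suc 0))) ?h (smor ?Q (Suc d)) =
      Comp C (fobj F z) (fobj F (sobj P 0)) (fobj F (sobj P (Suc 0))) (smor ?R (Suc d)) ?k"
    using seq_morphismD(2)[OF f(3), of "Suc d"]
    by (simp add: ext_obj_simps ext_mor_simps ob f(1) k(2))
  have sQ: "smor ?Q (Suc d) = (if even d then Ident C (fobj F z) else \<ominus>\<^bsub>Hom C (fobj F z) (fobj F z)\<^esub> Ident C (fobj F z))"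
    using st(2)[of 0] st(2)[of "Suc 0"] st(4) by (simp add: rotate_mor_last ext_obj_simps ext_mor_simps functor_Ident[OF F_additive])
  have sR: "smor ?R (Suc d) = (if even d then fmor F (sobj P 0) (sobj P (Suc 0)) (smor P 0)
      else \<ominus>\<^bsub>Hom C (fobj F (sobj P 0)) (fobj F (sobj P (Suc 0)))\<^esub> fmor F (sobj P 0) (sobj P (Suc 0)) (smor P 0))"
    by (simp add: rotate_mor_last ext_obj_simps ext_mor_simps)
  have "?h = Comp C (fobj F z) (fobj F (sobj P 0)) (fobj F (sobj P (Suc 0)))
      (fmor F (sobj P 0) (sobj P (Suc 0)) (smor P 0)) ?k"
  proof (cases "even d")
    case True
    then show ?thesis using eq unfolding sQ sR by simp
  next
    case False
    then have "\<ominus>\<^bsub>Hom C (fobj F z) (fobj F (sobj P (Suc 0)))\<^esub> ?h =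
      \<ominus>\<^bsub>Hom C (fobj F z) (fobj F (sobj P (Suc 0)))\<^esub> Comp C (fobj F z) (fobj F (sobj P 0)) (fobj F (sobj P (Suc 0)))
      (fmor F (sobj P 0) (sobj P (Suc 0)) (smor P 0)) ?k"
      using eq unfolding sQ sR by simp
    from arg_cong[OF this, of "\<lambda>u. \<ominus>\<^bsub>Hom C (fobj F z) (fobj F (sobj P (Suc 0)))\<^esub> u"] show ?thesis by simp
  qed
  then have "?h = fmor F z (sobj P (Suc 0)) (Comp C z (sobj P 0) (sobj P (Suc 0)) (smor P 0) k)"
    by (simp add: functor_Comp[OF F_additive])
  then have "h = Comp C z (sobj P 0) (sobj P (Suc 0)) (smor P 0) k"
    by (rule F_faithful[of z "sobj P (Suc 0)", rotated -1]) simp_all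
  then show ?thesis using k(1) by blast
qed

lemma angle_exact_0:
  assumes P: "P \<in> angles"
  shows "exact_at (eobj F d P 0) (eobj F d P (Suc 0)) (eobj F d P (Suc (Suc 0)))
    (emor F d P 0) (emor F d P (Suc 0))"
proof -
  have "eobj F d P 0 = sobj P 0" "eobj F d P (Suc 0) = sobj P (Suc 0)"
    "eobj F d P (Suc (Suc 0)) = sobj P (Suc (Suc 0))" "emor F d P 0 = smor P 0" "emor F d P (Suc 0) = smor P (Suc 0)"
    using d_pos by (simp_all add: ext_obj_simps ext_mor_simps)
  then show ?thesis
    unfolding exact_at_def
    using angle_objs[OF P] angle_composite_zero[OF P] angle_exact_contravariant[OF P]
      angle_exact_covariant[OF P] by simp
qed

text \<open>Rotation moves position \<open>i\<close> to the start. The sign in the rotated angle does not affect exactness.\<close>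

lemma angle_exact:
  assumes "P \<in> angles" "i \<le> Suc d"
  shows "exact_at (eobj F d P i) (eobj F d P (Suc i)) (eobj F d P (Suc (Suc i)))
    (emor F d P i) (emor F d P (Suc i))"
  using assms
proof (induction i arbitrary: P)
  case 0
  then show ?case using angle_exact_0 by blast
next
  case (Suc i)
  let ?R = "rotate_seq C F d P"
  have e: "exact_at (eobj F d ?R i) (eobj F d ?R (Suc i)) (eobj F d ?R (Suc (Suc i)))
      (emor F d ?R i) (emor F d ?R (Suc i))"
    using Suc rotate_angle by simp
  have o: "eobj F d ?R i = eobj F d P (Suc i)" "eobj F d ?R (Suc i) = eobj F d P (Suc (Suc i))"
    "eobj F d ?R (Suc (Suc i)) = eobj F d P (Suc (Suc (Suc i)))"
    using Suc.prems(2) by (simp_all add: rotate_eobj)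
  have m: "emor F d ?R i = emor F d P (Suc i)"
    using Suc.prems(2) by (simp add: ext_mor_simps rotate_mor)
  have e: "exact_at (eobj F d P (Suc i)) (eobj F d P (Suc (Suc i))) (eobj F d P (Suc (Suc (Suc i))))
      (emor F d P (Suc i)) (emor F d ?R (Suc i))"
    using e unfolding o m .
  show ?case
  proof (cases "Suc i \<le> d")
    case True
    then have "emor F d ?R (Suc i) = emor F d P (Suc (Suc i))"
      by (simp add: ext_mor_simps rotate_mor)
    then show ?thesis using e by simp
  next
    case False
    then have i: "i = d" using Suc.prems(2) by simp
    have m': "emor F d ?R (Suc i) = (if even d then emor F d P (Suc (Suc i))
     else \<ominus>\<^bsub>Hom C (eobj F d P (Suc (Suc i))) (eobj F d P (Suc (Suc (Suc i))))\<^esub> emor F d P (Suc (Suc i)))"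
      unfolding i using rotate_mor_last[of P] by (simp add: ext_mor_simps(1)[of "Suc d"])
    show ?thesis
    proof (cases "even d")
      case True
      then show ?thesis using e unfolding m' by simp
    next
      case False
      have P: "is_sigma_seq C F d P" using Suc.prems(1) by (rule angles_are_seqs)
      have s: "emor F d P (Suc (Suc i)) \<in> mor C (eobj F d P (Suc (Suc i))) (eobj F d P (Suc (Suc (Suc i))))"
        "eobj F d P (Suc (Suc i)) \<in> Obj C" "eobj F d P (Suc (Suc (Suc i))) \<in> Obj C"
        using is_sigma_seqD[OF P] i by simp_all
      show ?thesis using exact_at_neg_right[OF e] False s unfolding m' by simp
    qed
  qed
qed

end

section \<open>Additive functions on the index\<close>

text \<open>A function on objects extends to the free abelian group, and additivity says that the extension
  vanishes on the relations.\<close>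

lemma split_K0_functional:
  fixes h :: "'o \<Rightarrow> int"
  assumes add: "\<And>t t' t''. \<lbrakk>t \<in> A; t' \<in> A; t'' \<in> A; is_direct_sum C t' t'' t\<rbrakk> \<Longrightarrow> h t = h t' + h t''"
  shows "comm_group (split_K0 C A) \<and>
    (\<forall>t\<in>A. K0_class C A t \<in> carrier (split_K0 C A)) \<and>
    (\<exists>\<psi>\<in>hom (split_K0 C A) integer_group. \<forall>t\<in>A. \<psi> (K0_class C A t) = h t)"
proof -
  let ?G = "free_Abelian_group A" and ?R = "split_relations C A"
  let ?N = "generate ?G ?R"
  interpret G: comm_group ?G by (rule abelian_free_Abelian_group)
  interpret Z: comm_group integer_group by (rule abelian_integer_group)
  obtain \<phi> where \<phi>: "\<phi> \<in> hom ?G integer_group" "\<And>t. t \<in> A \<Longrightarrow> \<phi> (frag_of t) = h t"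
    using Z.free_Abelian_group_universal[of h A] by auto
  interpret \<phi>: group_hom ?G integer_group \<phi>
    by (intro group_hom.intro group_hom_axioms.intro G.group_axioms Z.group_axioms \<phi>(1))
  have minus: "\<phi> (x - y) = \<phi> x - \<phi> y" if "x \<in> carrier ?G" "y \<in> carrier ?G" for x y
    using \<phi>.hom_mult[OF that(1) G.inv_closed[OF that(2)]] \<phi>.hom_inv[OF that(2)] that by simp
  have "?R \<subseteq> kernel ?G integer_group \<phi>"
  proof
    fix r assume "r \<in> ?R"
    then obtain t t' t'' where t: "t \<in> A" "t' \<in> A" "t'' \<in> A" "is_direct_sum C t' t'' t"
      "r = frag_of t - frag_of t' - frag_of t''"
      unfolding split_relations_def by blast
    have c: "frag_of t - frag_of t' \<in> carrier ?G"
      using G.m_closed[of "frag_of t" "- frag_of t'"] t by simp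
    have "r \<in> carrier ?G" using G.m_closed[OF c, of "- frag_of t''"] t by simp
    moreover have "\<phi> r = 0" using minus[of "frag_of t" "frag_of t'"] minus[OF c, of "frag_of t''"] t add \<phi>(2) by simp
    ultimately show "r \<in> kernel ?G integer_group \<phi>" by (simp add: kernel_def)
  qed
  then have Nk: "?N \<subseteq> kernel ?G integer_group \<phi>"
    by (rule G.generate_subgroup_incl) (rule \<phi>.subgroup_kernel)
  have Rc: "?R \<subseteq> carrier ?G"
    using \<open>?R \<subseteq> kernel ?G integer_group \<phi>\<close> unfolding kernel_def by blast
  have sub: "subgroup ?N ?G" by (rule G.generate_is_subgroup[OF Rc])
  then have norm: "?N \<lhd> ?G" by (rule G.subgroup_imp_normal)
  have "\<phi> x = \<phi> y" if xy: "x \<in> carrier ?G" "y \<in> carrier ?G" "?N #>\<^bsub>?G\<^esub> x = ?N #>\<^bsub>?G\<^esub> y" for x y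
  proof -
    have "x \<in> ?N #>\<^bsub>?G\<^esub> y" using G.rcos_self[OF xy(1) sub] xy(3) by simp
    then obtain n where n: "n \<in> ?N" "x = n \<otimes>\<^bsub>?G\<^esub> y" unfolding r_coset_def by blast
    have n': "n \<in> carrier ?G" "\<phi> n = 0" using n(1) Nk unfolding kernel_def by auto
    show ?thesis unfolding n(2) using \<phi>.hom_mult[OF n'(1) xy(2)] n'(2) by simp
  qed
  from FactGroup_universal[OF \<phi>(1) norm this]
  obtain \<psi> where \<psi>: "\<psi> \<in> hom (?G Mod ?N) integer_group" "\<And>x. x \<in> carrier ?G \<Longrightarrow> \<psi> (?N #>\<^bsub>?G\<^esub> x) = \<phi> x"
    by blast
  have "comm_group (?G Mod ?N)" by (rule G.abelian_FactGroup[OF sub])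
  moreover have "K0_class C A t \<in> carrier (split_K0 C A)" if "t \<in> A" for t
    using that unfolding K0_class_def split_K0_def FactGroup_def RCOSETS_def by auto
  moreover have "\<psi> (K0_class C A t) = h t" if "t \<in> A" for t
    unfolding K0_class_def using \<psi>(2)[of "frag_of t"] \<phi>(2) that by simp
  ultimately show ?thesis using \<psi>(1) unfolding split_K0_def by blast
qed

lemma hom_alternating_product:
  fixes d :: nat
  assumes "comm_group G" "\<psi> \<in> hom G integer_group" "\<And>i. i \<le> d \<Longrightarrow> f i \<in> carrier G"
  shows "\<psi> (finprod G (\<lambda>i. f i [^]\<^bsub>G\<^esub> ((-1) ^ i :: int)) {..d}) = (\<Sum>i\<le>d. (-1) ^ i * \<psi> (f i))"
proof -
  interpret G: comm_group G by fact
  interpret Z: comm_group integer_group by (rule abelian_integer_group)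
  interpret \<psi>: group_hom G integer_group \<psi>
    by (intro group_hom.intro group_hom_axioms.intro G.group_axioms Z.group_axioms assms(2))
  have p: "\<psi> (f i [^]\<^bsub>G\<^esub> ((-1) ^ i :: int)) = (-1) ^ i * \<psi> (f i)" if "i \<le> d" for i
    using \<psi>.hom_int_pow[OF assms(3)[OF that]] by simp
  have "\<psi> (finprod G (\<lambda>i. f i [^]\<^bsub>G\<^esub> ((-1) ^ i :: int)) {..n}) = (\<Sum>i\<le>n. (-1) ^ i * \<psi> (f i))" if "n \<le> d" for n
    using that
  proof (induction n)
    case 0
    then show ?case using p[of 0] assms(3)[of 0] by simp
  next
    case (Suc n)
    let ?g = "\<lambda>i. f i [^]\<^bsub>G\<^esub> ((-1) ^ i :: int)"
    have g: "?g \<in> {..Suc n} \<rightarrow> carrier G" using assms(3) Suc.prems by auto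
    note [simp del] = power_Suc
    have step: "finprod G ?g {..Suc n} = ?g (Suc n) \<otimes>\<^bsub>G\<^esub> finprod G ?g {..n}"
      by (rule G.finprod_Suc[OF g])
    have "\<psi> (finprod G ?g {..Suc n}) = \<psi> (?g (Suc n)) + \<psi> (finprod G ?g {..n})"
    proof -
      have "?g (Suc n) \<in> carrier G" "finprod G ?g {..n} \<in> carrier G"
        using g by (auto intro!: G.finprod_closed)
      from \<psi>.hom_mult[OF this] show ?thesis using step by simp
    qed
    then show ?case using Suc p[of "Suc n"] by simp
  qed
  then show ?thesis by simp
qed

section \<open>Serre duality\<close>

text \<open>Choose a linear form on \<open>Hom(c,z)\<close> that does not vanish at \<open>f\<close>, and let \<open>g : z \<rightarrow> S c\<close> correspond to it under
  Serre duality. By naturality the form corresponding to \<open>g f\<close> has the value \<open>\<phi> f \<noteq> 0\<close> at the identity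
  of \<open>c\<close>.\<close>

lemma (in hom_finite_category) calabi_yau_nondegenerate:
  assumes cy: "calabi_yau K C F" and c: "c \<in> Obj C" and z: "z \<in> Obj C"
    and FF: "\<And>x. x \<in> Obj C \<Longrightarrow> fobj F x \<in> Obj C"
    and f: "f \<in> mor C c z" "f \<noteq> \<zero>\<^bsub>Hom C c z\<^esub>"
  shows "\<exists>g\<in>mor C z (fobj F (fobj F c)).
    Comp C c z (fobj F (fobj F c)) g f \<noteq> \<zero>\<^bsub>Hom C c (fobj F (fobj F c))\<^esub>"
proof -
  obtain S where S: "serre_functor K C S" "nat_iso C S (comp_functor F F)"
    using cy unfolding calabi_yau_def by (elim exE conjE)
  have Sc: "fobj S c \<in> Obj C"
    using S(1)[unfolded serre_functor_def auto_equivalence_def is_functor_def] c by simp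
  from S(1)[unfolded serre_functor_def, THEN conjunct2]
  obtain \<theta> :: "'o \<Rightarrow> 'o \<Rightarrow> 'm \<Rightarrow> 'm \<Rightarrow> 'k" where
    "\<forall>x\<in>Obj C. \<forall>y\<in>Obj C.
       \<theta> x y \<in> LinearCombinations.module_hom K (Hom C y (fobj S x)) (dual_space K (Hom C x y)) \<and>
       bij_betw (\<theta> x y) (mor C y (fobj S x)) (carrier (dual_space K (Hom C x y)))"
    "\<forall>x\<in>Obj C. \<forall>y\<in>Obj C. \<forall>y'\<in>Obj C. \<forall>g\<in>mor C y' y. \<forall>h\<in>mor C y (fobj S x). \<forall>u\<in>mor C x y'.
       \<theta> x y' (Comp C y' y (fobj S x) h g) u = \<theta> x y h (Comp C x y' y g u)"
    by (elim exE conjE)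
  then have \<theta>:
    "\<And>x y. \<lbrakk>x \<in> Obj C; y \<in> Obj C\<rbrakk> \<Longrightarrow> \<theta> x y \<in> LinearCombinations.module_hom K (Hom C y (fobj S x)) (dual_space K (Hom C x y))"
    "\<And>x y. \<lbrakk>x \<in> Obj C; y \<in> Obj C\<rbrakk> \<Longrightarrow> bij_betw (\<theta> x y) (mor C y (fobj S x)) (carrier (dual_space K (Hom C x y)))"
    "\<And>x y y' g h u. \<lbrakk>x \<in> Obj C; y \<in> Obj C; y' \<in> Obj C; g \<in> mor C y' y; h \<in> mor C y (fobj S x); u \<in> mor C x y'\<rbrakk> \<Longrightarrow>
      \<theta> x y' (Comp C y' y (fobj S x) h g) u = \<theta> x y h (Comp C x y' y g u)"
    by simp_all
  obtain \<phi> where \<phi>: "\<phi> \<in> carrier (dual_space K (Hom C c z))" "\<phi> f \<noteq> \<zero>\<^bsub>K\<^esub>"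
    using separating_form[OF Hom_vectorspace[OF c z] Hom_fin_dim[OF c z] f] by (elim bexE)
  have "\<phi> \<in> \<theta> c z ` mor C z (fobj S c)"
    unfolding bij_betw_imp_surj_on[OF \<theta>(2)[OF c z]] by (rule \<phi>(1))
  then obtain g where g: "g \<in> mor C z (fobj S c)" "\<theta> c z g = \<phi>"
    by (elim imageE) simp
  note [simp] = c z f(1) g(1) Sc
  have 1: "Comp C c z (fobj S c) g f \<noteq> \<zero>\<^bsub>Hom C c (fobj S c)\<^esub>"
  proof
    assume 0: "Comp C c z (fobj S c) g f = \<zero>\<^bsub>Hom C c (fobj S c)\<^esub>"
    interpret V: vectorspace K "Hom C c c" by (rule Hom_vectorspace) simp_all
    have "\<theta> c c \<zero>\<^bsub>Hom C c (fobj S c)\<^esub> =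
        \<theta> c c (\<zero>\<^bsub>Hom C c (fobj S c)\<^esub> \<oplus>\<^bsub>Hom C c (fobj S c)\<^esub> \<zero>\<^bsub>Hom C c (fobj S c)\<^esub>)"
      by simp
    also have "\<dots> = \<theta> c c \<zero>\<^bsub>Hom C c (fobj S c)\<^esub> \<oplus>\<^bsub>dual_space K (Hom C c c)\<^esub> \<theta> c c \<zero>\<^bsub>Hom C c (fobj S c)\<^esub>"
      by (rule LinearCombinations.module_hom_add[OF \<theta>(1)]) simp_all
    finally have d: "\<theta> c c \<zero>\<^bsub>Hom C c (fobj S c)\<^esub> =
        \<theta> c c \<zero>\<^bsub>Hom C c (fobj S c)\<^esub> \<oplus>\<^bsub>dual_space K (Hom C c c)\<^esub> \<theta> c c \<zero>\<^bsub>Hom C c (fobj S c)\<^esub>" .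
    have m: "\<theta> c c \<zero>\<^bsub>Hom C c (fobj S c)\<^esub> \<in> carrier (dual_space K (Hom C c c))"
      using bij_betw_apply[OF \<theta>(2)[of c c], of "\<zero>\<^bsub>Hom C c (fobj S c)\<^esub>"] by simp
    let ?a = "\<theta> c c \<zero>\<^bsub>Hom C c (fobj S c)\<^esub> (Ident C c)"
    have a: "?a \<in> carrier K"
      using m by (simp add: dual_space_def LinearCombinations.module_hom_def ring_as_module_def Pi_iff)
    have e: "?a = ?a \<oplus>\<^bsub>K\<^esub> ?a"
      by (subst d) (simp add: dual_space_def V.func_space_def)
    have "?a = \<zero>\<^bsub>K\<^esub>" by (rule iffD1[OF V.R.add.r_cancel_one[OF a a] e[symmetric]])
    moreover have "?a = \<phi> f" using \<theta>(3)[of c z c f g "Ident C c"] 0 g(2) by simp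
    ultimately show False using \<phi>(2) by simp
  qed
  obtain \<eta> where "\<forall>x\<in>Obj C. iso_mor C (fobj S x) (fobj (comp_functor F F) x) (\<eta> x)"
    using S(2) unfolding nat_iso_def by (elim exE conjE)
  then have "iso_mor C (fobj S c) (fobj F (fobj F c)) (\<eta> c)" by (simp add: comp_functor_def)
  then obtain \<eta>' where \<eta>: "\<eta> c \<in> mor C (fobj S c) (fobj F (fobj F c))" "\<eta>' \<in> mor C (fobj F (fobj F c)) (fobj S c)"
    "Comp C (fobj S c) (fobj F (fobj F c)) (fobj S c) \<eta>' (\<eta> c) = Ident C (fobj S c)"
    unfolding iso_mor_def inverse_mor_def by (elim exE conjE)
  note [simp] = FF \<eta>(1,2)
  let ?z = "fobj F (fobj F c)"
  show ?thesis
  proof (intro bexI notI)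
    show "Comp C z (fobj S c) ?z (\<eta> c) g \<in> mor C z ?z" by simp
    assume "Comp C c z ?z (Comp C z (fobj S c) ?z (\<eta> c) g) f = \<zero>\<^bsub>Hom C c ?z\<^esub>"
    then have "Comp C c (fobj S c) ?z (\<eta> c) (Comp C c z (fobj S c) g f) = \<zero>\<^bsub>Hom C c ?z\<^esub>"
      by (simp add: Comp_assoc)
    then have "Comp C c (fobj S c) (fobj S c) (Comp C (fobj S c) ?z (fobj S c) \<eta>' (\<eta> c)) (Comp C c z (fobj S c) g f)
        = \<zero>\<^bsub>Hom C c (fobj S c)\<^esub>"
      using Comp_assoc[of c "fobj S c" ?z "fobj S c" \<eta>' "\<eta> c" "Comp C c z (fobj S c) g f"] by simp
    then show False using 1 \<eta>(3) by simp
  qed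
qed

section \<open>The quotient category\<close>

lemma (in linear_category) quotient_nonzero:
  assumes x: "x \<in> Obj C" "y \<in> Obj C" and A: "A \<noteq> {}" "A \<subseteq> Obj C"
    and f: "f \<in> mor C x y" "f \<notin> factoring C A x y"
  shows "nonzero_space (Hom (quotient_category C A) x y)"
proof -
  interpret H: abelian_group "Hom C x y" by (rule Hom_abelian_group[OF x])
  obtain s where "s \<in> A" using A(1) by auto
  then have s: "s \<in> A" "s \<in> Obj C" using A(2) by auto
  have "\<zero>\<^bsub>Hom C x y\<^esub> = Comp C x s y \<zero>\<^bsub>Hom C s y\<^esub> \<zero>\<^bsub>Hom C x s\<^esub>" using x s by simp
  then have z: "\<zero>\<^bsub>Hom C x y\<^esub> \<in> factoring C A x y"
    unfolding factoring_def using s x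
    by (intro CollectI bexI[of _ s] bexI[of _ "\<zero>\<^bsub>Hom C x s\<^esub>"] bexI[of _ "\<zero>\<^bsub>Hom C s y\<^esub>"]) simp_all
  let ?N = "factoring C A x y"
  have "?N +>\<^bsub>Hom C x y\<^esub> f \<in> a_rcosets\<^bsub>Hom C x y\<^esub> ?N"
    unfolding A_RCOSETS_def' using f(1) by (intro UN_I[of f]) simp_all
  moreover have "f \<in> ?N +>\<^bsub>Hom C x y\<^esub> f"
  proof -
    have "f = \<zero>\<^bsub>Hom C x y\<^esub> \<oplus>\<^bsub>Hom C x y\<^esub> f" using f by simp
    then show ?thesis unfolding a_r_coset_def' by (intro UN_I[OF z]) simp
  qed
  ultimately have "a_rcosets\<^bsub>Hom C x y\<^esub> ?N \<noteq> {?N}" using f(2) by (metis singletonD)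
  then show ?thesis
    by (simp add: nonzero_space_def quotient_category_def quotient_module_def)
qed

section \<open>The Euler form of a presentation\<close>

context hom_finite_category
begin

text \<open>With \<open>q j\<close> the rank of precomposition with \<open>\<sigma> j\<close>, exactness gives \<open>dim Hom(e (j+1),z) = q (j+1) + q j\<close>
  for \<open>j < d\<close>, and the alternating sum telescopes.\<close>

lemma presentation_euler:
  assumes P: "presentation T d e \<sigma>" and z: "z \<in> Obj C" and d: "odd d"
  shows "(\<Sum>i\<le>d. (-1) ^ i * int (hdim (e (Suc i)) z (mor C (e (Suc i)) z))) =
    int (test_dim e \<sigma> z) -
    (int (hdim (e (Suc d)) z (mor C (e (Suc d)) z)) - int (hdim (e (Suc d)) z (through (e (Suc d)) (e d) (\<sigma> d) z)))"
proof -
  define h where "h j = int (hdim (e j) z (mor C (e j) z))" for j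
  define q where "q j = int (hdim (e (Suc j)) z (through (e (Suc j)) (e j) (\<sigma> j) z))" for j
  note [simp] = presentationD(1,2)[OF P] z
  have hq: "h (Suc j) = q (Suc j) + q j" if j: "j < d" for j
  proof -
    let ?a = "e j" and ?b = "e (Suc j)" and ?c = "e (Suc (Suc j))"
    have "{w \<in> mor C ?b z. Comp C ?c ?b z w (\<sigma> (Suc j)) = \<zero>\<^bsub>Hom C ?c z\<^esub>} = through ?b ?a (\<sigma> j) z"
    proof (intro equalityI subsetI)
      fix w assume "w \<in> {w \<in> mor C ?b z. Comp C ?c ?b z w (\<sigma> (Suc j)) = \<zero>\<^bsub>Hom C ?c z\<^esub>}"
      then show "w \<in> through ?b ?a (\<sigma> j) z"
        using presentationD(5)[OF P j z, of w] unfolding through_def by auto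
    next
      fix w assume "w \<in> through ?b ?a (\<sigma> j) z"
      then obtain u where u: "u \<in> mor C ?a z" "w = Comp C ?b ?a z u (\<sigma> j)" unfolding through_def by auto
      then show "w \<in> {w \<in> mor C ?b z. Comp C ?c ?b z w (\<sigma> (Suc j)) = \<zero>\<^bsub>Hom C ?c z\<^esub>}"
        using j presentationD(4)[OF P j] by (simp add: Comp_assoc)
    qed
    then show ?thesis
      using pre_rank(2)[of ?c ?b z "\<sigma> (Suc j)" "mor C ?b z"] j
      unfolding h_def q_def by (simp add: hom_submodule_mor through_def)
  qed
  have "(\<Sum>i<n. (-1) ^ i * h (Suc i)) = q 0 - (-1) ^ n * q n" if "n \<le> d" for n
    using that
  proof (induction n)
    case (Suc n)
    then show ?case using hq[of n] by (simp add: algebra_simps)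
  qed simp
  from this[of d] have "(\<Sum>i\<le>d. (-1) ^ i * h (Suc i)) = q 0 + q d - h (Suc d)"
    using d by (simp flip: lessThan_Suc_atMost)
  then show ?thesis unfolding h_def q_def test_dim_def by simp
qed

end

section \<open>Resolutions by cluster tilting objects\<close>

locale cluster_tilting_category = hom_finite_category K C + angulated_category K C F d angles
  for K :: "('k, 'r) ring_scheme" and C :: "('o, 'k, 'm) lin_cat"
    and F :: "('o, 'm) endofunctor" and d :: nat and angles :: "('o, 'm) sigma_seq set" +
  fixes T :: 'o
  assumes split: "split_idempotents C" and ct: "cluster_tilting C F d angles T"
begin

abbreviation A :: "'o set" where "A \<equiv> add_closure C T"

lemma T_Obj [simp]: "T \<in> Obj C"
  using ct by (simp add: cluster_tilting_def)

lemma A_built_from: "t \<in> A \<Longrightarrow> built_from C T t"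
  by (rule add_closure_built_from[OF T_Obj])

lemma A_Obj: "t \<in> A \<Longrightarrow> t \<in> Obj C"
  using A_built_from by (simp add: built_from_def)

lemma T_in_A: "T \<in> A"
proof -
  obtain z where z: "zero_object C z" using zero_object_exists by blast
  have b: "is_direct_sum C T z T" unfolding is_direct_sum_def
    using biproduct_zero_right[OF T_Obj z] by blast
  have "T \<in> copies C T" by (rule copies.step[OF copies.zero[OF z] b])
  then show ?thesis unfolding add_closure_def using b by blast
qed

lemma A_orthogonal: "\<lbrakk>t \<in> A; t' \<in> A\<rbrakk> \<Longrightarrow> mor C t (fobj F t') = {\<zero>\<^bsub>Hom C t (fobj F t')\<^esub>}"
  using ct by (simp add: cluster_tilting_def)

text \<open>Resolutions in the numbering of presentations, that is \<open>c\<close>, \<open>t\<^sub>0\<close>, \<open>\<dots>\<close>, \<open>t\<^sub>d\<close>.\<close>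

definition res_obj :: "('o, 'm) sigma_seq \<Rightarrow> nat \<Rightarrow> 'o" where "res_obj P j = sobj P (Suc d - j)"

definition res_mor :: "('o, 'm) sigma_seq \<Rightarrow> nat \<Rightarrow> 'm" where "res_mor P j = smor P (d - j)"

lemma resolution_presentation:
  assumes P: "resolution d angles A c P"
  shows "presentation T d (res_obj P) (res_mor P)" "res_obj P 0 = c"
proof -
  have Pa: "P \<in> angles" and PA: "\<And>i. i \<le> d \<Longrightarrow> sobj P (d - i) \<in> A" and Pc: "sobj P (Suc d) = c"
    using P by (simp_all add: resolution_def)
  note s = angles_are_seqs[OF Pa]
  have eo: "eobj F d P (Suc d - j) = res_obj P j" for j by (simp add: res_obj_def ext_obj_simps)
  have em: "emor F d P (d - j) = res_mor P j" for j by (simp add: res_mor_def ext_mor_simps)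
  have o: "res_obj P j \<in> Obj C" for j using is_sigma_seqD(1)[OF s, of "Suc d - j"] by (simp add: eo)
  have m: "res_mor P j \<in> mor C (res_obj P (Suc j)) (res_obj P j)" if "j \<le> d" for j
    using is_sigma_seqD(2)[OF s, of "d - j"] that eo[of "Suc j"] eo[of j] em[of j]
    by (simp add: Suc_diff_le)
  have ex: "exact_at (res_obj P (Suc (Suc j))) (res_obj P (Suc j)) (res_obj P j) (res_mor P (Suc j)) (res_mor P j)"
    if "j < d" for j
  proof -
    have i: "Suc d - Suc (Suc j) = d - Suc j" "Suc (d - Suc j) = d - j" "Suc (d - j) = Suc d - j" "Suc d - Suc j = d - j"
      using that by auto
    show ?thesis
      using angle_exact[OF Pa, of "d - Suc j"] eo[of j] eo[of "Suc j"] eo[of "Suc (Suc j)"] em[of j] em[of "Suc j"]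
      unfolding i by simp
  qed
  show "presentation T d (res_obj P) (res_mor P)"
    unfolding presentation_def
  proof (intro conjI allI impI ballI)
    show "built_from C T (res_obj P (Suc j))" if "j \<le> d" for j
      using A_built_from[OF PA[OF that]] by (simp add: res_obj_def)
    show "\<exists>f'\<in>mor C (res_obj P j) z. f = Comp C (res_obj P (Suc j)) (res_obj P j) z f' (res_mor P j)"
      if "j < d" "z \<in> Obj C" "f \<in> mor C (res_obj P (Suc j)) z"
      "Comp C (res_obj P (Suc (Suc j))) (res_obj P (Suc j)) z f (res_mor P (Suc j)) = \<zero>\<^bsub>Hom C (res_obj P (Suc (Suc j))) z\<^esub>"
      for j z f
      using exact_atD(8)[OF ex] that by blast
  qed (use o m exact_atD(6)[OF ex] in blast)+
  show "res_obj P 0 = c" using Pc by (simp add: res_obj_def)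
qed

text \<open>The angle starting with \<open>g : y \<rightarrow> c\<close> is shifted back by \<open>\<Sigma>\<^sup>-\<^sup>d\<close>, so that it ends with \<open>g\<close>. At the start, a
  morphism \<open>w \<rightarrow> x 0\<close> killed by \<open>\<xi> 0\<close> factors, after \<open>\<Sigma>\<^sup>d\<close>, as \<open>\<Sigma>\<^sup>d w \<rightarrow> c \<rightarrow> \<Sigma>\<^sup>d x 0\<close>. For \<open>w\<close> in \<open>\<T>\<close> the first
  morphism factors through \<open>g\<close> up to sums, hence the composite is zero.\<close>

lemma angle_test_sequence:
  assumes R: "R \<in> angles" "sobj R 0 = y" "sobj R 1 = c" "smor R 0 = g"
    and kill: "\<And>k. k \<in> mor C (fobj F T) c \<Longrightarrow> \<exists>m\<in>mor C (fobj F T) y. k = Comp C (fobj F T) y c g m"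
  shows "\<exists>x \<xi>. test_sequence T d x \<xi> \<and> x d = y \<and> x (Suc d) = c \<and> \<xi> d = g"
proof -
  define x where "x i = fobj Fi (eobj F d R (Suc (Suc i)))" for i
  define \<xi> where "\<xi> i = fmor Fi (eobj F d R (Suc (Suc i))) (eobj F d R (Suc (Suc (Suc i)))) (emor F d R (Suc (Suc i)))" for i
  note s = is_sigma_seqD[OF angles_are_seqs[OF R(1)]]
  have ex: "exact_at (x i) (x (Suc i)) (x (Suc (Suc i))) (\<xi> i) (\<xi> (Suc i))" if "i < d" for i
    unfolding x_def \<xi>_def using that by (intro Fi_exact_at angle_exact R(1)) simp
  have xO: "x i \<in> Obj C" if "i \<le> Suc d" for i unfolding x_def using s(1)[of "Suc (Suc i)"] that by simp
  have xm: "\<xi> i \<in> mor C (x i) (x (Suc i))" if "i \<le> d" for i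
    unfolding x_def \<xi>_def using s(1)[of "Suc (Suc i)"] s(1)[of "Suc (Suc (Suc i))"] s(2)[of "Suc (Suc i)"] that by simp
  have [simp]: "y \<in> Obj C" "c \<in> Obj C" "g \<in> mor C y c"
    using angle_objs[OF R(1)] R(2-4) by simp_all
  let ?z = "eobj F d R (Suc (Suc 0))" and ?z' = "eobj F d R (Suc (Suc (Suc 0)))"
  let ?a = "emor F d R (Suc 0)" and ?b = "emor F d R (Suc (Suc 0))"
  have e1: "exact_at c ?z ?z' ?a ?b"
    using angle_exact[OF R(1), of "Suc 0"] R(3) unfolding One_nat_def
    by (simp only: ext_obj_simps(1)[of "Suc 0"] le0 Suc_le_mono)
  have e0: "exact_at y c ?z g ?a"
    using angle_exact[OF R(1), of 0] R(2-4) unfolding One_nat_def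
    by (simp only: ext_obj_simps(1)[of "Suc 0"] ext_obj_simps(1)[of 0] ext_mor_simps(1)[of 0] le0 Suc_le_mono)
  note [simp] = exact_atD(1-5)[OF e1]
  have x0: "x 0 = fobj Fi ?z" "x (Suc 0) = fobj Fi ?z'" "\<xi> 0 = fmor Fi ?z ?z' ?b"
    by (simp_all only: x_def \<xi>_def)
  have start: "f = \<zero>\<^bsub>Hom C w (x 0)\<^esub>"
    if w: "built_from C T w" and f: "f \<in> mor C w (x 0)"
      "Comp C w (x 0) (x (Suc 0)) (\<xi> 0) f = \<zero>\<^bsub>Hom C w (x (Suc 0))\<^esub>" for w f
  proof -
    have [simp]: "w \<in> Obj C" using w by (simp add: built_from_def)
    let ?w = "fobj F w"
    obtain f' where f': "f' \<in> mor C ?w ?z" "f = fmor Fi ?w ?z f'"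
    proof (rule Fi_full[of ?w ?z f])
      show "f \<in> mor C (fobj Fi ?w) (fobj Fi ?z)" using f(1) by (simp add: x0)
    qed simp_all
    note [simp] = f'(1)
    have "fmor Fi ?w ?z' (Comp C ?w ?z ?z' ?b f') = fmor Fi ?w ?z' \<zero>\<^bsub>Hom C ?w ?z'\<^esub>"
      using f(2) unfolding x0 f'(2)
      by (simp add: functor_Comp[OF Fi_additive] functor_zero[OF Fi_additive])
    then have "Comp C ?w ?z ?z' ?b f' = \<zero>\<^bsub>Hom C ?w ?z'\<^esub>"
      by (rule Fi_faithful[rotated 4]) simp_all
    then have "\<exists>k\<in>mor C ?w c. f' = Comp C ?w c ?z ?a k"
      by (intro exact_atD(7)[OF e1]) simp_all
    then obtain k where k: "k \<in> mor C ?w c" "f' = Comp C ?w c ?z ?a k" by (elim bexE)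
    have kl: "Comp C (fobj F T) c ?z ?a l = \<zero>\<^bsub>Hom C (fobj F T) ?z\<^esub>" if l: "l \<in> mor C (fobj F T) c" for l
    proof -
      obtain m where m: "m \<in> mor C (fobj F T) y" "l = Comp C (fobj F T) y c g m" using kill[OF l] by (elim bexE)
      then show ?thesis
        using Comp_assoc[of "fobj F T" y c ?z ?a g m] exact_atD(6)[OF e0] by simp
    qed
    have kt: "k \<in> thru C (fobj F T) ?w c"
      using functor_built_from[OF F_additive T_Obj w] k by (intro built_from_thru_left) simp_all
    have "Comp C ?w c ?z ?a k = \<zero>\<^bsub>Hom C ?w ?z\<^esub>"
      by (rule killed_on_thru[OF _ _ _ _ _ kl kt]) simp_all
    then have "f' = \<zero>\<^bsub>Hom C ?w ?z\<^esub>" by (simp only: k(2))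
    then show ?thesis using f'(2) functor_zero[OF Fi_additive, of ?w ?z] x0 by simp
  qed
  have "test_sequence T d x \<xi>"
    unfolding test_sequence_def
  proof (intro conjI allI impI ballI)
    show "\<exists>f'\<in>mor C w (x i). f = Comp C w (x i) (x (Suc i)) (\<xi> i) f'"
      if "i < d" "w \<in> Obj C" "f \<in> mor C w (x (Suc i))"
        "Comp C w (x (Suc i)) (x (Suc (Suc i))) (\<xi> (Suc i)) f = \<zero>\<^bsub>Hom C w (x (Suc (Suc i)))\<^esub>" for i w f
      by (rule exact_atD(7)[OF ex[OF that(1)] that(2-4)])
    show "f = \<zero>\<^bsub>Hom C w (x 0)\<^esub>" if "built_from C T w" "f \<in> mor C w (x 0)"
      "Comp C w (x 0) (x (Suc 0)) (\<xi> 0) f = \<zero>\<^bsub>Hom C w (x (Suc 0))\<^esub>" for w f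
      by (rule start[OF that])
    show "Comp C (x i) (x (Suc i)) (x (Suc (Suc i))) (\<xi> (Suc i)) (\<xi> i) = \<zero>\<^bsub>Hom C (x i) (x (Suc (Suc i)))\<^esub>"
      if "i < d" for i by (rule exact_atD(6)[OF ex[OF that]])
  qed (simp_all add: xO xm)
  moreover have "x d = y" "x (Suc d) = c" "\<xi> d = g"
    using R(2-4) by (simp_all add: x_def \<xi>_def ext_obj_simps ext_mor_simps)
  ultimately show ?thesis by (intro exI[of _ x] exI[of _ \<xi>]) simp
qed

lemma test_dims_determine_object:
  assumes P: "presentation T d e \<sigma>" and P': "presentation T d e' \<sigma>'"
    and ind: "indecomposable C (e 0)" "indecomposable C (e' 0)"
    and nz: "\<sigma> 0 \<noteq> \<zero>\<^bsub>Hom C (e 1) (e 0)\<^esub>"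
    and eq: "\<And>y. y \<in> Obj C \<Longrightarrow> test_dim e \<sigma> y = test_dim e' \<sigma>' y"
  shows "isomorphic C (e 0) (e' 0)"
proof -
  note [simp] = indecomposable_Obj[OF ind(1)] indecomposable_Obj[OF ind(2)]
  let ?N = "fobj F T" and ?c = "e 0"
  obtain u i1 i2 p1 p2 where b: "biproduct C (e' 0) ?N u i1 i2 p1 p2"
    using direct_sum_exists[of "e' 0" ?N] unfolding is_direct_sum_def by (auto simp del: split_paired_Ex)
  note [simp] = biproductD(1-11)[OF b]
  obtain y g where y: "y \<in> Obj C" "built_from C u y" "g \<in> mor C y ?c" "Comp C u y ?c g ` mor C u y = mor C u ?c"
    by (rule approximation[of u ?c]) simp_all
  note [simp] = y(1,3)
  obtain R where R: "R \<in> angles" "sobj R 0 = y" "sobj R 1 = ?c" "smor R 0 = g"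
    using N1_exists[OF y(1) _ y(3)] by (auto simp del: One_nat_def)
  have kill: "\<exists>m\<in>mor C ?N y. k = Comp C ?N y ?c g m" if k: "k \<in> mor C ?N ?c" for k
  proof -
    have "Comp C u ?N ?c k p2 \<in> mor C u ?c" using k by simp
    then obtain m where m: "m \<in> mor C u y" "Comp C u ?N ?c k p2 = Comp C u y ?c g m"
      unfolding y(4)[symmetric] by auto
    have "k = Comp C ?N u ?c (Comp C u ?N ?c k p2) i2" using k by (simp add: Comp_assoc)
    also have "\<dots> = Comp C ?N y ?c g (Comp C ?N u y m i2)" unfolding m(2) using m(1) by (simp add: Comp_assoc)
    finally show ?thesis using m(1) by (intro bexI[of _ "Comp C ?N u y m i2"]) simp_all
  qed
  obtain x \<xi> where x: "test_sequence T d x \<xi>" "x d = y" "x (Suc d) = ?c" "\<xi> d = g"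
  proof -
    have "\<exists>x \<xi>. test_sequence T d x \<xi> \<and> x d = y \<and> x (Suc d) = ?c \<and> \<xi> d = g"
      by (rule angle_test_sequence[OF R]) (rule kill)
    then show ?thesis using that by (elim exE conjE)
  qed
  show ?thesis
    by (rule presentations_determine_object[OF split T_Obj P P' ind nz eq _ A_orthogonal[OF T_in_A T_in_A] b x(1,3)])
      (simp_all add: x y)
qed


lemma resolution_ends:
  assumes P: "resolution d angles A c P"
  defines "t \<equiv> res_obj P (Suc d)" and "s \<equiv> res_obj P d"
  shows "P \<in> angles" "t \<in> A" "s \<in> Obj C" "t \<in> Obj C" "c \<in> Obj C"
    "res_mor P d \<in> mor C t s"
    "exact_at (res_obj P 1) c (fobj F t) (res_mor P 0) (smor P (Suc d))"
    "exact_at c (fobj F t) (fobj F s) (smor P (Suc d)) (fmor F t s (res_mor P d))"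
proof -
  show Pa: "P \<in> angles" using P by (simp add: resolution_def)
  show "t \<in> A" using P unfolding resolution_def t_def res_obj_def by (metis diff_self_eq_0 le_refl)
  have c: "sobj P (Suc d) = c" using P by (simp add: resolution_def)
  have ts: "t = sobj P 0" "s = sobj P (Suc 0)" "res_mor P d = smor P 0"
    by (simp_all add: t_def s_def res_obj_def res_mor_def)
  show "s \<in> Obj C" "t \<in> Obj C" "res_mor P d \<in> mor C t s" using angle_objs[OF Pa] by (simp_all add: ts)
  show "c \<in> Obj C" using is_sigma_seqD(1)[OF angles_are_seqs[OF Pa], of "Suc d"] by (simp add: ext_obj_simps c)
  show "exact_at (res_obj P 1) c (fobj F t) (res_mor P 0) (smor P (Suc d))"
    using angle_exact[OF Pa, of d] by (simp add: ext_obj_simps ext_mor_simps c ts res_obj_def res_mor_def)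
  show "exact_at c (fobj F t) (fobj F s) (smor P (Suc d)) (fmor F t s (res_mor P d))"
    using angle_exact[OF Pa, of "Suc d"] by (simp add: ext_obj_simps ext_mor_simps c ts)
qed

text \<open>Shifted by \<open>\<Sigma>\<^sup>d\<close>, this is exactness of the angle at \<open>\<Sigma>\<^sup>d t\<^sub>d\<close>; undo the shift by fullness and
  faithfulness.\<close>

lemma factors_if_killed_by_connecting:
  assumes P: "resolution d angles A c P" and x: "x \<in> Obj C"
    and \<beta>: "\<beta> \<in> mor C (res_obj P (Suc d)) x"
    and k: "Comp C c (fobj F (res_obj P (Suc d))) (fobj F x) (fmor F (res_obj P (Suc d)) x \<beta>) (smor P (Suc d)) =
      \<zero>\<^bsub>Hom C c (fobj F x)\<^esub>"
  shows "\<beta> \<in> through (res_obj P (Suc d)) (res_obj P d) (res_mor P d) x"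
proof -
  let ?t = "res_obj P (Suc d)" and ?s = "res_obj P d" and ?p = "res_mor P d"
  note [simp] = resolution_ends(3-6)[OF P] x \<beta>
  obtain \<gamma>' where \<gamma>': "\<gamma>' \<in> mor C (fobj F ?s) (fobj F x)"
    "fmor F ?t x \<beta> = Comp C (fobj F ?t) (fobj F ?s) (fobj F x) \<gamma>' (fmor F ?t ?s ?p)"
    using exact_atD(8)[OF resolution_ends(8)[OF P] _ _ k] by auto
  obtain \<gamma> where \<gamma>: "\<gamma> \<in> mor C ?s x" "\<gamma>' = fmor F ?s x \<gamma>"
    by (rule F_full[OF _ _ \<gamma>'(1)]) simp_all
  have "fmor F ?t x \<beta> = fmor F ?t x (Comp C ?t ?s x \<gamma> ?p)"
    using \<gamma>'(2) \<gamma> by (simp add: functor_Comp[OF F_additive])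
  then have "\<beta> = Comp C ?t ?s x \<gamma> ?p" by (rule F_faithful[rotated 4]) (simp_all add: \<gamma>(1))
  then show ?thesis unfolding through_def by (rule image_eqI) (rule \<gamma>(1))
qed

text \<open>If \<open>\<beta> : t\<^sub>d \<rightarrow> x\<close> is not in the image, then \<open>c \<rightarrow> \<Sigma>\<^sup>d t\<^sub>d \<rightarrow> \<Sigma>\<^sup>d x\<close> is nonzero, and duality gives \<open>g' : x \<rightarrow> \<Sigma>\<^sup>d c\<close>
  with \<open>g' \<beta> \<noteq> 0\<close>. But \<open>g'\<close> factors through \<open>\<Sigma>\<^sup>d \<T>\<close>, to which \<open>t\<^sub>d\<close> has no nonzero morphisms.\<close>

lemma serre_vanishing:
  assumes cy: "calabi_yau K C F" and P: "resolution d angles A c P" and x: "x \<in> Obj C"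
    and fac: "mor C x (fobj F c) \<subseteq> factoring C (fobj F ` A) x (fobj F c)"
  shows "through (res_obj P (Suc d)) (res_obj P d) (res_mor P d) x = mor C (res_obj P (Suc d)) x"
proof (intro equalityI subsetI)
  let ?t = "res_obj P (Suc d)" and ?s = "res_obj P d" and ?p = "res_mor P d" and ?\<delta> = "smor P (Suc d)"
  note [simp] = resolution_ends(3-6)[OF P] x exact_atD(5)[OF resolution_ends(7)[OF P]]
  fix \<beta> assume "\<beta> \<in> through ?t ?s ?p x"
  then show "\<beta> \<in> mor C ?t x" unfolding through_def by auto
next
  let ?t = "res_obj P (Suc d)" and ?s = "res_obj P d" and ?p = "res_mor P d" and ?\<delta> = "smor P (Suc d)"
  note [simp] = resolution_ends(3-6)[OF P] x exact_atD(5)[OF resolution_ends(7)[OF P]]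
  fix \<beta> assume \<beta> [simp]: "\<beta> \<in> mor C ?t x"
  let ?f = "Comp C c (fobj F ?t) (fobj F x) (fmor F ?t x \<beta>) ?\<delta>"
  have "?f = \<zero>\<^bsub>Hom C c (fobj F x)\<^esub>"
  proof (rule ccontr)
    assume "?f \<noteq> \<zero>\<^bsub>Hom C c (fobj F x)\<^esub>"
    then obtain g where g: "g \<in> mor C (fobj F x) (fobj F (fobj F c))"
      "Comp C c (fobj F x) (fobj F (fobj F c)) g ?f \<noteq> \<zero>\<^bsub>Hom C c (fobj F (fobj F c))\<^esub>"
      using calabi_yau_nondegenerate[OF cy, of c "fobj F x" ?f] by auto
    obtain g' where g': "g' \<in> mor C x (fobj F c)" "g = fmor F x (fobj F c) g'"
      by (rule F_full[OF _ _ g(1)]) simp_all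
    have "g' \<in> factoring C (fobj F ` A) x (fobj F c)" using g'(1) fac by (rule subsetD[rotated])
    then obtain t' l k where t': "t' \<in> A" "l \<in> mor C x (fobj F t')" "k \<in> mor C (fobj F t') (fobj F c)"
      "g' = Comp C x (fobj F t') (fobj F c) k l"
      unfolding factoring_def by auto
    note [simp] = g(1) g'(1) t'(2,3) A_Obj[OF t'(1)]
    have "Comp C ?t x (fobj F t') l \<beta> \<in> mor C ?t (fobj F t')" by simp
    then have "Comp C ?t x (fobj F t') l \<beta> = \<zero>\<^bsub>Hom C ?t (fobj F t')\<^esub>"
      using A_orthogonal[OF resolution_ends(2)[OF P] t'(1)] by (metis singletonD)
    then have g0: "Comp C ?t x (fobj F c) g' \<beta> = \<zero>\<^bsub>Hom C ?t (fobj F c)\<^esub>"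
      unfolding t'(4) by (simp add: Comp_assoc)
    have "Comp C c (fobj F x) (fobj F (fobj F c)) g ?f =
      Comp C c (fobj F ?t) (fobj F (fobj F c)) (fmor F ?t (fobj F c) (Comp C ?t x (fobj F c) g' \<beta>)) ?\<delta>"
      unfolding g'(2) by (simp add: functor_Comp[OF F_additive] Comp_assoc)
    also have "\<dots> = \<zero>\<^bsub>Hom C c (fobj F (fobj F c))\<^esub>"
      unfolding g0 by (simp add: functor_zero[OF F_additive])
    finally show False using g(2) by simp
  qed
  then show "\<beta> \<in> through ?t ?s ?p x" by (intro factors_if_killed_by_connecting[OF P x \<beta>])
qed

lemma index_determines_euler_sum:
  assumes c: "c \<in> Obj C" "c' \<in> Obj C" and eq: "index C d angles A c = index C d angles A c'"
  shows "\<exists>P P'. resolution d angles A c P \<and> resolution d angles A c' P' \<and>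
    (\<forall>x\<in>Obj C. (\<Sum>i\<le>d. (-1) ^ i * int (hdim (res_obj P (Suc i)) x (mor C (res_obj P (Suc i)) x))) =
      (\<Sum>i\<le>d. (-1) ^ i * int (hdim (res_obj P' (Suc i)) x (mor C (res_obj P' (Suc i)) x))))"
proof -
  define R where "R c = (SOME P. resolution d angles A c P)" for c
  have R: "resolution d angles A c (R c)" if "c \<in> Obj C" for c
    unfolding R_def by (rule someI_ex) (use ct that in \<open>simp add: cluster_tilting_def\<close>)
  have "(\<Sum>i\<le>d. (-1) ^ i * int (hdim (res_obj (R c) (Suc i)) x (mor C (res_obj (R c) (Suc i)) x))) =
      (\<Sum>i\<le>d. (-1) ^ i * int (hdim (res_obj (R c') (Suc i)) x (mor C (res_obj (R c') (Suc i)) x)))"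
    if x: "x \<in> Obj C" for x
  proof -
    define h where "h t = int (hdim t x (mor C t x))" for t
    have "h t = h t' + h t''" if "is_direct_sum C t' t'' t" for t t' t''
      using that mor_biproduct_from[OF x] unfolding is_direct_sum_def h_def by (elim exE) simp
    then have sk: "comm_group (split_K0 C A) \<and> (\<forall>t\<in>A. K0_class C A t \<in> carrier (split_K0 C A)) \<and>
        (\<exists>\<psi>\<in>hom (split_K0 C A) integer_group. \<forall>t\<in>A. \<psi> (K0_class C A t) = h t)"
      by (intro split_K0_functional)
    then obtain \<psi> where \<psi>: "\<psi> \<in> hom (split_K0 C A) integer_group" "\<forall>t\<in>A. \<psi> (K0_class C A t) = h t"
      by (elim conjE bexE)
    have "\<psi> (index C d angles A b) = (\<Sum>i\<le>d. (-1) ^ i * h (res_obj (R b) (Suc i)))" if b: "b \<in> Obj C" for b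
    proof -
      have A: "sobj (R b) (d - i) \<in> A" if "i \<le> d" for i using R[OF b] that by (simp add: resolution_def)
      have "\<psi> (index C d angles A b) = (\<Sum>i\<le>d. (-1) ^ i * \<psi> (K0_class C A (sobj (R b) (d - i))))"
        unfolding index_def Let_def R_def[symmetric]
        by (rule hom_alternating_product) (use sk \<psi>(1) A in auto)
      also have "\<dots> = (\<Sum>i\<le>d. (-1) ^ i * h (res_obj (R b) (Suc i)))"
        by (rule sum.cong) (use \<psi>(2) A in \<open>auto simp: res_obj_def\<close>)
      finally show ?thesis .
    qed
    from this[OF c(1)] this[OF c(2)] show ?thesis using eq unfolding h_def by simp
  qed
  then show ?thesis using R c by (intro exI[of _ "R c"] exI[of _ "R c'"]) simp
qed

text \<open>As \<open>t\<^sub>0 \<rightarrow> c\<close> is zero, the connecting morphism \<open>c \<rightarrow> \<Sigma>\<^sup>d t\<^sub>d\<close> is a split monomorphism \<open>\<Sigma>\<^sup>d \<iota>\<close>. Restriction along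
  \<open>\<iota>\<close> maps \<open>Hom(t\<^sub>d,x)\<close> onto \<open>Hom(\<Sigma>\<^sup>-\<^sup>d c,x)\<close>, and its kernel is the image of \<open>Hom(t\<^sub>d\<^sub>-\<^sub>1,x)\<close>.\<close>

lemma shifted_summand:
  assumes P: "resolution d angles A c P" and z: "res_mor P 0 = \<zero>\<^bsub>Hom C (res_obj P 1) c\<^esub>"
    and x: "x \<in> Obj C"
  shows "built_from C T (fobj Fi c)"
    "hdim (res_obj P (Suc d)) x (mor C (res_obj P (Suc d)) x) =
     hdim (fobj Fi c) x (mor C (fobj Fi c) x) +
     hdim (res_obj P (Suc d)) x (through (res_obj P (Suc d)) (res_obj P d) (res_mor P d) x)"
proof -
  let ?t = "res_obj P (Suc d)" and ?s = "res_obj P d" and ?p = "res_mor P d" and ?\<delta> = "smor P (Suc d)"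
  note ex = resolution_ends(7,8)[OF P]
  note [simp] = resolution_ends(3-6)[OF P] x exact_atD(1,5)[OF ex(1), unfolded One_nat_def]
  let ?e = "fobj Fi c"
  have "\<exists>\<rho>\<in>mor C (fobj F ?t) c. Ident C c = Comp C c (fobj F ?t) c \<rho> ?\<delta>"
    by (rule exact_atD(8)[OF ex(1)]) (simp_all add: z)
  then obtain \<rho> where \<rho>: "\<rho> \<in> mor C (fobj F ?t) c" "Ident C c = Comp C c (fobj F ?t) c \<rho> ?\<delta>" by (elim bexE)
  note [simp] = \<rho>(1)
  obtain \<iota> where \<iota>: "\<iota> \<in> mor C ?e ?t" "?\<delta> = fmor F ?e ?t \<iota>"
    by (rule F_full[of ?e ?t ?\<delta>]) simp_all
  obtain r where r: "r \<in> mor C ?t ?e" "\<rho> = fmor F ?t ?e r"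
    by (rule F_full[of ?t ?e \<rho>]) simp_all
  note [simp] = \<iota>(1) r(1)
  have "fmor F ?e ?e (Comp C ?e ?t ?e r \<iota>) = Comp C c (fobj F ?t) c \<rho> ?\<delta>"
    unfolding \<iota>(2) r(2) by (simp add: functor_Comp[OF F_additive])
  also have "\<dots> = fmor F ?e ?e (Ident C ?e)" using \<rho>(2) functor_Ident[OF F_additive, of ?e] by simp
  finally have r\<iota>: "Comp C ?e ?t ?e r \<iota> = Ident C ?e"
    by (rule F_faithful[rotated 4]) simp_all
  show "built_from C T ?e"
    by (rule built_from_retract[OF T_Obj A_built_from[OF resolution_ends(2)[OF P]] _ \<iota>(1) r(1) r\<iota>]) simp
  have "(\<lambda>u. Comp C ?e ?t x u \<iota>) ` mor C ?t x = mor C ?e x"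
  proof (intro equalityI subsetI)
    fix v assume v: "v \<in> mor C ?e x"
    then have "v = Comp C ?e ?t x (Comp C ?t ?e x v r) \<iota>" by (simp add: Comp_assoc r\<iota>)
    then show "v \<in> (\<lambda>u. Comp C ?e ?t x u \<iota>) ` mor C ?t x" by (rule image_eqI) (use v in simp)
  qed auto
  moreover have "{u \<in> mor C ?t x. Comp C ?e ?t x u \<iota> = \<zero>\<^bsub>Hom C ?e x\<^esub>} = through ?t ?s ?p x"
  proof (intro equalityI subsetI)
    fix u assume "u \<in> {u \<in> mor C ?t x. Comp C ?e ?t x u \<iota> = \<zero>\<^bsub>Hom C ?e x\<^esub>}"
    then have u: "u \<in> mor C ?t x" "Comp C ?e ?t x u \<iota> = \<zero>\<^bsub>Hom C ?e x\<^esub>" by simp_all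
    have "Comp C c (fobj F ?t) (fobj F x) (fmor F ?t x u) ?\<delta> = fmor F ?e x (Comp C ?e ?t x u \<iota>)"
      using u(1) by (simp add: \<iota>(2) functor_Comp[OF F_additive])
    then show "u \<in> through ?t ?s ?p x"
      using u functor_zero[OF F_additive, of ?e x] by (intro factors_if_killed_by_connecting[OF P x]) simp_all
  next
    fix u assume "u \<in> through ?t ?s ?p x"
    then obtain v where v: "v \<in> mor C ?s x" "u = Comp C ?t ?s x v ?p" unfolding through_def by auto
    have "fmor F ?e ?s (Comp C ?e ?t ?s ?p \<iota>) = Comp C c (fobj F ?t) (fobj F ?s) (fmor F ?t ?s ?p) ?\<delta>"
      by (simp add: \<iota>(2) functor_Comp[OF F_additive])
    also have "\<dots> = fmor F ?e ?s \<zero>\<^bsub>Hom C ?e ?s\<^esub>"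
      using exact_atD(6)[OF ex(2)] functor_zero[OF F_additive, of ?e ?s] by simp
    finally have "Comp C ?e ?t ?s ?p \<iota> = \<zero>\<^bsub>Hom C ?e ?s\<^esub>"
      by (rule F_faithful[rotated 4]) simp_all
    then show "u \<in> {u \<in> mor C ?t x. Comp C ?e ?t x u \<iota> = \<zero>\<^bsub>Hom C ?e x\<^esub>}"
      using v by (simp add: Comp_assoc)
  qed
  ultimately show "hdim ?t x (mor C ?t x) = hdim ?e x (mor C ?e x) + hdim ?t x (through ?t ?s ?p x)"
    using pre_rank(2)[of ?e ?t x \<iota> "mor C ?t x"] by (simp add: hom_submodule_mor)
qed

lemma trivial_presentation:
  assumes e: "built_from C T t"
  shows "\<exists>e \<sigma>. presentation T d e \<sigma> \<and> e 0 = t \<and> e 1 = t \<and> \<sigma> 0 = Ident C t \<and>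
    (\<forall>x\<in>Obj C. test_dim e \<sigma> x = hdim t x (mor C t x))"
proof -
  have [simp]: "t \<in> Obj C" using e by (simp add: built_from_def)
  obtain z where z: "zero_object C z" using zero_object_exists by blast
  then have [simp]: "z \<in> Obj C" by (simp add: zero_object_def)
  define e :: "nat \<Rightarrow> 'o" where "e j = (if j \<le> 1 then t else z)" for j
  define \<sigma> where "\<sigma> j = (if j = 0 then Ident C t else \<zero>\<^bsub>Hom C (e (Suc j)) (e j)\<^esub>)" for j
  have eO [simp]: "e j \<in> Obj C" for j by (simp add: e_def)
  have e01: "e 0 = t" "e (Suc 0) = t" by (simp_all add: e_def)
  have ez: "zero_object C (e (Suc (Suc j)))" for j using z by (simp add: e_def)
  have \<sigma>m: "\<sigma> j \<in> mor C (e (Suc j)) (e j)" for j by (cases j) (simp_all add: \<sigma>_def e01)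
  have "presentation T d e \<sigma>"
    unfolding presentation_def
  proof (intro conjI allI impI ballI)
    show "built_from C T (e (Suc j))" for j
      using \<open>built_from C T t\<close> built_from_zero_object[OF T_Obj z] by (simp add: e_def)
    show "Comp C (e (Suc (Suc j))) (e (Suc j)) (e j) (\<sigma> j) (\<sigma> (Suc j)) = \<zero>\<^bsub>Hom C (e (Suc (Suc j))) (e j)\<^esub>" for j
      by (rule zero_object_from[OF ez]) (simp_all add: \<sigma>m)
    show "\<exists>f'\<in>mor C (e j) w. f = Comp C (e (Suc j)) (e j) w f' (\<sigma> j)"
      if w: "w \<in> Obj C" "f \<in> mor C (e (Suc j)) w" for j w f
    proof (cases j)
      case 0
      then show ?thesis using w by (intro bexI[of _ f]) (simp_all add: e01 \<sigma>_def)
    next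
      case (Suc i)
      then have "f = \<zero>\<^bsub>Hom C (e (Suc j)) w\<^esub>" using w by (intro zero_object_from[of "e (Suc j)"]) (simp_all add: ez)
      then show ?thesis using w \<sigma>m[of j] by (intro bexI[of _ "\<zero>\<^bsub>Hom C (e j) w\<^esub>"]) simp_all
    qed
  qed (simp_all add: \<sigma>m)
  moreover have "test_dim e \<sigma> x = hdim t x (mor C t x)" if "x \<in> Obj C" for x
    using that by (simp add: test_dim_def e01 \<sigma>_def through_Ident)
  moreover have "\<sigma> 0 = Ident C t" by (simp add: \<sigma>_def)
  ultimately show ?thesis using e01 by (intro exI[of _ e] exI[of _ \<sigma>]) simp
qed

theorem index_determines_indecomposable:
  assumes d: "odd d" and cy: "calabi_yau K C F"
    and hyp: "\<And>c x. \<lbrakk>indecomposable C c; indecomposable C x\<rbrakk> \<Longrightarrow>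
      \<not> (nonzero_space (Hom (quotient_category C (fobj F ` A)) c x) \<and>
         nonzero_space (Hom (quotient_category C (fobj F ` A)) x (fobj F c)))"
    and c: "indecomposable C c" and c': "indecomposable C c'"
    and eq: "index C d angles A c = index C d angles A c'"
  shows "isomorphic C c c'"
proof -
  have FA: "fobj F ` A \<noteq> {}" "fobj F ` A \<subseteq> Obj C" using T_in_A A_Obj by auto
  \<comment> \<open>the number \<open>b(c,x)\<close>; \<open>a(c,x)\<close> is \<open>test_dim (res_obj P) (res_mor P) x\<close>\<close>
  define cok where "cok P x = int (hdim (res_obj P (Suc d)) x (mor C (res_obj P (Suc d)) x)) -
      int (hdim (res_obj P (Suc d)) x (through (res_obj P (Suc d)) (res_obj P d) (res_mor P d) x))" for P x
  note [simp] = indecomposable_Obj[OF c] indecomposable_Obj[OF c']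
  obtain P P' where P: "resolution d angles A c P" and P': "resolution d angles A c' P'"
    and PP: "\<And>x. x \<in> Obj C \<Longrightarrow>
      (\<Sum>i\<le>d. (-1) ^ i * int (hdim (res_obj P (Suc i)) x (mor C (res_obj P (Suc i)) x))) =
      (\<Sum>i\<le>d. (-1) ^ i * int (hdim (res_obj P' (Suc i)) x (mor C (res_obj P' (Suc i)) x)))"
    using index_determines_euler_sum[of c c'] eq by auto
  note pr = resolution_presentation[OF P] and pr' = resolution_presentation[OF P']
  have diff: "int (test_dim (res_obj P) (res_mor P) x) - cok P x = int (test_dim (res_obj P') (res_mor P') x) - cok P' x"
    if "x \<in> Obj C" for x
    using PP[OF that] presentation_euler[OF pr(1) that d] presentation_euler[OF pr'(1) that d]
    unfolding cok_def by linarith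
  have cok_nonneg: "cok Q x \<ge> 0" if Q: "resolution d angles A b Q" and x: "x \<in> Obj C" for b Q x
  proof -
    note r = resolution_ends(3-6)[OF Q]
    have "hdim (res_obj Q (Suc d)) x (through (res_obj Q (Suc d)) (res_obj Q d) (res_mor Q d) x) \<le>
        hdim (res_obj Q (Suc d)) x (mor C (res_obj Q (Suc d)) x)"
      by (rule hdim_mono) (use r x in \<open>auto simp: through_def intro!: pre_rank(1) hom_submodule_mor\<close>)
    then show ?thesis unfolding cok_def by simp
  qed
  have disj: "test_dim (res_obj Q) (res_mor Q) x = 0 \<or> cok Q x = 0"
    if b: "indecomposable C b" and Q: "resolution d angles A b Q" and x: "indecomposable C x" for b Q x
  proof (rule disjCI)
    assume nz: "cok Q x \<noteq> 0"
    have [simp]: "x \<in> Obj C" "b \<in> Obj C" using b x by (simp_all add: indecomposable_Obj)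
    note prQ = resolution_presentation[OF Q]
    note ex = resolution_ends(7)[OF Q]
    have "through (res_obj Q (Suc d)) (res_obj Q d) (res_mor Q d) x \<noteq> mor C (res_obj Q (Suc d)) x"
      using nz unfolding cok_def by auto
    then have "\<not> mor C x (fobj F b) \<subseteq> factoring C (fobj F ` A) x (fobj F b)"
      using serre_vanishing[OF cy Q \<open>x \<in> Obj C\<close>] by blast
    then obtain g where "g \<in> mor C x (fobj F b)" "g \<notin> factoring C (fobj F ` A) x (fobj F b)" by blast
    then have "nonzero_space (Hom (quotient_category C (fobj F ` A)) x (fobj F b))"
      by (intro quotient_nonzero[OF _ _ FA]) simp_all
    then have nn: "\<not> nonzero_space (Hom (quotient_category C (fobj F ` A)) b x)" using hyp[OF b x] by blast
    have "w = \<zero>\<^bsub>Hom C (res_obj Q 1) x\<^esub>" if "w \<in> through (res_obj Q 1) b (res_mor Q 0) x" for w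
    proof -
      obtain u where u: "u \<in> mor C b x" "w = Comp C (res_obj Q 1) b x u (res_mor Q 0)"
        using \<open>w \<in> _\<close> unfolding through_def by auto
      have "u \<in> factoring C (fobj F ` A) b x"
        using quotient_nonzero[OF \<open>b \<in> Obj C\<close> \<open>x \<in> Obj C\<close> FA u(1)] nn by blast
      then obtain t l k where t: "t \<in> A" "l \<in> mor C b (fobj F t)" "k \<in> mor C (fobj F t) x"
        "u = Comp C b (fobj F t) x k l"
        unfolding factoring_def by auto
      note [simp] = t(2,3) A_Obj[OF t(1)] exact_atD(1,4)[OF ex, unfolded One_nat_def]
      have "res_obj Q 1 \<in> A"
        using Q unfolding resolution_def res_obj_def by (metis diff_Suc_Suc minus_nat.diff_0 One_nat_def le0)
      then have "Comp C (res_obj Q 1) b (fobj F t) l (res_mor Q 0) = \<zero>\<^bsub>Hom C (res_obj Q 1) (fobj F t)\<^esub>"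
        using A_orthogonal[OF _ t(1)] Comp_closed[of "res_obj Q 1" b "fobj F t" l "res_mor Q 0"] by simp
      then show ?thesis unfolding u(2) t(4) by (simp add: Comp_assoc)
    qed
    then have "through (res_obj Q 1) b (res_mor Q 0) x \<subseteq> {\<zero>\<^bsub>Hom C (res_obj Q 1) x\<^esub>}" by blast
    moreover have "\<zero>\<^bsub>Hom C (res_obj Q 1) x\<^esub> \<in> through (res_obj Q 1) b (res_mor Q 0) x"
      using submodule.zero_closed[OF through_submodule] exact_atD(1,4)[OF ex] by simp
    ultimately have "through (res_obj Q 1) b (res_mor Q 0) x = {\<zero>\<^bsub>Hom C (res_obj Q 1) x\<^esub>}" by blast
    then show "test_dim (res_obj Q) (res_mor Q) x = 0"
      unfolding test_dim_def prQ(2) using hdim_zero[OF exact_atD(1)[OF ex] \<open>x \<in> Obj C\<close>] by simp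
  qed
  have test_eq: "test_dim (res_obj P) (res_mor P) x = test_dim (res_obj P') (res_mor P') x" if "x \<in> Obj C" for x
    using that
  proof (induction x rule: decomposition_induct)
    case (zero z)
    then show ?case using test_dim_zero[OF pr(1)] test_dim_zero[OF pr'(1)] by simp
  next
    case (indecomposable x)
    then show ?case
      using disj[OF c P indecomposable] disj[OF c' P' indecomposable] indecomposable_Obj[OF indecomposable]
        diff[of x] cok_nonneg[OF P, of x] cok_nonneg[OF P', of x] by auto
  next
    case (sum y z s i1 i2 p1 p2)
    then show ?case using test_dim_biproduct[OF pr(1) sum(1)] test_dim_biproduct[OF pr'(1) sum(1)] by simp
  qed
  show ?thesis
  proof (cases "res_mor P 0 = \<zero>\<^bsub>Hom C (res_obj P 1) c\<^esub>")
    case False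
    then show ?thesis
      using test_dims_determine_object[OF pr(1) pr'(1)] c c' test_eq pr(2) pr'(2) by simp
  next
    case True
    note ex = resolution_ends(7)[OF P] and ex' = resolution_ends(7)[OF P']
    note [simp] = exact_atD(1,4)[OF ex, unfolded One_nat_def] exact_atD(1,4)[OF ex', unfolded One_nat_def]
    have "through (res_obj P 1) c (res_mor P 0) c' = {\<zero>\<^bsub>Hom C (res_obj P 1) c'\<^esub>}"
      unfolding True through_def
      by (auto simp: image_iff) (rule exI[of _ "\<zero>\<^bsub>Hom C c c'\<^esub>"], simp)
    then have "test_dim (res_obj P) (res_mor P) c' = 0"
      unfolding test_dim_def pr(2) by (simp add: hdim_zero)
    then have "hdim (res_obj P' 1) c' (through (res_obj P' 1) c' (res_mor P' 0) c') = 0"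
      using test_eq[of c'] unfolding test_dim_def pr'(2) by simp
    then have "through (res_obj P' 1) c' (res_mor P' 0) c' = {\<zero>\<^bsub>Hom C (res_obj P' 1) c'\<^esub>}"
      by (intro hdim_zero_imp through_submodule) simp_all
    moreover have "res_mor P' 0 \<in> through (res_obj P' 1) c' (res_mor P' 0) c'"
      unfolding through_def by (rule image_eqI[of _ _ "Ident C c'"]) simp_all
    ultimately have True': "res_mor P' 0 = \<zero>\<^bsub>Hom C (res_obj P' 1) c'\<^esub>" by simp
    let ?t = "fobj Fi c" and ?t' = "fobj Fi c'"
    have t: "indecomposable C ?t" "indecomposable C ?t'" using Fi_indecomposable c c' by blast+
    have bf: "built_from C T ?t" "built_from C T ?t'"
      using shifted_summand(1)[OF P True, of T] shifted_summand(1)[OF P' True', of T] by simp_all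
    have hd: "hdim ?t x (mor C ?t x) = hdim ?t' x (mor C ?t' x)" if x: "x \<in> Obj C" for x
      using shifted_summand(2)[OF P True x] shifted_summand(2)[OF P' True' x] diff[OF x] test_eq[OF x]
      unfolding cok_def by simp
    obtain e \<sigma> where e: "presentation T d e \<sigma>" "e 0 = ?t" "e 1 = ?t" "\<sigma> 0 = Ident C ?t"
      "\<And>x. x \<in> Obj C \<Longrightarrow> test_dim e \<sigma> x = hdim ?t x (mor C ?t x)"
      using trivial_presentation[OF bf(1)] by auto
    obtain e' \<sigma>' where e': "presentation T d e' \<sigma>'" "e' 0 = ?t'" "e' 1 = ?t'" "\<sigma>' 0 = Ident C ?t'"
      "\<And>x. x \<in> Obj C \<Longrightarrow> test_dim e' \<sigma>' x = hdim ?t' x (mor C ?t' x)"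
      using trivial_presentation[OF bf(2)] by auto
    have "isomorphic C (e 0) (e' 0)"
      by (rule test_dims_determine_object[OF e(1) e'(1)])
        (use t e(2-5) e'(2-5) hd indecomposable_nonzero[OF t(1)] in simp_all)
    then have "isomorphic C ?t ?t'" unfolding e(2) e'(2) .
    from functor_iso[OF F_additive this] show ?thesis by simp
  qed
qed

end

theorem corollaryB:
  fixes K :: "('k, 'r) ring_scheme"
    and C :: "('o, 'k, 'm) lin_cat"
    and F :: "('o, 'm) endofunctor"
    and d :: nat
    and angles :: "('o, 'm) sigma_seq set"
    and T :: 'o
  assumes "algebraically_closed K"
    and "odd d"
    and "angulated_category K C F d angles"
    and "hom_finite K C"
    and "split_idempotents C"
    and "calabi_yau K C F"
    and "cluster_tilting C F d angles T"
    and "\<forall>c x. indecomposable C c \<longrightarrow> indecomposable C x \<longrightarrow>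
           \<not> (nonzero_space (Hom (quotient_category C (fobj F ` add_closure C T)) c x) \<and>
              nonzero_space (Hom (quotient_category C (fobj F ` add_closure C T)) x (fobj F c)))"
  shows "\<forall>c c'. indecomposable C c \<longrightarrow> indecomposable C c' \<longrightarrow>
           index C d angles (add_closure C T) c = index C d angles (add_closure C T) c' \<longrightarrow>
           isomorphic C c c'"
proof (intro allI impI)
  fix c c'
  assume c: "indecomposable C c" "indecomposable C c'"
    and eq: "index C d angles (add_closure C T) c = index C d angles (add_closure C T) c'"
  interpret angulated_category K C F d angles by (rule assms(3))
  interpret cluster_tilting_category K C F d angles T
    by unfold_locales (rule assms(4), rule assms(5), rule assms(7))
  show "isomorphic C c c'"
    by (rule index_determines_indecomposable[OF assms(2,6) _ c eq]) (use assms(8) in blast)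
qed

end
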